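(* Let $H$ be a discrete quantum group, let $G$ be a finite normal quantum subgroup of $H$, and let $\phi$ be a generating normal state on $\ell^\infty(H)$, meaning that $\bigvee_{n\ge1}\operatorname{supp}\phi^{n}=1$. Then any positive, possibly unbounded, $P_\phi$-harmonic function on $H$ is $G$-invariant.
   Context: Discrete quantum groups. For a discrete quantum group $H$, $\ell^\infty(H)$ denotes the von Neumann algebra of bounded functions on $H$, with comultiplication $\Delta_H\colon\ell^\infty(H)\to\ell^\infty(H)\bar\otimes\ell^\infty(H)$. It is an $\ell^\infty$-direct sum $\ell^\infty(H)=\ell^\infty\text{-}\bigoplus_{s\in I}B(H_s)$ of full matrix algebras ($H_s$ finite dimensional Hilbert spaces), where $I$ is the set of equivalence classes of irreducible representations of the dual compact quantum group $\hat H$. The algebra of all (possibly unbounded) functions on $H$ is $\prod_{s\in I}B(H_s)$. The symbol $\iota$ denotes the identity map. Convolution operators and harmonic functions. For a normal state $\phi\in\ell^\infty(H)_*$, put $P_\phi=(\phi\otimes\iota)\Delta_H\colon\ell^\infty(H)\to\ell^\infty(H)$. Convolution powers are defined by $\phi^1=\phi$, $\phi^{n+1}=(\phi^n\otimes\phi)\Delta_H$, so that $P_\phi^n=P_{\phi^n}$; $\operatorname{supp}\phi^n$ is the support projection of the normal state $\phi^n$. The map $P_\phi$ can be viewed as a matrix of completely positive maps $P_{t,s}\colon B(H_s)\to B(H_t)$. A positive element $a=(a_s)_s\in\prod_{s\in I}B(H_s)$ is called a positive (possibly unbounded) $P_\phi$-harmonic function if $P_\phi(a)=a$, that is, for every $t\in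 I$ the series of positive elements $\sum_{s}P_{t,s}(a_s)$ converges in $B(H_t)$ to $a_t$. Finite normal quantum subgroups. A finite normal quantum subgroup $G$ of $H$ is given by a finite dimensional $\ell^\infty(G)$ (the function algebra, also denoted $C(G)$, of a finite quantum group) together with a surjective normal $*$-homomorphism $\pi\colon\ell^\infty(H)\to\ell^\infty(G)$ respecting the coproducts, such that the fixed point algebra $\ell^\infty(G\backslash H)=\{x\mid\alpha_l(x)=1\otimes x\}$ of the left action $\alpha_l=(\pi\otimes\iota)\Delta_H$ of $G$ on $\ell^\infty(H)$ coincides with the fixed point algebra $\ell^\infty(H/G)=\{x\mid\alpha_r(x)=x\otimes1\}$ of the right action $\alpha_r=(\iota\otimes\pi)\Delta_H$. $G$-invariance. There are partitions of $I$ into finite subsets $S$ such that $\alpha_r$ (resp. $\alpha_l$) restricts to an action of $G$ on each $\bigoplus_{s\in S}B(H_s)$; hence $\alpha_l$ and $\alpha_r$ extend to actions of $G$ on the algebra $\prod_{s\in I}B(H_s)$ of all functions on $H$. A function $a$ on $H$ is $G$-invariant if $\alpha_l(a)=1\otimes a$, equivalently $\alpha_r(a)=a\otimes1$. *)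

theory Defs
  imports
    "HOL-Analysis.Analysis"
    "HOL-Library.Function_Algebras"
    "HOL-Library.Complex_Order"
begin

section \<open>Direct products of full matrix algebras\<close>

text \<open>
  The index set \<open>I\<close> is the type \<open>'i\<close>. A family of finite dimensional Hilbert spaces
  \<open>(H\<^sub>s)\<^sub>s\<close> is given by finite orthonormal bases \<open>B s\<close>, and an operator on \<open>H\<^sub>s\<close> is
  its matrix, extended by zero outside \<open>B s \<times> B s\<close>. Thus \<open>H\<^sub>s \<otimes> K\<^sub>t\<close> has basis
  \<open>B s \<times> C t\<close>, and tensor products are associative up to rebracketing of tuples.
  Addition, subtraction and \<open>0\<close> of families are those of the function type. Its pointwise
  multiplication, \<open>1\<close> and order are not the ones of the matrix algebras and are never used here.
\<close>

type_synonym ('i, 'b) fam = "'i \<Rightarrow> 'b \<Rightarrow> 'b \<Rightarrow> complex"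

definition funs :: "('i \<Rightarrow> 'b set) \<Rightarrow> ('i, 'b) fam set" where
  "funs B = {a. \<forall>s i j. a s i j \<noteq> 0 \<longrightarrow> i \<in> B s \<and> j \<in> B s}"

definition fmult :: "('i \<Rightarrow> 'b set) \<Rightarrow> ('i, 'b) fam \<Rightarrow> ('i, 'b) fam \<Rightarrow> ('i, 'b) fam" where
  "fmult B a b = (\<lambda>s i j. \<Sum>k\<in>B s. a s i k * b s k j)"

definition fone :: "('i \<Rightarrow> 'b set) \<Rightarrow> ('i, 'b) fam" where
  "fone B = (\<lambda>s i j. if i = j \<and> i \<in> B s then 1 else 0)"

definition fadj :: "('i, 'b) fam \<Rightarrow> ('i, 'b) fam" where
  "fadj a = (\<lambda>s i j. cnj (a s j i))"

definition fscale :: "complex \<Rightarrow> ('i, 'b) fam \<Rightarrow> ('i, 'b) fam" where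
  "fscale c a = (\<lambda>s i j. c * a s i j)"

text \<open>\<open>\<langle>v, a\<^sub>s v\<rangle> \<ge> 0\<close> for all \<open>s\<close> and all \<open>v\<close> in \<open>H\<^sub>s\<close>. In the order on the complex
  numbers used here, \<open>0 \<le> z\<close> means that \<open>z\<close> is real and nonnegative.\<close>

definition fpos :: "('i \<Rightarrow> 'b set) \<Rightarrow> ('i, 'b) fam \<Rightarrow> bool" where
  "fpos B a \<longleftrightarrow> a \<in> funs B \<and>
     (\<forall>s v. 0 \<le> (\<Sum>i\<in>B s. \<Sum>j\<in>B s. cnj (v i) * a s i j * v j))"

definition fle :: "('i \<Rightarrow> 'b set) \<Rightarrow> ('i, 'b) fam \<Rightarrow> ('i, 'b) fam \<Rightarrow> bool" where
  "fle B a b \<longleftrightarrow> fpos B (b - a)"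

text \<open>The \<open>\<ell>\<^sup>\<infinity>\<close>-direct sum: the operator norms \<open>\<parallel>a\<^sub>s\<parallel>\<close> have a common bound. For bases
  \<open>B \<otimes> C\<close> as below it is the von Neumann algebraic tensor product of the
  \<open>\<ell>\<^sup>\<infinity>\<close>-direct sums for \<open>B\<close> and for \<open>C\<close>.\<close>

definition linf :: "('i \<Rightarrow> 'b set) \<Rightarrow> ('i, 'b) fam set" where
  "linf B = {a \<in> funs B. \<exists>c\<ge>0. \<forall>s v.
     (\<Sum>i\<in>B s. (cmod (\<Sum>j\<in>B s. a s i j * v j))\<^sup>2) \<le> c\<^sup>2 * (\<Sum>j\<in>B s. (cmod (v j))\<^sup>2)}"

definition linf_pos :: "('i \<Rightarrow> 'b set) \<Rightarrow> ('i, 'b) fam set" where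
  "linf_pos B = {a \<in> linf B. fpos B a}"

text \<open>The algebraic direct sum.\<close>

definition cfin :: "('i \<Rightarrow> 'b set) \<Rightarrow> ('i, 'b) fam set" where
  "cfin B = {a \<in> funs B. finite {s. a s \<noteq> 0}}"

text \<open>The component of \<open>a\<close> in \<open>B(H\<^sub>s)\<close>, regarded as a function on the whole quantum group.\<close>

definition cut :: "'i \<Rightarrow> ('i, 'b) fam \<Rightarrow> ('i, 'b) fam" where
  "cut s a = (\<lambda>t. if t = s then a t else 0)"


section \<open>Tensor products\<close>

definition btens :: "('i \<Rightarrow> 'b set) \<Rightarrow> ('j \<Rightarrow> 'c set) \<Rightarrow> 'i \<times> 'j \<Rightarrow> ('b \<times> 'c) set"
    (infixr "\<otimes>\<^sub>B" 70) where
  "B \<otimes>\<^sub>B C = (\<lambda>(s, t). B s \<times> C t)"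

definition ftens :: "('i, 'b) fam \<Rightarrow> ('j, 'c) fam \<Rightarrow> ('i \<times> 'j, 'b \<times> 'c) fam"
    (infixr "\<otimes>\<^sub>F" 70) where
  "a \<otimes>\<^sub>F b = (\<lambda>(s, t) (i, k) (j, l). a s i j * b t k l)"

text \<open>Slices \<open>(\<iota> \<otimes> \<omega>)(x)\<close> and \<open>(\<omega> \<otimes> \<iota>)(x)\<close>, where \<open>\<omega>\<close> is the functional that takes a family
  \<open>y\<close> to the matrix coefficient \<open>y t k l\<close>. Since these functionals separate points, a normal map
  \<open>T \<otimes> \<iota>\<close> is determined by \<open>(\<iota> \<otimes> \<omega>)((T \<otimes> \<iota>)(x)) = T((\<iota> \<otimes> \<omega>)(x))\<close>; this is the definition
  of the maps \<open>T \<otimes> \<iota>\<close>, \<open>\<iota> \<otimes> T\<close> and, for a functional, \<open>\<phi> \<otimes> \<iota>\<close>, \<open>\<iota> \<otimes> \<phi>\<close> below.\<close>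

definition slice1 :: "('i \<times> 'j, 'b \<times> 'c) fam \<Rightarrow> 'j \<Rightarrow> 'c \<Rightarrow> 'c \<Rightarrow> ('i, 'b) fam" where
  "slice1 x t k l = (\<lambda>s i j. x (s, t) (i, k) (j, l))"

definition slice2 :: "('i \<times> 'j, 'b \<times> 'c) fam \<Rightarrow> 'i \<Rightarrow> 'b \<Rightarrow> 'b \<Rightarrow> ('j, 'c) fam" where
  "slice2 x s i j = (\<lambda>t k l. x (s, t) (i, k) (j, l))"

definition map_id :: "(('i, 'b) fam \<Rightarrow> ('p, 'd) fam) \<Rightarrow>
    ('i \<times> 'j, 'b \<times> 'c) fam \<Rightarrow> ('p \<times> 'j, 'd \<times> 'c) fam" where
  "map_id T x = (\<lambda>(p, t) (d, k) (e, l). T (slice1 x t k l) p d e)"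

definition id_map :: "(('j, 'c) fam \<Rightarrow> ('p, 'd) fam) \<Rightarrow>
    ('i \<times> 'j, 'b \<times> 'c) fam \<Rightarrow> ('i \<times> 'p, 'b \<times> 'd) fam" where
  "id_map T x = (\<lambda>(s, p) (i, d) (j, e). T (slice2 x s i j) p d e)"

definition fun_id :: "(('i, 'b) fam \<Rightarrow> complex) \<Rightarrow>
    ('i \<times> 'j, 'b \<times> 'c) fam \<Rightarrow> ('j, 'c) fam" where
  "fun_id \<phi> x = (\<lambda>t k l. \<phi> (slice1 x t k l))"

definition id_fun :: "(('j, 'c) fam \<Rightarrow> complex) \<Rightarrow>
    ('i \<times> 'j, 'b \<times> 'c) fam \<Rightarrow> ('i, 'b) fam" where
  "id_fun \<phi> x = (\<lambda>s i j. \<phi> (slice2 x s i j))"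

definition reassoc ::
    "(('i \<times> 'j) \<times> 'k, ('b \<times> 'c) \<times> 'd) fam \<Rightarrow> ('i \<times> 'j \<times> 'k, 'b \<times> 'c \<times> 'd) fam" where
  "reassoc x = (\<lambda>(s, t, u) (i, k, m) (j, l, n). x ((s, t), u) ((i, k), m) ((j, l), n))"


section \<open>Normal homomorphisms and normal states\<close>

definition star_hom ::
    "('i \<Rightarrow> 'b set) \<Rightarrow> ('j \<Rightarrow> 'c set) \<Rightarrow> (('i, 'b) fam \<Rightarrow> ('j, 'c) fam) \<Rightarrow> bool" where
  "star_hom B C T \<longleftrightarrow>
     (\<forall>a\<in>linf B. T a \<in> linf C) \<and>
     (\<forall>a\<in>linf B. \<forall>b\<in>linf B. T (a + b) = T a + T b) \<and>
     (\<forall>c. \<forall>a\<in>linf B. T (fscale c a) = fscale c (T a)) \<and>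
     (\<forall>a\<in>linf B. \<forall>b\<in>linf B. T (fmult B a b) = fmult C (T a) (T b)) \<and>
     (\<forall>a\<in>linf B. T (fadj a) = fadj (T a))"

definition upward_directed :: "('i \<Rightarrow> 'b set) \<Rightarrow> ('i, 'b) fam set \<Rightarrow> bool" where
  "upward_directed B X \<longleftrightarrow> X \<noteq> {} \<and> (\<forall>x\<in>X. \<forall>y\<in>X. \<exists>z\<in>X. fle B x z \<and> fle B y z)"

definition is_sup :: "('i \<Rightarrow> 'b set) \<Rightarrow> ('i, 'b) fam set \<Rightarrow> ('i, 'b) fam \<Rightarrow> bool" where
  "is_sup B X x \<longleftrightarrow> x \<in> linf B \<and> (\<forall>y\<in>X. fle B y x) \<and>
     (\<forall>z\<in>linf B. (\<forall>y\<in>X. fle B y z) \<longrightarrow> fle B x z)"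

definition normal_map ::
    "('i \<Rightarrow> 'b set) \<Rightarrow> ('j \<Rightarrow> 'c set) \<Rightarrow> (('i, 'b) fam \<Rightarrow> ('j, 'c) fam) \<Rightarrow> bool" where
  "normal_map B C T \<longleftrightarrow>
     (\<forall>X x. X \<subseteq> linf_pos B \<and> upward_directed B X \<and> is_sup B X x \<longrightarrow> is_sup C (T ` X) (T x))"

definition normal_state :: "('i \<Rightarrow> 'b set) \<Rightarrow> (('i, 'b) fam \<Rightarrow> complex) \<Rightarrow> bool" where
  "normal_state B \<phi> \<longleftrightarrow>
     (\<forall>a\<in>linf B. \<forall>b\<in>linf B. \<phi> (a + b) = \<phi> a + \<phi> b) \<and>
     (\<forall>c. \<forall>a\<in>linf B. \<phi> (fscale c a) = c * \<phi> a) \<and>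
     (\<forall>a\<in>linf_pos B. 0 \<le> \<phi> a) \<and>
     \<phi> (fone B) = 1 \<and>
     (\<forall>X x. X \<subseteq> linf_pos B \<and> upward_directed B X \<and> is_sup B X x \<longrightarrow>
        Re (\<phi> x) = (SUP y\<in>X. Re (\<phi> y)))"

definition projections :: "('i \<Rightarrow> 'b set) \<Rightarrow> ('i, 'b) fam set" where
  "projections B = {p \<in> linf B. fmult B p p = p \<and> fadj p = p}"

text \<open>The support projection of a normal state is the smallest projection of value \<open>1\<close>.\<close>

definition is_support ::
    "('i \<Rightarrow> 'b set) \<Rightarrow> (('i, 'b) fam \<Rightarrow> complex) \<Rightarrow> ('i, 'b) fam \<Rightarrow> bool" where
  "is_support B \<phi> p \<longleftrightarrow> p \<in> projections B \<and> \<phi> p = 1 \<and>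
     (\<forall>q\<in>projections B. \<phi> q = 1 \<longrightarrow> fle B p q)"

definition is_join :: "('i \<Rightarrow> 'b set) \<Rightarrow> ('i, 'b) fam set \<Rightarrow> ('i, 'b) fam \<Rightarrow> bool" where
  "is_join B X p \<longleftrightarrow> p \<in> projections B \<and> (\<forall>q\<in>X. fle B q p) \<and>
     (\<forall>r\<in>projections B. (\<forall>q\<in>X. fle B q r) \<longrightarrow> fle B p r)"


section \<open>Discrete quantum groups\<close>

text \<open>
  Discrete quantum groups in the sense of Van Daele: the algebraic direct sum \<open>A\<close> of the
  \<open>B(H\<^sub>s)\<close> is a multiplier Hopf \<open>*\<close>-algebra, i.e. the linear maps on \<open>A \<otimes> A\<close> given by
  \<open>a \<otimes> b \<mapsto> \<Delta>(a)(1 \<otimes> b)\<close> and \<open>a \<otimes> b \<mapsto> (a \<otimes> 1)\<Delta>(b)\<close> are well-defined bijections of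
  \<open>A \<otimes> A\<close>. An element of \<open>A \<otimes> A\<close> is written as the sum of \<open>a \<otimes> b\<close> over a list of pairs.
  The index set is identified with that of the irreducible representations of the dual compact
  quantum group.
\<close>

locale discrete_quantum_group =
  fixes B :: "'i \<Rightarrow> 'b set" and \<Delta> :: "('i, 'b) fam \<Rightarrow> ('i \<times> 'i, 'b \<times> 'b) fam"
  assumes finite_dim: "\<And>s. finite (B s)"
    and nonzero_dim: "\<And>s. B s \<noteq> {}"
    and comult_hom: "star_hom B (B \<otimes>\<^sub>B B) \<Delta>"
    and comult_one: "\<Delta> (fone B) = fone (B \<otimes>\<^sub>B B)"
    and comult_normal: "normal_map B (B \<otimes>\<^sub>B B) \<Delta>"
    and coassoc: "\<And>a. a \<in> linf B \<Longrightarrow> reassoc (map_id \<Delta> (\<Delta> a)) = id_map \<Delta> (\<Delta> a)"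
    and T1_surj:
      "{(\<Sum>(a, b)\<leftarrow>ps. fmult (B \<otimes>\<^sub>B B) (\<Delta> a) (fone B \<otimes>\<^sub>F b)) |ps. ps \<in> lists (cfin B \<times> cfin B)}
         = cfin (B \<otimes>\<^sub>B B)"
    and T1_inj: "\<And>ps. ps \<in> lists (cfin B \<times> cfin B) \<Longrightarrow>
      (\<Sum>(a, b)\<leftarrow>ps. fmult (B \<otimes>\<^sub>B B) (\<Delta> a) (fone B \<otimes>\<^sub>F b)) = 0 \<Longrightarrow> (\<Sum>(a, b)\<leftarrow>ps. a \<otimes>\<^sub>F b) = 0"
    and T2_surj:
      "{(\<Sum>(a, b)\<leftarrow>ps. fmult (B \<otimes>\<^sub>B B) (a \<otimes>\<^sub>F fone B) (\<Delta> b)) |ps. ps \<in> lists (cfin B \<times> cfin B)}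
         = cfin (B \<otimes>\<^sub>B B)"
    and T2_inj: "\<And>ps. ps \<in> lists (cfin B \<times> cfin B) \<Longrightarrow>
      (\<Sum>(a, b)\<leftarrow>ps. fmult (B \<otimes>\<^sub>B B) (a \<otimes>\<^sub>F fone B) (\<Delta> b)) = 0 \<Longrightarrow> (\<Sum>(a, b)\<leftarrow>ps. a \<otimes>\<^sub>F b) = 0"

text \<open>A finite quantum group is a discrete quantum group with finite dimensional function algebra.\<close>

locale finite_quantum_group = discrete_quantum_group B \<Delta>
  for B :: "'i \<Rightarrow> 'b set" and \<Delta> :: "('i, 'b) fam \<Rightarrow> ('i \<times> 'i, 'b \<times> 'b) fam" +
  assumes finite_index: "finite (UNIV :: 'i set)"

definition left_action ::
    "(('i, 'b) fam \<Rightarrow> ('i \<times> 'i, 'b \<times> 'b) fam) \<Rightarrow> (('i, 'b) fam \<Rightarrow> ('j, 'c) fam) \<Rightarrow>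
     ('i, 'b) fam \<Rightarrow> ('j \<times> 'i, 'c \<times> 'b) fam" where
  "left_action \<Delta> \<pi> x = map_id \<pi> (\<Delta> x)"

definition right_action ::
    "(('i, 'b) fam \<Rightarrow> ('i \<times> 'i, 'b \<times> 'b) fam) \<Rightarrow> (('i, 'b) fam \<Rightarrow> ('j, 'c) fam) \<Rightarrow>
     ('i, 'b) fam \<Rightarrow> ('i \<times> 'j, 'b \<times> 'c) fam" where
  "right_action \<Delta> \<pi> x = id_map \<pi> (\<Delta> x)"

locale finite_normal_quantum_subgroup =
  H: discrete_quantum_group BH \<Delta>H + G: finite_quantum_group BG \<Delta>G
  for BH :: "'i \<Rightarrow> 'b set" and \<Delta>H :: "('i, 'b) fam \<Rightarrow> ('i \<times> 'i, 'b \<times> 'b) fam"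
    and BG :: "'j \<Rightarrow> 'c set" and \<Delta>G :: "('j, 'c) fam \<Rightarrow> ('j \<times> 'j, 'c \<times> 'c) fam" +
  fixes \<pi> :: "('i, 'b) fam \<Rightarrow> ('j, 'c) fam"
  assumes res_hom: "star_hom BH BG \<pi>"
    and res_normal: "normal_map BH BG \<pi>"
    and res_surj: "\<pi> ` linf BH = linf BG"
    and res_comult: "\<And>a. a \<in> linf BH \<Longrightarrow> \<Delta>G (\<pi> a) = map_id \<pi> (id_map \<pi> (\<Delta>H a))"
    and fixed_points_eq:
      "{x \<in> linf BH. left_action \<Delta>H \<pi> x = fone BG \<otimes>\<^sub>F x}
         = {x \<in> linf BH. right_action \<Delta>H \<pi> x = x \<otimes>\<^sub>F fone BG}"


section \<open>Random walks and invariance\<close>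

definition conv_op ::
    "(('i, 'b) fam \<Rightarrow> ('i \<times> 'i, 'b \<times> 'b) fam) \<Rightarrow> (('i, 'b) fam \<Rightarrow> complex) \<Rightarrow>
     ('i, 'b) fam \<Rightarrow> ('i, 'b) fam" where
  "conv_op \<Delta> \<phi> a = fun_id \<phi> (\<Delta> a)"

definition conv ::
    "(('i, 'b) fam \<Rightarrow> ('i \<times> 'i, 'b \<times> 'b) fam) \<Rightarrow> (('i, 'b) fam \<Rightarrow> complex) \<Rightarrow>
     (('i, 'b) fam \<Rightarrow> complex) \<Rightarrow> ('i, 'b) fam \<Rightarrow> complex" where
  "conv \<Delta> \<phi> \<psi> a = \<phi> (id_fun \<psi> (\<Delta> a))"

text \<open>\<open>conv_pow_Suc \<Delta> \<phi> n\<close> is the convolution power \<open>\<phi>\<^sup>n\<^sup>+\<^sup>1\<close>.\<close>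

primrec conv_pow_Suc ::
    "(('i, 'b) fam \<Rightarrow> ('i \<times> 'i, 'b \<times> 'b) fam) \<Rightarrow> (('i, 'b) fam \<Rightarrow> complex) \<Rightarrow> nat \<Rightarrow>
     ('i, 'b) fam \<Rightarrow> complex" where
  "conv_pow_Suc \<Delta> \<phi> 0 = \<phi>"
| "conv_pow_Suc \<Delta> \<phi> (Suc n) = conv \<Delta> (conv_pow_Suc \<Delta> \<phi> n) \<phi>"

definition generating ::
    "('i \<Rightarrow> 'b set) \<Rightarrow> (('i, 'b) fam \<Rightarrow> ('i \<times> 'i, 'b \<times> 'b) fam) \<Rightarrow>
     (('i, 'b) fam \<Rightarrow> complex) \<Rightarrow> bool" where
  "generating B \<Delta> \<phi> \<longleftrightarrow> is_join B {p. \<exists>n. is_support B (conv_pow_Suc \<Delta> \<phi> n) p} (fone B)"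

text \<open>
  For \<open>T\<close> defined on bounded functions, with matrix coefficients \<open>T\<^sub>u\<^sub>,\<^sub>s\<close> on \<open>B(H\<^sub>s)\<close>, this
  says that \<open>\<Sum>\<^sub>s T\<^sub>u\<^sub>,\<^sub>s(a\<^sub>s)\<close> converges to \<open>x\<^sub>u\<close> for every \<open>u\<close>, i.e. that \<open>T(a) = x\<close> for the
  possibly unbounded functions \<open>a\<close> and \<open>x\<close>. Convergence of matrices is convergence of entries.
\<close>

definition extends_to ::
    "(('i, 'b) fam \<Rightarrow> ('j, 'c) fam) \<Rightarrow> ('i, 'b) fam \<Rightarrow> ('j, 'c) fam \<Rightarrow> bool" where
  "extends_to T a x \<longleftrightarrow> (\<forall>u k l. ((\<lambda>s. T (cut s a) u k l) has_sum x u k l) UNIV)"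

definition positive_harmonic ::
    "('i \<Rightarrow> 'b set) \<Rightarrow> (('i, 'b) fam \<Rightarrow> ('i \<times> 'i, 'b \<times> 'b) fam) \<Rightarrow>
     (('i, 'b) fam \<Rightarrow> complex) \<Rightarrow> ('i, 'b) fam \<Rightarrow> bool" where
  "positive_harmonic B \<Delta> \<phi> a \<longleftrightarrow> fpos B a \<and> extends_to (conv_op \<Delta> \<phi>) a a"

text \<open>The extension of \<open>\<alpha>\<^sub>l\<close> to all functions acts separately on finite direct sums of blocks
  \<open>B(H\<^sub>s)\<close>, so here the sums in \<open>extends_to\<close> have only finitely many nonzero terms.\<close>

definition G_invariant ::
    "(('i, 'b) fam \<Rightarrow> ('i \<times> 'i, 'b \<times> 'b) fam) \<Rightarrow> ('j \<Rightarrow> 'c set) \<Rightarrow>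
     (('i, 'b) fam \<Rightarrow> ('j, 'c) fam) \<Rightarrow> ('i, 'b) fam \<Rightarrow> bool" where
  "G_invariant \<Delta> BG \<pi> a \<longleftrightarrow> extends_to (left_action \<Delta> \<pi>) a (fone BG \<otimes>\<^sub>F a)"

end

theory Submission
  imports Defs
begin

text \<open>
  For normal functionals \<open>\<omega>\<close> and \<open>\<tau>\<close> on \<open>\<ell>\<^sup>\<infinity>(H)\<close> write \<open>\<omega> \<star> \<tau> = (\<omega> \<otimes> \<tau>)\<Delta>\<close>. A positive normal
  functional \<open>\<tau>\<close> has a value \<open>\<tau>(a) = \<Sum>\<^sub>s \<tau>(a\<^sub>s)\<close> in \<open>[0, \<infinity>]\<close> on a positive unbounded
  function \<open>a\<close>, and \<open>a\<close> is harmonic iff \<open>(\<phi> \<star> \<tau>)(a) = \<tau>(a)\<close> for all \<open>\<tau>\<close>. Then also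
  \<open>(\<psi> \<star> \<tau>)(a) = \<tau>(a)\<close> for every mean \<open>\<psi>\<close> of convolution powers of \<open>\<phi>\<close>.

  Let \<open>h\<close> be the Haar state of \<open>G\<close> and \<open>\<omega> = h \<circ> \<pi>\<close>, so that \<open>\<omega> \<star> \<omega> = \<omega>\<close>. Two facts carry the
  proof.

  \<^item> \<open>\<omega>\<close> is central for \<open>\<star>\<close> (lemma \<open>averaging_central\<close>). The maps \<open>(\<omega> \<otimes> \<iota>)\<Delta>\<close> and \<open>(\<iota> \<otimes> \<omega>)\<Delta>\<close>
    are commuting projections onto \<open>\<ell>\<^sup>\<infinity>(G\H)\<close> and \<open>\<ell>\<^sup>\<infinity>(H/G)\<close>. These algebras coincide by
    normality, and commuting projections with the same range are equal.
  \<^item> \<open>c \<omega> \<le> \<psi>\<close> for some \<open>c > 0\<close> and some mean \<open>\<psi>\<close> of finitely many convolution powers (lemmas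
    \<open>generating_faithful\<close> and \<open>averaging_dominated\<close>). Indeed \<open>\<omega>\<close> lives on finitely many matrix
    blocks, the powers are jointly faithful since \<open>\<phi>\<close> is generating, and the unit spheres of
    the blocks are compact.

  Put \<open>\<rho> = \<psi> - c \<omega> \<ge> 0\<close> and suppose that \<open>\<tau>(a) \<ge> k (\<omega> \<star> \<tau>)(a)\<close> for all \<open>\<tau>\<close>; this holds for
  \<open>k = 0\<close>. By centrality \<open>(\<omega> \<star> \<rho> \<star> \<tau>)(a) = (1 - c) (\<omega> \<star> \<tau>)(a)\<close>, so the assumption for
  \<open>\<rho> \<star> \<tau>\<close> gives \<open>\<tau>(a) = c (\<omega> \<star> \<tau>)(a) + (\<rho> \<star> \<tau>)(a) \<ge> (c + (1 - c) k) (\<omega> \<star> \<tau>)(a)\<close>. Iterating,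
  \<open>k\<close> tends to \<open>1\<close>. Hence \<open>a \<ge> b\<close>, where \<open>b = (\<omega> \<otimes> \<iota>)\<Delta>(a)\<close> is the average of \<open>a\<close> over \<open>G\<close>. The
  average of \<open>a - b \<ge> 0\<close> vanishes. As \<open>h\<close> is faithful and \<open>(x \<otimes> y) \<mapsto> (x \<otimes> 1)\<Delta>(y)\<close> is
  injective, this forces \<open>a = b\<close> (lemma \<open>averaging_fixes_harmonic\<close>), and averages are
  \<open>G\<close>-invariant.

  The Haar state (lemma \<open>haar_state\<close>) is the limit of the convolution powers of the normalized
  trace \<open>\<theta>\<close> of \<open>C(G)\<close>. Injectivity of the two canonical maps and compactness provide a
  \<open>\<delta> > 0\<close> with \<open>\<theta> \<star> \<tau> \<ge> \<delta> \<theta>\<close> and \<open>\<tau> \<star> \<theta> \<ge> \<delta> \<theta>\<close> for all states \<open>\<tau>\<close>, and by Doeblin's argument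
  convolution with \<open>\<theta>\<close> contracts distances between states by the factor \<open>1 - \<delta>\<close>. The
  rules of calculation for \<open>\<star>\<close>, such as associativity, rest on one principle: normal functionals which
  agree on matrix units are equal.
\<close>

section \<open>Bounded and positive families of matrices\<close>

text \<open>
  The matrix element \<open>\<langle>w, x\<^sub>s v\<rangle>\<close>, conjugate linear in \<open>w\<close>.
\<close>

definition sesq :: "('i \<Rightarrow> 'b set) \<Rightarrow> 'i \<Rightarrow> ('b \<Rightarrow> complex) \<Rightarrow> ('b \<Rightarrow> complex) \<Rightarrow>
    ('i, 'b) fam \<Rightarrow> complex" where
  "sesq B s w v x = (\<Sum>i\<in>B s. \<Sum>j\<in>B s. cnj (w i) * x s i j * v j)"

definition sqnorm :: "('i \<Rightarrow> 'b set) \<Rightarrow> 'i \<Rightarrow> ('b \<Rightarrow> complex) \<Rightarrow> real" where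
  "sqnorm B s v = (\<Sum>i\<in>B s. (cmod (v i))\<^sup>2)"

definition basis_vec :: "'b \<Rightarrow> 'b \<Rightarrow> complex" where
  "basis_vec i = (\<lambda>j. if j = i then 1 else 0)"

definition fd :: "('i \<Rightarrow> 'b set) \<Rightarrow> bool" where
  "fd B \<longleftrightarrow> (\<forall>s. finite (B s))"

lemma fdD: "fd B \<Longrightarrow> finite (B s)"
  by (simp add: fd_def)

lemma fd_tens: "fd B \<Longrightarrow> fd C \<Longrightarrow> fd (B \<otimes>\<^sub>B C)"
  by (auto simp: fd_def btens_def)

lemma sum_fun_apply: "sum f A x = (\<Sum>a\<in>A. f a x)"
  for f :: "'a \<Rightarrow> 'x \<Rightarrow> 'y::comm_monoid_add"
  by (induction A rule: infinite_finite_induct) auto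

lemma fam_sum_apply: "sum f A s i j = (\<Sum>a\<in>A. f a s i j)" for f :: "'a \<Rightarrow> ('i, 'b) fam"
  by (simp add: sum_fun_apply)

lemma fscale_apply [simp]: "fscale c x s i j = c * x s i j"
  by (simp add: fscale_def)

lemma sesq_add: "sesq B s w v (x + y) = sesq B s w v x + sesq B s w v y"
  by (simp add: sesq_def algebra_simps sum.distrib)

lemma sesq_diff: "sesq B s w v (x - y) = sesq B s w v x - sesq B s w v y"
  by (simp add: sesq_def algebra_simps sum_subtractf)

lemma sesq_scale: "sesq B s w v (fscale c x) = c * sesq B s w v x"
  by (simp add: sesq_def algebra_simps sum_distrib_left)

lemma sesq_zero [simp]: "sesq B s w v 0 = 0"
  by (simp add: sesq_def)

lemma sesq_add_right: "sesq B s w (\<lambda>i. v i + u i) x = sesq B s w v x + sesq B s w u x"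
  by (simp add: sesq_def algebra_simps sum.distrib)

lemma sesq_add_left: "sesq B s (\<lambda>i. v i + u i) w x = sesq B s v w x + sesq B s u w x"
  by (simp add: sesq_def algebra_simps sum.distrib)

lemma sesq_scale_right: "sesq B s w (\<lambda>i. c * v i) x = c * sesq B s w v x"
  by (simp add: sesq_def algebra_simps sum_distrib_left)

lemma sesq_scale_left: "sesq B s (\<lambda>i. c * w i) v x = cnj c * sesq B s w v x"
  by (simp add: sesq_def algebra_simps sum_distrib_left)

lemma sesq_polarization:
  "4 * sesq B s w v x = sesq B s (\<lambda>i. w i + v i) (\<lambda>i. w i + v i) x
     - sesq B s (\<lambda>i. w i + (-1) * v i) (\<lambda>i. w i + (-1) * v i) x
     - \<i> * sesq B s (\<lambda>i. w i + \<i> * v i) (\<lambda>i. w i + \<i> * v i) x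
     + \<i> * sesq B s (\<lambda>i. w i + (-\<i>) * v i) (\<lambda>i. w i + (-\<i>) * v i) x"
  unfolding sesq_add_left sesq_add_right sesq_scale_left sesq_scale_right
  by (simp add: complex_eq_iff)

lemma sesq_basis_right:
  assumes "fd B" "j \<in> B s"
  shows "sesq B s w (basis_vec j) x = (\<Sum>i\<in>B s. cnj (w i) * x s i j)"
  using assms by (simp add: sesq_def basis_vec_def fdD if_distrib if_distribR cong: if_cong)

lemma sesq_basis:
  assumes "fd B" "i \<in> B s" "j \<in> B s"
  shows "sesq B s (basis_vec i) (basis_vec j) x = x s i j"
  using assms by (simp add: sesq_basis_right)
    (simp add: basis_vec_def fdD if_distrib if_distribR cong: if_cong)

lemma sqnorm_nonneg [simp]: "0 \<le> sqnorm B s v"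
  by (simp add: sqnorm_def sum_nonneg)

lemma sqnorm_scale: "sqnorm B s (\<lambda>i. c * v i) = (cmod c)\<^sup>2 * sqnorm B s v"
  by (simp add: sqnorm_def norm_mult power_mult_distrib sum_distrib_left)

lemma sqnorm_eq_0_iff: "fd B \<Longrightarrow> sqnorm B s v = 0 \<longleftrightarrow> (\<forall>i\<in>B s. v i = 0)"
  by (simp add: sqnorm_def fdD sum_nonneg_eq_0_iff)

lemma sesq_self_sqnorm: "(\<Sum>i\<in>B s. cnj (v i) * v i) = of_real (sqnorm B s v)"
  unfolding sqnorm_def of_real_sum by (intro sum.cong refl) (metis complex_norm_square mult.commute of_real_power)

lemma cmod_sq_expand: "(cmod (a + b))\<^sup>2 = (cmod a)\<^sup>2 + (cmod b)\<^sup>2 + 2 * Re (a * cnj b)"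
  unfolding cmod_power2 by (simp add: power2_eq_square algebra_simps)

lemma sqnorm_parallelogram:
  "sqnorm B s (\<lambda>i. w i + v i) + sqnorm B s (\<lambda>i. w i + (-1) * v i)
   + sqnorm B s (\<lambda>i. w i + \<i> * v i) + sqnorm B s (\<lambda>i. w i + (-\<i>) * v i)
   = 4 * (sqnorm B s w + sqnorm B s v)"
  unfolding sqnorm_def sum.distrib[symmetric] sum_distrib_left cmod_sq_expand
  by (intro sum.cong refl) (simp add: norm_mult cmod_power2)

lemma funs_add: "x \<in> funs B \<Longrightarrow> y \<in> funs B \<Longrightarrow> x + y \<in> funs B"
  by (simp add: funs_def) (metis add.right_neutral)

lemma funs_scale: "x \<in> funs B \<Longrightarrow> fscale c x \<in> funs B"
  by (auto simp: funs_def)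

lemma funs_diff: "x \<in> funs B \<Longrightarrow> y \<in> funs B \<Longrightarrow> x - y \<in> funs B"
  by (simp add: funs_def) (metis diff_self)

lemma funs_zero: "x \<in> funs B \<Longrightarrow> i \<notin> B s \<or> j \<notin> B s \<Longrightarrow> x s i j = 0"
  by (auto simp: funs_def)

lemma funsI: "(\<And>s i j. i \<notin> B s \<or> j \<notin> B s \<Longrightarrow> x s i j = 0) \<Longrightarrow> x \<in> funs B"
  by (auto simp: funs_def)

lemma sesq_bound:
  assumes q: "\<And>v. cmod (sesq B s v v x) \<le> c * sqnorm B s v"
  shows "cmod (sesq B s w v x) \<le> c * (sqnorm B s w + sqnorm B s v)"
proof -
  let ?u = "\<lambda>c i. w i + c * v i"
  let ?q = "\<lambda>u. sesq B s u u x"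
  have "cmod (4 * sesq B s w v x) = cmod (?q (\<lambda>i. w i + v i) - ?q (?u (-1)) - \<i> * ?q (?u \<i>) + \<i> * ?q (?u (-\<i>)))"
    unfolding sesq_polarization ..
  also have "\<dots> \<le> cmod (?q (\<lambda>i. w i + v i)) + cmod (?q (?u (-1))) + cmod (\<i> * ?q (?u \<i>)) + cmod (\<i> * ?q (?u (-\<i>)))"
    by (meson add_mono norm_triangle_ineq norm_triangle_ineq4 order_trans order_refl)
  also have "\<dots> \<le> c * sqnorm B s (\<lambda>i. w i + v i) + c * sqnorm B s (?u (-1)) + c * sqnorm B s (?u \<i>) + c * sqnorm B s (?u (-\<i>))"
    unfolding norm_mult using q by (intro add_mono) auto
  also have "\<dots> = 4 * (c * (sqnorm B s w + sqnorm B s v))"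
    using sqnorm_parallelogram[of B s w v] by (simp only: distrib_left[symmetric] mult.left_commute[of 4 c])
  finally show ?thesis by (simp add: norm_mult)
qed

text \<open>
  A bound on the quadratic forms \<open>\<langle>v, x\<^sub>s v\<rangle>\<close> gives one on the norms \<open>\<parallel>x\<^sub>s\<parallel>\<close> by polarization.
  Boundedness in terms of quadratic forms is compatible with sums, adjoints and the order.
\<close>

lemma linf_iff:
  "x \<in> linf B \<longleftrightarrow> x \<in> funs B \<and> (\<exists>c. \<forall>s v. cmod (sesq B s v v x) \<le> c * sqnorm B s v)"
proof safe
  assume x: "x \<in> linf B"
  then show "x \<in> funs B" by (simp add: linf_def)
  from x obtain c where c: "\<And>s v. (\<Sum>i\<in>B s. (cmod (\<Sum>j\<in>B s. x s i j * v j))\<^sup>2) \<le> c\<^sup>2 * (\<Sum>j\<in>B s. (cmod (v j))\<^sup>2)"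
    by (auto simp: linf_def)
  have "cmod (sesq B s v v x) \<le> ((1 + c\<^sup>2) / 2) * sqnorm B s v" for s v
  proof -
    have "sesq B s v v x = (\<Sum>i\<in>B s. cnj (v i) * (\<Sum>j\<in>B s. x s i j * v j))"
      by (simp add: sesq_def sum_distrib_left mult.assoc)
    also have "cmod \<dots> \<le> (\<Sum>i\<in>B s. cmod (v i) * cmod (\<Sum>j\<in>B s. x s i j * v j))"
      by (rule sum_norm_le) (simp add: norm_mult)
    also have "\<dots> \<le> (\<Sum>i\<in>B s. (cmod (v i))\<^sup>2 / 2 + (cmod (\<Sum>j\<in>B s. x s i j * v j))\<^sup>2 / 2)"
    proof (rule sum_mono)
      fix i show "cmod (v i) * cmod (\<Sum>j\<in>B s. x s i j * v j) \<le> (cmod (v i))\<^sup>2 / 2 + (cmod (\<Sum>j\<in>B s. x s i j * v j))\<^sup>2 / 2"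
        using sum_squares_bound[of "cmod (v i)" "cmod (\<Sum>j\<in>B s. x s i j * v j)"] by simp
    qed
    also have "\<dots> \<le> ((1 + c\<^sup>2) / 2) * sqnorm B s v"
      using c[of s v] by (simp add: sum.distrib sum_divide_distrib[symmetric] sqnorm_def field_simps)
    finally show ?thesis .
  qed
  then show "\<exists>c. \<forall>s v. cmod (sesq B s v v x) \<le> c * sqnorm B s v" by blast
next
  fix c assume x: "x \<in> funs B" and c: "\<forall>s v. cmod (sesq B s v v x) \<le> c * sqnorm B s v"
  define d where "d = \<bar>c\<bar> + 1"
  have d: "d \<ge> 1" "c \<le> d" by (auto simp: d_def)
  have cd: "cmod (sesq B s v v x) \<le> d * sqnorm B s v" for s v
    using c[rule_format, of s v] d mult_right_mono[of c d "sqnorm B s v"] by simp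
  have "(\<Sum>i\<in>B s. (cmod (\<Sum>j\<in>B s. x s i j * v j))\<^sup>2) \<le> (2 * d)\<^sup>2 * (\<Sum>j\<in>B s. (cmod (v j))\<^sup>2)" for s v
  proof -
    \<comment> \<open>Pairing \<open>x v\<close> with the multiple \<open>(2d)\<^sup>-\<^sup>1 x v\<close> of itself turns the bound on the
      sesquilinear form into a bound on the norm of \<open>x v\<close>.\<close>
    define y where "y = (\<lambda>i. \<Sum>j\<in>B s. x s i j * v j)"
    define t where "t = 1 / (2 * d)"
    have t: "t > 0" "t * d = 1/2" using d by (auto simp: t_def)
    have "sesq B s (\<lambda>i. of_real t * y i) v x = of_real t * (\<Sum>i\<in>B s. cnj (y i) * y i)"
      by (simp add: sesq_scale_left) (simp add: sesq_def y_def sum_distrib_left mult.assoc)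
    then have "sesq B s (\<lambda>i. of_real t * y i) v x = of_real (t * sqnorm B s y)"
      by (simp add: sesq_self_sqnorm)
    then have "t * sqnorm B s y \<le> d * (sqnorm B s (\<lambda>i. of_real t * y i) + sqnorm B s v)"
      using sesq_bound[OF cd, of s "\<lambda>i. of_real t * y i" v] t by (simp add: norm_mult)
    also have "\<dots> = (t * d) * (t * sqnorm B s y) + d * sqnorm B s v"
      by (simp add: sqnorm_scale algebra_simps power2_eq_square)
    finally have "t * sqnorm B s y \<le> 2 * d * sqnorm B s v" using t by simp
    then have "sqnorm B s y \<le> (2 * d) * (2 * d * sqnorm B s v)"
      using d by (simp add: t_def field_simps)
    then show ?thesis by (simp add: y_def sqnorm_def power2_eq_square algebra_simps)
  qed
  then show "x \<in> linf B" using x d unfolding linf_def by (auto intro!: exI[of _ "2 * d"])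
qed

lemma linf_funs: "x \<in> linf B \<Longrightarrow> x \<in> funs B"
  by (simp add: linf_iff)

lemma linf_obtain:
  assumes "x \<in> linf B"
  obtains c where "c \<ge> 0" "\<And>s v. cmod (sesq B s v v x) \<le> c * sqnorm B s v"
proof -
  obtain c where c: "\<And>s v. cmod (sesq B s v v x) \<le> c * sqnorm B s v"
    using assms by (auto simp: linf_iff)
  have "cmod (sesq B s v v x) \<le> \<bar>c\<bar> * sqnorm B s v" for s v
    using c[of s v] mult_right_mono[of c "\<bar>c\<bar>" "sqnorm B s v"] by (fastforce intro: order_trans)
  then show thesis using that[of "\<bar>c\<bar>"] by simp
qed

lemma linf_add: "x \<in> linf B \<Longrightarrow> y \<in> linf B \<Longrightarrow> x + y \<in> linf B"
proof -
  assume x: "x \<in> linf B" and y: "y \<in> linf B"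
  obtain c d where "\<And>s v. cmod (sesq B s v v x) \<le> c * sqnorm B s v" "\<And>s v. cmod (sesq B s v v y) \<le> d * sqnorm B s v"
    using linf_obtain[OF x] linf_obtain[OF y] by metis
  then have "cmod (sesq B s v v (x + y)) \<le> (c + d) * sqnorm B s v" for s v
    unfolding sesq_add by (metis add_mono distrib_right norm_triangle_mono)
  then show ?thesis using x y by (auto simp: linf_iff funs_add)
qed

lemma linf_scale: "x \<in> linf B \<Longrightarrow> fscale c x \<in> linf B"
proof -
  assume x: "x \<in> linf B"
  obtain d where "\<And>s v. cmod (sesq B s v v x) \<le> d * sqnorm B s v"
    using linf_obtain[OF x] by metis
  then have "cmod (sesq B s v v (fscale c x)) \<le> (cmod c * d) * sqnorm B s v" for s v
    unfolding sesq_scale by (simp add: norm_mult mult.assoc mult_left_mono)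
  then show ?thesis using x by (auto simp: linf_iff funs_scale)
qed

lemma linf_zero [simp]: "0 \<in> linf B"
  by (auto simp: linf_iff funs_def intro: exI[of _ 0])

lemma fam_diff_conv: "x - y = x + fscale (-1) y" for x :: "('i, 'b) fam"
  by (intro ext) simp

lemma linf_diff: "x \<in> linf B \<Longrightarrow> y \<in> linf B \<Longrightarrow> x - y \<in> linf B"
  unfolding fam_diff_conv by (intro linf_add linf_scale)

lemma linf_sum: "(\<And>a. a \<in> A \<Longrightarrow> f a \<in> linf B) \<Longrightarrow> (\<Sum>a\<in>A. f a) \<in> linf B"
  by (induction A rule: infinite_finite_induct) (auto intro: linf_add)

lemma fpos_iff: "fpos B x \<longleftrightarrow> x \<in> funs B \<and> (\<forall>s v. 0 \<le> sesq B s v v x)"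
  by (simp add: fpos_def sesq_def)

lemma fposD: "fpos B x \<Longrightarrow> 0 \<le> sesq B s v v x"
  by (simp add: fpos_iff)

lemma fle_iff: "x \<in> funs B \<Longrightarrow> y \<in> funs B \<Longrightarrow>
    fle B x y \<longleftrightarrow> (\<forall>s v. sesq B s v v x \<le> sesq B s v v y)"
  by (auto simp: fle_def fpos_iff funs_diff sesq_diff)

lemma linf_pos_iff: "x \<in> linf_pos B \<longleftrightarrow> x \<in> linf B \<and> fpos B x"
  by (simp add: linf_pos_def)

lemma linf_posD: "x \<in> linf_pos B \<Longrightarrow> x \<in> linf B"
  by (simp add: linf_pos_def)

lemma linf_pos_add: "x \<in> linf_pos B \<Longrightarrow> y \<in> linf_pos B \<Longrightarrow> x + y \<in> linf_pos B"
  by (simp add: linf_pos_iff linf_add fpos_iff sesq_add funs_add)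

lemma linf_pos_zero [simp]: "0 \<in> linf_pos B"
  by (simp add: linf_pos_iff fpos_iff) (simp add: funs_def)

lemma linf_pos_sum: "(\<And>a. a \<in> A \<Longrightarrow> f a \<in> linf_pos B) \<Longrightarrow> (\<Sum>a\<in>A. f a) \<in> linf_pos B"
  by (induction A rule: infinite_finite_induct) (auto intro: linf_pos_add)

lemma fpos_dominated_linf:
  assumes "fpos B y" and x: "x \<in> linf B" and le: "\<And>s v. sesq B s v v y \<le> sesq B s v v x"
  shows "y \<in> linf_pos B"
proof -
  obtain c where "\<And>s v. cmod (sesq B s v v x) \<le> c * sqnorm B s v"
    using linf_obtain[OF x] by metis
  moreover have "cmod (sesq B s v v y) \<le> cmod (sesq B s v v x)" for s v
    using fposD[OF assms(1), of s v] le[of s v] by (simp add: less_eq_complex_def cmod_eq_Re)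
  ultimately show ?thesis using assms(1)
    by (meson fpos_iff linf_iff linf_pos_iff order_trans)
qed

lemma fone_funs [simp]: "fone B \<in> funs B"
  by (auto simp: funs_def fone_def)

lemma sesq_fone: "fd B \<Longrightarrow> sesq B s w v (fone B) = (\<Sum>i\<in>B s. cnj (w i) * v i)"
  by (auto simp: sesq_def fone_def fdD if_distrib if_distribR intro!: sum.cong cong: if_cong)

lemma sesq_fone_self: "fd B \<Longrightarrow> sesq B s v v (fone B) = of_real (sqnorm B s v)"
  by (simp add: sesq_fone sesq_self_sqnorm)

lemma fone_linf_pos: "fd B \<Longrightarrow> fone B \<in> linf_pos B"
  by (auto simp: linf_pos_iff linf_iff fpos_iff sesq_fone_self less_eq_complex_def intro: exI[of _ 1])

lemma fone_linf: "fd B \<Longrightarrow> fone B \<in> linf B"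
  by (simp add: fone_linf_pos linf_posD)

lemma sesq_adj: "sesq B s w v (fadj x) = cnj (sesq B s v w x)"
  unfolding sesq_def fadj_def by (subst sum.swap) (simp add: mult.commute mult.left_commute)

lemma linf_adj: "x \<in> linf B \<Longrightarrow> fadj x \<in> linf B"
  by (auto simp: linf_iff sesq_adj) (auto simp: funs_def fadj_def)

lemma linf_pos_shift:
  assumes fd: "fd B" and x: "x \<in> linf B" and herm: "fadj x = x"
    and c: "\<And>s v. cmod (sesq B s v v x) \<le> c * sqnorm B s v"
  shows "x + fscale (of_real c) (fone B) \<in> linf_pos B"
proof -
  have "0 \<le> sesq B s v v (x + fscale (of_real c) (fone B))" for s v
  proof -
    have im: "Im (sesq B s v v x) = 0"
      using sesq_adj[of B s v v x] herm by (metis complex_cnj_cancel_iff complex_is_Real_iff Reals_cnj_iff)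
    have "- (c * sqnorm B s v) \<le> Re (sesq B s v v x)"
      using c[of s v] abs_Re_le_cmod[of "sesq B s v v x"] by linarith
    then show ?thesis by (simp add: sesq_add sesq_scale sesq_fone_self fd less_eq_complex_def im)
  qed
  moreover have "x + fscale (of_real c) (fone B) \<in> linf B"
    by (intro linf_add linf_scale x fone_linf fd)
  ultimately show ?thesis by (simp add: linf_pos_iff fpos_iff linf_funs)
qed

text \<open>
  A bounded function is a combination of two hermitian ones, and a hermitian one becomes
  positive after adding a multiple of \<open>1\<close>.
\<close>

lemma linf_induct [consumes 2, case_names pos add scale]:
  assumes fd: "fd B" and x: "x \<in> linf B"
    and pos: "\<And>a. a \<in> linf_pos B \<Longrightarrow> P a"
    and add: "\<And>a b. a \<in> linf B \<Longrightarrow> b \<in> linf B \<Longrightarrow> P a \<Longrightarrow> P b \<Longrightarrow> P (a + b)"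
    and scale: "\<And>c a. a \<in> linf B \<Longrightarrow> P a \<Longrightarrow> P (fscale c a)"
  shows "P x"
proof -
  have herm: "P h" if h: "h \<in> linf B" "fadj h = h" for h
  proof -
    obtain c where c: "\<And>s v. cmod (sesq B s v v h) \<le> c * sqnorm B s v"
      using linf_obtain[OF h(1)] by metis
    have p: "h + fscale (of_real c) (fone B) \<in> linf_pos B"
      by (rule linf_pos_shift[OF fd h c])
    have "h = (h + fscale (of_real c) (fone B)) + fscale (- of_real c) (fone B)"
      by (intro ext) simp
    moreover have "P ((h + fscale (of_real c) (fone B)) + fscale (- of_real c) (fone B))"
      using p by (intro add pos scale linf_scale fone_linf fone_linf_pos fd) (auto simp: linf_posD)
    ultimately show ?thesis by metis
  qed
  let ?h = "fscale (1/2) (x + fadj x)" and ?k = "fscale (\<i>/2) (fadj x + fscale (-1) x)"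
  have 1: "?h \<in> linf B" "?k \<in> linf B" by (intro linf_scale linf_add linf_adj x)+
  have 2: "fadj ?h = ?h" "fadj ?k = ?k" by (auto simp: fadj_def fun_eq_iff algebra_simps)
  have "x = ?h + fscale \<i> ?k" by (auto simp: fun_eq_iff fadj_def algebra_simps)
  moreover have "P (?h + fscale \<i> ?k)" by (rule add[OF 1(1) linf_scale[OF 1(2)] herm[OF 1(1) 2(1)] scale[OF 1(2) herm[OF 1(2) 2(2)]]])
  ultimately show ?thesis by metis
qed

lemma fpos_sesq_sym:
  assumes "fpos B x"
  shows "sesq B s w v x = cnj (sesq B s v w x)"
proof -
  have im: "Im (sesq B s u u x) = 0" for u
    using fposD[OF assms, of s u] by (simp add: less_eq_complex_def)
  have "Im (sesq B s w v x + sesq B s v w x) = 0"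
    using im[of "\<lambda>i. w i + v i"] im[of w] im[of v] by (simp add: sesq_add_left sesq_add_right)
  moreover have "Im (\<i> * sesq B s w v x - \<i> * sesq B s v w x) = 0"
    using im[of "\<lambda>i. w i + \<i> * v i"] im[of w] im[of v]
    by (simp add: sesq_add_left sesq_add_right sesq_scale_left sesq_scale_right)
  ultimately show ?thesis by (simp add: complex_eq_iff)
qed

lemma fpos_hermitian:
  assumes fd: "fd B" and x: "fpos B x"
  shows "x s i j = cnj (x s j i)"
proof (cases "i \<in> B s \<and> j \<in> B s")
  case True
  then show ?thesis
    using fpos_sesq_sym[OF x, of s "basis_vec i" "basis_vec j"] by (simp add: sesq_basis fd)
next
  case False
  have "x \<in> funs B" using x by (simp add: fpos_iff)
  with False show ?thesis by (metis complex_cnj_zero funs_zero)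
qed

text \<open>
  The inequality \<open>\<langle>u, x u\<rangle> \<ge> 0\<close> is used for three vectors \<open>u = \<alpha> w + \<beta> v\<close>. They settle the
  cases \<open>\<langle>v, x v\<rangle> > 0\<close>, \<open>\<langle>w, x w\<rangle> > 0\<close>, and both values zero.
\<close>

lemma fpos_Cauchy_Schwarz:
  assumes x: "fpos B x"
  shows "(cmod (sesq B s w v x))\<^sup>2 \<le> Re (sesq B s w w x) * Re (sesq B s v v x)"
proof -
  define S where "S = sesq B s v w x"
  define p r where "p = Re (sesq B s w w x)" and "r = Re (sesq B s v v x)"
  have p: "sesq B s w w x = of_real p" "p \<ge> 0" and r: "sesq B s v v x = of_real r" "r \<ge> 0"
    using fposD[OF x] by (auto simp: p_def r_def less_eq_complex_def complex_eq_iff)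
  have S: "sesq B s w v x = cnj S" by (simp add: S_def fpos_sesq_sym[OF x, of s w v])
  have q: "0 \<le> Re ((cmod a)\<^sup>2 * p + (cmod b)\<^sup>2 * r + 2 * Re (cnj b * a * S))" for a b
  proof -
    have "0 \<le> Re (sesq B s (\<lambda>i. a * w i + b * v i) (\<lambda>i. a * w i + b * v i) x)"
      using fposD[OF x] by (simp add: less_eq_complex_def)
    also have "\<dots> = Re ((a * cnj a) * p + (b * cnj b) * r + (cnj b * a * S + cnj (cnj b * a * S)))"
      unfolding sesq_add_left sesq_add_right sesq_scale_left sesq_scale_right S S_def[symmetric] p r
      by (simp add: ring_distribs mult_ac)
    also have "\<dots> = Re ((cmod a)\<^sup>2 * p + (cmod b)\<^sup>2 * r + 2 * Re (cnj b * a * S))"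
      by (simp add: complex_norm_square[symmetric] algebra_simps del: of_real_power)
    finally show ?thesis by simp
  qed
  have SS: "c * cnj S * S = c * of_real ((cmod S)\<^sup>2)" for c
    by (simp only: complex_norm_square mult_ac)
  have e: "cnj (- S) * of_real r * S = of_real (- (r * (cmod S)\<^sup>2))"
    "cnj (of_real p) * (- cnj S) * S = of_real (- (p * (cmod S)\<^sup>2))"
    "cnj (- 1) * cnj S * S = of_real (- ((cmod S)\<^sup>2))"
    using SS[of "- of_real r"] SS[of "- of_real p"] SS[of "-1"] by (simp_all add: mult_ac)
  have 1: "0 \<le> r * (r * p - (cmod S)\<^sup>2)"
    using q[of "of_real r" "- S"] unfolding e
    by (simp add: power2_eq_square[of r] algebra_simps)
  have 2: "0 \<le> p * (p * r - (cmod S)\<^sup>2)"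
    using q[of "- cnj S" "of_real p"] unfolding e
    by (simp add: power2_eq_square[of p] algebra_simps)
  have 3: "0 \<le> (cmod S)\<^sup>2 * p + r - 2 * (cmod S)\<^sup>2"
    using q[of "cnj S" "-1"] unfolding e by simp
  have "(cmod S)\<^sup>2 \<le> p * r"
  proof (cases "r > 0 \<or> p > 0")
    case True
    then show ?thesis using 1 2 by (auto simp: zero_le_mult_iff mult.commute)
  next
    case False
    then have "p = 0" "r = 0" using p r by auto
    with 3 show ?thesis by simp
  qed
  then show ?thesis unfolding S p r by simp
qed

lemma fpos_kernel:
  assumes "fpos B x" "sesq B s v v x = 0"
  shows "sesq B s w v x = 0"
  using fpos_Cauchy_Schwarz[OF assms(1), of s w v] assms(2) by simp

lemma form_zero_imp_entry_zero:
  assumes fd: "fd B" and x: "x \<in> funs B" and z: "\<And>v. sesq B s v v x = 0"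
  shows "x s i j = 0"
proof (cases "i \<in> B s \<and> j \<in> B s")
  case True
  have "4 * sesq B s (basis_vec i) (basis_vec j) x = 0" by (subst sesq_polarization) (simp add: z)
  then show ?thesis using True by (simp add: sesq_basis fd)
qed (use funs_zero[OF x, of i s j] in blast)

lemma funs_eqI:
  assumes fd: "fd B" and x: "x \<in> funs B" "y \<in> funs B"
    and z: "\<And>s v. sesq B s v v x = sesq B s v v y"
  shows "x = y"
proof -
  have "(x - y) s i j = 0" for s i j
    by (rule form_zero_imp_entry_zero[OF fd funs_diff[OF x]]) (simp add: sesq_diff z)
  then show ?thesis by (auto simp: fun_eq_iff)
qed

lemma block_bound:
  assumes fd: "fd B"
  shows "cmod (sesq B s v v x) \<le> (\<Sum>i\<in>B s. \<Sum>j\<in>B s. cmod (x s i j)) * sqnorm B s v"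
proof -
  have vv: "cmod (v i) * cmod (v j) \<le> sqnorm B s v" if "i \<in> B s" "j \<in> B s" for i j
  proof -
    have "(cmod (v k))\<^sup>2 \<le> sqnorm B s v" if "k \<in> B s" for k
      unfolding sqnorm_def using that fdD[OF fd] by (intro member_le_sum) auto
    from this[OF \<open>i \<in> B s\<close>] this[OF \<open>j \<in> B s\<close>] show ?thesis
      using sum_squares_bound[of "cmod (v i)" "cmod (v j)"] by linarith
  qed
  have "cmod (sesq B s v v x) \<le> (\<Sum>i\<in>B s. \<Sum>j\<in>B s. cmod (x s i j) * sqnorm B s v)"
    unfolding sesq_def
  proof (intro sum_norm_le)
    fix i j assume ij: "i \<in> B s" "j \<in> B s"
    have "cmod (cnj (v i) * x s i j * v j) = cmod (x s i j) * (cmod (v i) * cmod (v j))"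
      by (simp add: norm_mult)
    also have "\<dots> \<le> cmod (x s i j) * sqnorm B s v"
      by (intro mult_left_mono vv ij) auto
    finally show "cmod (cnj (v i) * x s i j * v j) \<le> cmod (x s i j) * sqnorm B s v" .
  qed
  then show ?thesis by (simp add: sum_distrib_right)
qed

lemma cfin_linf:
  assumes fd: "fd B" and x: "x \<in> cfin B"
  shows "x \<in> linf B"
proof -
  define N where "N s = (\<Sum>i\<in>B s. \<Sum>j\<in>B s. cmod (x s i j))" for s
  have f: "finite {s. x s \<noteq> 0}" and xf: "x \<in> funs B" using x by (auto simp: cfin_def)
  have "N s \<le> (\<Sum>t\<in>{s. x s \<noteq> 0}. N t)" for s
  proof (cases "x s = 0")
    case True then show ?thesis by (simp add: N_def sum_nonneg)
  next
    case False then show ?thesis using f by (intro member_le_sum) (auto simp: N_def sum_nonneg)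
  qed
  then have "cmod (sesq B s v v x) \<le> (\<Sum>t\<in>{s. x s \<noteq> 0}. N t) * sqnorm B s v" for s v
    by (rule order_trans[OF block_bound[OF fd, of s v x, folded N_def] mult_right_mono]) auto
  with xf show ?thesis by (auto simp: linf_iff)
qed

lemma cut_funs: "x \<in> funs B \<Longrightarrow> cut s x \<in> funs B"
  by (auto simp: funs_def cut_def)

lemma cut_cfin: "x \<in> funs B \<Longrightarrow> cut s x \<in> cfin B"
  by (auto simp: cfin_def cut_funs) (auto simp: cut_def intro: finite_subset[of _ "{s}"])

lemma cut_linf: "fd B \<Longrightarrow> x \<in> funs B \<Longrightarrow> cut s x \<in> linf B"
  by (simp add: cfin_linf cut_cfin)

lemma sesq_cut: "sesq B t w v (cut s x) = (if t = s then sesq B t w v x else 0)"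
  by (simp add: sesq_def cut_def)

lemma cut_linf_pos: "fd B \<Longrightarrow> fpos B x \<Longrightarrow> cut s x \<in> linf_pos B"
  by (simp add: linf_pos_iff cut_linf fpos_iff cut_funs sesq_cut)

definition mat_unit :: "'i \<Rightarrow> 'b \<Rightarrow> 'b \<Rightarrow> ('i, 'b) fam" where
  "mat_unit s i j = (\<lambda>t k l. if t = s \<and> k = i \<and> l = j then 1 else 0)"

lemma mat_unit_linf:
  assumes "fd B" "i \<in> B s" "j \<in> B s"
  shows "mat_unit s i j \<in> linf B"
proof (rule cfin_linf[OF assms(1)])
  have "{t. mat_unit s i j t \<noteq> (0 :: 'b \<Rightarrow> 'b \<Rightarrow> complex)} \<subseteq> {s}"
    by (auto simp: mat_unit_def fun_eq_iff)
  then show "mat_unit s i j \<in> cfin B"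
    using assms by (auto simp: cfin_def funs_def mat_unit_def intro: finite_subset)
qed

lemma cut_expand:
  assumes fd: "fd B" and x: "x \<in> funs B"
  shows "cut s x = (\<Sum>i\<in>B s. \<Sum>j\<in>B s. fscale (x s i j) (mat_unit s i j))"
proof (intro ext)
  fix t k l
  have "(\<Sum>i\<in>B s. \<Sum>j\<in>B s. fscale (x s i j) (mat_unit s i j)) t k l
      = (\<Sum>i\<in>B s. \<Sum>j\<in>B s. if j = l then (if i = k \<and> t = s then x s i l else 0) else 0)"
    unfolding fam_sum_apply by (intro sum.cong refl) (auto simp: mat_unit_def)
  also have "\<dots> = (\<Sum>i\<in>B s. if i = k then (if l \<in> B s \<and> t = s then x s i l else 0) else 0)"
    by (intro sum.cong refl, subst sum.delta[OF fdD[OF fd]], auto)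
  also have "\<dots> = cut s x t k l"
    using x by (subst sum.delta[OF fdD[OF fd]]) (auto simp: cut_def funs_def)
  finally show "cut s x t k l = (\<Sum>i\<in>B s. \<Sum>j\<in>B s. fscale (x s i j) (mat_unit s i j)) t k l" ..
qed

definition linear_fun :: "('i \<Rightarrow> 'b set) \<Rightarrow> (('i, 'b) fam \<Rightarrow> complex) \<Rightarrow> bool" where
  "linear_fun B \<tau> \<longleftrightarrow> (\<forall>a\<in>linf B. \<forall>b\<in>linf B. \<tau> (a + b) = \<tau> a + \<tau> b) \<and>
     (\<forall>c. \<forall>a\<in>linf B. \<tau> (fscale c a) = c * \<tau> a)"

lemma linear_fun_add: "linear_fun B \<tau> \<Longrightarrow> a \<in> linf B \<Longrightarrow> b \<in> linf B \<Longrightarrow> \<tau> (a + b) = \<tau> a + \<tau> b"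
  by (simp add: linear_fun_def)

lemma linear_fun_scale: "linear_fun B \<tau> \<Longrightarrow> a \<in> linf B \<Longrightarrow> \<tau> (fscale c a) = c * \<tau> a"
  by (simp add: linear_fun_def)

lemma linear_fun_diff: "linear_fun B \<tau> \<Longrightarrow> a \<in> linf B \<Longrightarrow> b \<in> linf B \<Longrightarrow> \<tau> (a - b) = \<tau> a - \<tau> b"
  unfolding fam_diff_conv by (simp add: linear_fun_add linear_fun_scale linf_scale)

lemma linear_fun_zero: "linear_fun B \<tau> \<Longrightarrow> \<tau> 0 = 0"
  using linear_fun_diff[of B \<tau> 0 0] by simp

lemma linear_fun_sum:
  "linear_fun B \<tau> \<Longrightarrow> (\<And>a. a \<in> A \<Longrightarrow> f a \<in> linf B) \<Longrightarrow> \<tau> (\<Sum>a\<in>A. f a) = (\<Sum>a\<in>A. \<tau> (f a))"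
proof (induction A rule: infinite_finite_induct)
  case (insert x F)
  have "\<tau> (f x + (\<Sum>a\<in>F. f a)) = \<tau> (f x) + \<tau> (\<Sum>a\<in>F. f a)"
    using insert.prems by (intro linear_fun_add[of B]) (auto intro: linf_sum)
  moreover have "\<tau> (\<Sum>a\<in>F. f a) = (\<Sum>a\<in>F. \<tau> (f a))"
    using insert.prems by (intro insert.IH) auto
  ultimately show ?case by (simp only: sum.insert[OF insert.hyps])
qed (auto simp: linear_fun_zero)

lemma linear_fun_cut:
  assumes fd: "fd B" and x: "x \<in> funs B" and \<tau>: "linear_fun B \<tau>"
  shows "\<tau> (cut s x) = (\<Sum>i\<in>B s. \<Sum>j\<in>B s. x s i j * \<tau> (mat_unit s i j))"
  by (simp add: cut_expand[OF fd x] linear_fun_sum[OF \<tau>] linear_fun_scale[OF \<tau>]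
      linf_sum linf_scale mat_unit_linf[OF fd])

definition rank_one :: "('i \<Rightarrow> 'b set) \<Rightarrow> 'i \<Rightarrow> ('b \<Rightarrow> complex) \<Rightarrow> ('i, 'b) fam" where
  "rank_one B s v = (\<lambda>t i j. if t = s \<and> i \<in> B s \<and> j \<in> B s then v i * cnj (v j) else 0)"

lemma rank_one_cfin: "rank_one B s v \<in> cfin B"
proof -
  have "{t. rank_one B s v t \<noteq> 0} \<subseteq> {s}" by (auto simp: rank_one_def fun_eq_iff)
  then show ?thesis by (auto simp: cfin_def funs_def rank_one_def intro: finite_subset)
qed

lemma sesq_rank_one:
  "sesq B t w w (rank_one B s v) = (if t = s then of_real ((cmod (\<Sum>i\<in>B s. cnj (w i) * v i))\<^sup>2) else 0)"
proof -
  have "sesq B s w w (rank_one B s v) = (\<Sum>i\<in>B s. cnj (w i) * v i) * (\<Sum>j\<in>B s. cnj (v j) * w j)"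
    unfolding sum_product sesq_def rank_one_def by (intro sum.cong refl) simp
  also have "(\<Sum>j\<in>B s. cnj (v j) * w j) = cnj (\<Sum>i\<in>B s. cnj (w i) * v i)"
    by (simp add: mult.commute)
  finally show ?thesis
    unfolding complex_norm_square by (simp add: sesq_def rank_one_def)
qed

lemma rank_one_linf_pos: "fd B \<Longrightarrow> rank_one B s v \<in> linf_pos B"
  using rank_one_cfin[of B s v]
  by (auto simp: linf_pos_iff fpos_iff cfin_linf linf_funs sesq_rank_one less_eq_complex_def)

lemma rank_one_linf: "fd B \<Longrightarrow> rank_one B s v \<in> linf B"
  by (simp add: rank_one_linf_pos linf_posD)

lemma cut_rank_one: "cut s (rank_one B s v) = rank_one B s v"
  by (auto simp: cut_def rank_one_def fun_eq_iff)

text \<open>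
  Cholesky decomposition: if \<open>x\<^sub>i\<^sub>i > 0\<close>, subtracting the rank one matrix built from the
  \<open>i\<close>-th column of \<open>x\<close> leaves a matrix that is positive by the Cauchy-Schwarz inequality and has
  fewer nonzero diagonal entries. Inequalities between linear functionals on the positive
  matrices thereby reduce to matrices \<open>v v\<^sup>*\<close>.
\<close>

lemma rank_one_decomposition:
  assumes fd: "fd B" and x: "fpos B x"
  shows "\<exists>V. cut s x = (\<Sum>v\<leftarrow>V. rank_one B s v)"
  using x
proof (induction "card {i \<in> B s. x s i i \<noteq> 0}" arbitrary: x rule: less_induct)
  case less
  have xf: "x \<in> funs B" using less.prems by (simp add: fpos_iff)
  note herm = fpos_hermitian[OF fd less.prems]
  have ker: "x s k j = 0" if "x s j j = 0" for j k
  proof (cases "k \<in> B s \<and> j \<in> B s")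
    case True
    then show ?thesis
      using fpos_kernel[OF less.prems, of s "basis_vec j" "basis_vec k"] that by (simp add: sesq_basis fd)
  next
    case False
    then show ?thesis using funs_zero[OF xf, of k s j] by blast
  qed
  show ?case
  proof (cases "\<exists>i\<in>B s. x s i i \<noteq> 0")
    case False
    have "x s k j = 0" for k j
    proof (cases "j \<in> B s")
      case True
      with \<open>\<not> (\<exists>i\<in>B s. x s i i \<noteq> 0)\<close> have "x s j j = 0" by blast
      then show ?thesis by (rule ker)
    next
      case False
      then show ?thesis using funs_zero[OF xf, of k s j] by blast
    qed
    then have "cut s x = 0" by (simp add: cut_def fun_eq_iff)
    then show ?thesis by (intro exI[of _ "[]"]) simp
  next
    case True
    then obtain i where i: "i \<in> B s" "x s i i \<noteq> 0" by blast
    define r where "r = Re (x s i i)"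
    have "0 \<le> x s i i" using fposD[OF less.prems, of s "basis_vec i"] i by (simp add: sesq_basis fd)
    then have r: "x s i i = of_real r" "r > 0"
      using i by (auto simp: r_def less_eq_complex_def complex_eq_iff)
    define v where "v k = x s k i / of_real (sqrt r)" for k
    define y where "y = cut s x - rank_one B s v"
    have vv: "v k * cnj (v l) = x s k i * cnj (x s l i) / of_real r" for k l
      using r by (simp add: v_def flip: of_real_mult)
    have y_pos: "fpos B y"
      unfolding fpos_iff
    proof (intro conjI allI)
      show "y \<in> funs B" unfolding y_def using rank_one_cfin[of B s v]
        by (intro funs_diff cut_funs xf) (simp add: cfin_def)
      fix t w
      show "0 \<le> sesq B t w w y"
      proof (cases "t = s")
        case True
        have "(\<Sum>k\<in>B s. cnj (w k) * v k) = sesq B s w (basis_vec i) x / of_real (sqrt r)"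
          by (simp add: sesq_basis_right fd i v_def sum_divide_distrib)
        then have "(cmod (\<Sum>k\<in>B s. cnj (w k) * v k))\<^sup>2 = (cmod (sesq B s w (basis_vec i) x))\<^sup>2 / r"
          using r by (simp add: norm_divide power_divide)
        also have "\<dots> \<le> Re (sesq B s w w x)"
          using fpos_Cauchy_Schwarz[OF less.prems, of s w "basis_vec i"] r
          by (simp add: sesq_basis fd i divide_le_eq)
        finally show ?thesis using True fposD[OF less.prems, of s w]
          by (simp add: y_def sesq_diff sesq_cut sesq_rank_one less_eq_complex_def)
      qed (simp add: y_def sesq_diff sesq_cut sesq_rank_one)
    qed
    have ydiag: "y s k k = x s k k - x s k i * cnj (x s k i) / of_real r" if "k \<in> B s" for k
      using that by (simp add: y_def cut_def rank_one_def vv)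
    have "{k \<in> B s. y s k k \<noteq> 0} \<subseteq> {k \<in> B s. x s k k \<noteq> 0} - {i}"
    proof
      fix k assume k: "k \<in> {k \<in> B s. y s k k \<noteq> 0}"
      have "k \<noteq> i" using k ydiag[OF i(1)] r by auto
      moreover have "x s k k \<noteq> 0"
      proof
        assume "x s k k = 0"
        from ker[OF this] have "x s i k = 0" .
        then have "x s k i = 0" using herm[of s k i] by simp
        then show False using k ydiag[of k] \<open>x s k k = 0\<close> by simp
      qed
      ultimately show "k \<in> {k \<in> B s. x s k k \<noteq> 0} - {i}" using k by simp
    qed
    moreover have "i \<in> {k \<in> B s. x s k k \<noteq> 0}" using i by simp
    ultimately have "{k \<in> B s. y s k k \<noteq> 0} \<subset> {k \<in> B s. x s k k \<noteq> 0}" by blast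
    then have "card {k \<in> B s. y s k k \<noteq> 0} < card {k \<in> B s. x s k k \<noteq> 0}"
      by (intro psubset_card_mono) (simp add: fdD[OF fd])
    from less.hyps[OF this y_pos] obtain V where V: "cut s y = (\<Sum>v\<leftarrow>V. rank_one B s v)" by blast
    have "cut s x = rank_one B s v + cut s y"
      by (auto simp: y_def cut_def rank_one_def fun_eq_iff)
    with V have "cut s x = (\<Sum>v\<leftarrow>v # V. rank_one B s v)" by simp
    then show ?thesis by blast
  qed
qed

lemma cut_le_from_rank_one:
  assumes fd: "fd B" and \<sigma>: "linear_fun B \<sigma>" and \<tau>: "linear_fun B \<tau>" and x: "fpos B x"
    and le: "\<And>v. \<sigma> (rank_one B s v) \<le> \<tau> (rank_one B s v)"
  shows "\<sigma> (cut s x) \<le> \<tau> (cut s x)"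
proof -
  have L: "(\<Sum>v\<leftarrow>V. rank_one B s v) \<in> linf B \<and>
      \<sigma> (\<Sum>v\<leftarrow>V. rank_one B s v) \<le> \<tau> (\<Sum>v\<leftarrow>V. rank_one B s v)" for V
  proof (induction V)
    case Nil
    show ?case unfolding list.map sum_list.Nil linear_fun_zero[OF \<sigma>] linear_fun_zero[OF \<tau>]
      by (intro conjI linf_zero order_refl)
  next
    case (Cons v V)
    let ?y = "\<Sum>v\<leftarrow>V. rank_one B s v"
    have "\<sigma> (rank_one B s v + ?y) = \<sigma> (rank_one B s v) + \<sigma> ?y"
      "\<tau> (rank_one B s v + ?y) = \<tau> (rank_one B s v) + \<tau> ?y"
      using Cons.IH rank_one_linf[OF fd] by (intro linear_fun_add[OF \<sigma>] linear_fun_add[OF \<tau>]; blast)+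
    then show ?case using Cons.IH le[of v] linf_add[OF rank_one_linf[OF fd], of ?y s v]
      unfolding list.map sum_list.Cons by (metis add_mono)
  qed
  show ?thesis using rank_one_decomposition[OF fd x, of s] L by metis
qed

section \<open>Normal functionals and normal positive maps\<close>

text \<open>
  Normal positive functionals. Normality is expressed as additivity over the blocks.
\<close>

definition npf :: "('i \<Rightarrow> 'b set) \<Rightarrow> (('i, 'b) fam \<Rightarrow> complex) \<Rightarrow> bool" where
  "npf B \<tau> \<longleftrightarrow> linear_fun B \<tau> \<and> (\<forall>a\<in>linf_pos B. 0 \<le> \<tau> a) \<and>
     (\<forall>a\<in>linf_pos B. ((\<lambda>s. \<tau> (cut s a)) has_sum \<tau> a) UNIV)"

text \<open>
  Normal functionals, as the linear span of the normal positive ones. The rule \<open>cong\<close> makes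
  membership depend on the values on bounded functions only.
\<close>

inductive nfun :: "('i \<Rightarrow> 'b set) \<Rightarrow> (('i, 'b) fam \<Rightarrow> complex) \<Rightarrow> bool" for B where
  npf: "npf B \<tau> \<Longrightarrow> nfun B \<tau>"
| add: "nfun B \<tau> \<Longrightarrow> nfun B \<sigma> \<Longrightarrow> nfun B (\<lambda>x. \<tau> x + \<sigma> x)"
| scale: "nfun B \<tau> \<Longrightarrow> nfun B (\<lambda>x. c * \<tau> x)"
| cong: "nfun B \<tau> \<Longrightarrow> (\<And>x. x \<in> linf B \<Longrightarrow> \<sigma> x = \<tau> x) \<Longrightarrow> nfun B \<sigma>"

lemma npf_linear: "npf B \<tau> \<Longrightarrow> linear_fun B \<tau>"
  by (simp add: npf_def)

lemma npf_pos: "npf B \<tau> \<Longrightarrow> a \<in> linf_pos B \<Longrightarrow> 0 \<le> \<tau> a"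
  by (simp add: npf_def)

lemma npf_has_sum: "npf B \<tau> \<Longrightarrow> a \<in> linf_pos B \<Longrightarrow> ((\<lambda>s. \<tau> (cut s a)) has_sum \<tau> a) UNIV"
  by (simp add: npf_def)

lemma nfun_linear: "nfun B \<tau> \<Longrightarrow> linear_fun B \<tau>"
proof (induction rule: nfun.induct)
  case (npf \<tau>)
  then show ?case by (rule npf_linear)
next
  case (add \<tau> \<sigma>)
  then show ?case by (simp add: linear_fun_def algebra_simps)
next
  case (scale \<tau> c)
  then show ?case by (simp add: linear_fun_def algebra_simps)
next
  case (cong \<tau> \<sigma>)
  show ?case unfolding linear_fun_def
  proof (intro conjI ballI allI)
    fix a b assume ab: "a \<in> linf B" "b \<in> linf B"
    show "\<sigma> (a + b) = \<sigma> a + \<sigma> b"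
      unfolding cong.hyps(2)[OF linf_add[OF ab]] cong.hyps(2)[OF ab(1)] cong.hyps(2)[OF ab(2)]
      by (rule linear_fun_add[OF cong.IH ab])
  next
    fix c a assume a: "a \<in> linf B"
    show "\<sigma> (fscale c a) = c * \<sigma> a"
      unfolding cong.hyps(2)[OF linf_scale[OF a]] cong.hyps(2)[OF a]
      by (rule linear_fun_scale[OF cong.IH a])
  qed
qed

lemma nfun_zero: "nfun B (\<lambda>x. 0)"
  by (auto intro!: nfun.npf simp: npf_def linear_fun_def)

lemma npf_cong: "npf B \<tau> \<Longrightarrow> fd B \<Longrightarrow> (\<And>x. x \<in> linf B \<Longrightarrow> \<sigma> x = \<tau> x) \<Longrightarrow> npf B \<sigma>"
proof -
  assume \<tau>: "npf B \<tau>" and fd: "fd B" and eq: "\<And>x. x \<in> linf B \<Longrightarrow> \<sigma> x = \<tau> x"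
  have 1: "linear_fun B \<sigma>"
    using linear_fun_add[OF npf_linear[OF \<tau>]] linear_fun_scale[OF npf_linear[OF \<tau>]]
    by (simp add: linear_fun_def eq linf_add linf_scale)
  have 2: "\<sigma> (cut s a) = \<tau> (cut s a)" if "a \<in> linf_pos B" for a s
    using that fd by (intro eq cut_linf) (auto simp: linf_pos_iff linf_funs)
  show ?thesis unfolding npf_def
    using 1 2 npf_pos[OF \<tau>] npf_has_sum[OF \<tau>] eq by (auto simp: linf_posD)
qed

lemma npf_add: "npf B \<tau> \<Longrightarrow> npf B \<sigma> \<Longrightarrow> npf B (\<lambda>x. \<tau> x + \<sigma> x)"
  unfolding npf_def linear_fun_def by (auto simp: algebra_simps intro: has_sum_add)

lemma npf_zero: "npf B (\<lambda>x. 0)"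
  by (auto simp: npf_def linear_fun_def)

lemma npf_scale: "npf B \<tau> \<Longrightarrow> 0 \<le> r \<Longrightarrow> npf B (\<lambda>x. of_real r * \<tau> x)"
  unfolding npf_def linear_fun_def
  by (auto simp: algebra_simps less_eq_complex_def intro!: has_sum_cmult_right)

lemma npf_sum: "(\<And>a. a \<in> A \<Longrightarrow> npf B (f a)) \<Longrightarrow> npf B (\<lambda>x. \<Sum>a\<in>A. f a x)"
proof (induction A rule: infinite_finite_induct)
  case (insert a A)
  then have "npf B (\<lambda>x. f a x + (\<Sum>a\<in>A. f a x))" by (intro npf_add) auto
  with insert show ?case by simp
qed (auto simp: npf_zero)

lemma npf_mono:
  assumes "npf B \<tau>" "x \<in> linf B" "y \<in> linf B" "fle B x y"
  shows "\<tau> x \<le> \<tau> y"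
proof -
  have "0 \<le> \<tau> (y - x)"
    using assms by (intro npf_pos[OF assms(1)]) (simp add: linf_pos_iff linf_diff fle_def)
  also have "\<tau> (y - x) = \<tau> y - \<tau> x" by (rule linear_fun_diff[OF npf_linear[OF assms(1)] assms(3,2)])
  finally show ?thesis by simp
qed

lemma npf_sesq: "fd B \<Longrightarrow> npf B (sesq B s v v)"
proof -
  assume fd: "fd B"
  have "((\<lambda>t. sesq B s v v (cut t a)) has_sum sesq B s v v a) UNIV" for a
    by (rule has_sum_finite_neutralI[of "{s}"]) (auto simp: sesq_cut)
  then show ?thesis
    by (auto simp: npf_def linear_fun_def sesq_add sesq_scale linf_pos_iff fposD)
qed

lemma nfun_has_sum:
  assumes fd: "fd B" and "nfun B \<tau>" and x: "x \<in> linf B"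
  shows "((\<lambda>s. \<tau> (cut s x)) has_sum \<tau> x) UNIV"
  using assms(2)
proof (induction rule: nfun.induct)
  case (npf \<tau>)
  note lin = npf_linear[OF npf]
  note c = cut_linf[OF fd linf_funs]
  from fd x show ?case
  proof (induction rule: linf_induct)
    case (pos a)
    then show ?case by (rule npf_has_sum[OF npf])
  next
    case (add a b)
    have "cut s (a + b) = cut s a + cut s b" for s by (auto simp: cut_def fun_eq_iff)
    then have "\<tau> (cut s (a + b)) = \<tau> (cut s a) + \<tau> (cut s b)" for s
      using linear_fun_add[OF lin c[OF add(1)] c[OF add(2)]] by metis
    then show ?case unfolding linear_fun_add[OF lin add(1,2)] using has_sum_add[OF add(3,4)] by presburger
  next
    case (scale r a)
    have "cut s (fscale r a) = fscale r (cut s a)" for s by (auto simp: cut_def fun_eq_iff)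
    then have "\<tau> (cut s (fscale r a)) = r * \<tau> (cut s a)" for s
      using linear_fun_scale[OF lin c[OF scale(1)]] by metis
    then show ?case unfolding linear_fun_scale[OF lin scale(1)] using has_sum_cmult_right[OF scale(2)] by presburger
  qed
next
  case (add \<tau> \<sigma>)
  then show ?case by (intro has_sum_add)
next
  case (scale \<tau> c)
  then show ?case by (intro has_sum_cmult_right)
next
  case (cong \<tau> \<sigma>)
  have "\<sigma> (cut s x) = \<tau> (cut s x)" for s by (rule cong.hyps(2)[OF cut_linf[OF fd linf_funs[OF x]]])
  then show ?case using cong.IH cong.hyps(2)[OF x] by presburger
qed

text \<open>
  A normal functional is the sum of its restrictions to the blocks, which have the matrix units
  as bases. Identities between normal functionals are therefore checked on matrix units.
\<close>

lemma nfun_eqI: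
  assumes fd: "fd B" and \<tau>: "nfun B \<tau>" and \<sigma>: "nfun B \<sigma>" and x: "x \<in> linf B"
    and eq: "\<And>s i j. i \<in> B s \<Longrightarrow> j \<in> B s \<Longrightarrow> \<tau> (mat_unit s i j) = \<sigma> (mat_unit s i j)"
  shows "\<tau> x = \<sigma> x"
proof -
  have "\<tau> (cut s x) = \<sigma> (cut s x)" for s
    unfolding linear_fun_cut[OF fd linf_funs[OF x] nfun_linear[OF \<tau>]]
      linear_fun_cut[OF fd linf_funs[OF x] nfun_linear[OF \<sigma>]]
    by (intro sum.cong refl) (simp add: eq)
  then have "(\<lambda>s. \<tau> (cut s x)) = (\<lambda>s. \<sigma> (cut s x))" by blast
  with nfun_has_sum[OF fd \<sigma> x] have "((\<lambda>s. \<tau> (cut s x)) has_sum \<sigma> x) UNIV" by presburger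
  then show ?thesis by (rule has_sum_unique[OF nfun_has_sum[OF fd \<tau> x]])
qed

text \<open>
  Matrix entries are combinations of four quadratic forms. This carries normality, convergence
  and boundedness from vector states over to matrix coefficients.
\<close>

lemma entry_polarization:
  fixes v :: "complex \<Rightarrow> 'c \<Rightarrow> complex"
  assumes fd: "fd C" and kl: "k \<in> C u" "l \<in> C u"
    and v: "v = (\<lambda>c i. basis_vec k i + c * basis_vec l i)"
  shows "y u k l = (1/4) * (sesq C u (v 1) (v 1) y + (-1) * sesq C u (v (-1)) (v (-1)) y
     + (-\<i>) * sesq C u (v \<i>) (v \<i>) y + \<i> * sesq C u (v (-\<i>)) (v (-\<i>)) y)"
proof -
  have e: "z = (1/4) * (a + (-1) * b + (-\<i>) * c + \<i> * d)" if "4 * z = a - b - \<i> * c + \<i> * d"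
    for a b c d z :: complex
    using that by (simp add: field_simps)
  have "4 * y u k l = sesq C u (v 1) (v 1) y - sesq C u (v (-1)) (v (-1)) y
     - \<i> * sesq C u (v \<i>) (v \<i>) y + \<i> * sesq C u (v (-\<i>)) (v (-\<i>)) y"
    unfolding sesq_basis[OF fd kl, symmetric] v by (subst sesq_polarization) simp
  then show ?thesis by (rule e)
qed

lemma nfun_polarize:
  assumes fd: "fd C" and T: "\<And>x. x \<in> linf B \<Longrightarrow> T x \<in> funs C"
    and q: "\<And>v. nfun B (\<lambda>x. sesq C u v v (T x))"
  shows "nfun B (\<lambda>x. T x u k l)"
proof (cases "k \<in> C u \<and> l \<in> C u")
  case True
  then have kl: "k \<in> C u" "l \<in> C u" by auto
  show ?thesis unfolding entry_polarization[OF fd kl refl] by (intro nfun.add nfun.scale q)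
next
  case False
  have "T x u k l = 0" if "x \<in> linf B" for x using funs_zero[OF T[OF that]] False by blast
  then show ?thesis by (rule nfun.cong[OF nfun_zero])
qed

lemma has_sum_polarize:
  assumes fd: "fd C" and X: "\<And>s. X s \<in> funs C" and x: "x \<in> funs C"
    and q: "\<And>v. ((\<lambda>s. sesq C u v v (X s)) has_sum sesq C u v v x) A"
  shows "((\<lambda>s. X s u k l) has_sum x u k l) A"
proof (cases "k \<in> C u \<and> l \<in> C u")
  case True
  then have kl: "k \<in> C u" "l \<in> C u" by auto
  show ?thesis unfolding entry_polarization[OF fd kl refl]
    by (intro has_sum_add has_sum_cmult_right q)
next
  case False
  then have "X s u k l = 0" "x u k l = 0" for s using funs_zero[OF X] funs_zero[OF x] by blast+
  then show ?thesis by simp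
qed

lemma summable_polarize:
  assumes fd: "fd C" and X: "\<And>s. X s \<in> funs C"
    and q: "\<And>v. (\<lambda>s. sesq C u v v (X s)) summable_on A"
  shows "(\<lambda>s. X s u k l) summable_on A"
proof (cases "k \<in> C u \<and> l \<in> C u")
  case True
  then have kl: "k \<in> C u" "l \<in> C u" by auto
  show ?thesis unfolding entry_polarization[OF fd kl refl]
    by (intro summable_on_add summable_on_cmult_right q)
next
  case False
  then have "X s u k l = 0" for s using funs_zero[OF X] by blast
  then show ?thesis by simp
qed

lemma has_sum_sum:
  fixes f :: "'a \<Rightarrow> 's \<Rightarrow> complex"
  assumes "\<And>a. a \<in> A \<Longrightarrow> ((\<lambda>s. f a s) has_sum g a) S"
  shows "((\<lambda>s. \<Sum>a\<in>A. f a s) has_sum (\<Sum>a\<in>A. g a)) S"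
  using assms by (induction A rule: infinite_finite_induct) (auto intro: has_sum_add)

lemma has_sum_sesq:
  assumes "\<And>k l. ((\<lambda>s. X s u k l) has_sum x u k l) A"
  shows "((\<lambda>s. sesq C u v w (X s)) has_sum sesq C u v w x) A"
  unfolding sesq_def by (intro has_sum_sum has_sum_cmult_left has_sum_cmult_right assms)


lemma has_sum_complex_of_real_iff:
  assumes "\<And>x. x \<in> A \<Longrightarrow> 0 \<le> f x"
  shows "(f has_sum r) A \<longleftrightarrow> ((\<lambda>x. Re (f x)) has_sum Re r) A \<and> Im r = 0"
proof
  assume f: "(f has_sum r) A"
  have "((\<lambda>x. Im (f x)) has_sum Im r) A" by (rule has_sum_Im[OF f])
  moreover have "((\<lambda>x. Im (f x)) has_sum 0) A"
    by (rule has_sum_0) (use assms in \<open>auto simp: less_eq_complex_def\<close>)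
  ultimately show "((\<lambda>x. Re (f x)) has_sum Re r) A \<and> Im r = 0"
    using has_sum_Re[OF f] has_sum_unique by blast
next
  assume r: "((\<lambda>x. Re (f x)) has_sum Re r) A \<and> Im r = 0"
  then have "((\<lambda>x. of_real (Re (f x)) :: complex) has_sum of_real (Re r)) A"
    by (simp add: has_sum_of_real_iff)
  moreover have "of_real (Re r) = r" using r by (simp add: complex_eq_iff)
  moreover have "((\<lambda>x. of_real (Re (f x)) :: complex) has_sum r) A \<longleftrightarrow> (f has_sum r) A"
    by (rule has_sum_cong) (use assms in \<open>auto simp: less_eq_complex_def complex_eq_iff\<close>)
  ultimately show "(f has_sum r) A" by simp
qed

lemma has_sum_nonneg_complex:
  fixes f :: "'a \<Rightarrow> complex"
  assumes f: "(f has_sum r) A" and "\<And>x. x \<in> A \<Longrightarrow> 0 \<le> f x"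
  shows "0 \<le> r"
proof -
  have "0 \<le> Re r" by (rule has_sum_nonneg[OF has_sum_Re[OF f]]) (use assms in \<open>auto simp: less_eq_complex_def\<close>)
  then show ?thesis using assms(1) has_sum_complex_of_real_iff[of A f r] assms(2)
    by (auto simp: less_eq_complex_def)
qed

text \<open>
  Tonelli's theorem for nonnegative double series.
\<close>

lemma has_sum_iterated_nonneg:
  fixes g :: "'a \<Rightarrow> 'c \<Rightarrow> complex"
  assumes g0: "\<And>n s. 0 \<le> g n s"
    and row: "\<And>n. ((\<lambda>s. g n s) has_sum R n) S"
    and col: "\<And>s. ((\<lambda>n. g n s) has_sum C s) A"
    and r: "(R has_sum r) A"
  shows "(C has_sum r) S"
proof -
  define h where "h = (\<lambda>(n, s). Re (g n s))"
  have R0: "0 \<le> R n" for n by (rule has_sum_nonneg_complex[OF row]) (rule g0)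
  have C0: "0 \<le> C s" for s by (rule has_sum_nonneg_complex[OF col]) (rule g0)
  have rowr: "((\<lambda>s. h (n, s)) has_sum Re (R n)) S" for n
    using has_sum_Re[OF row] by (simp add: h_def)
  have colr: "((\<lambda>n. h (n, s)) has_sum Re (C s)) A" for s
    using has_sum_Re[OF col] by (simp add: h_def)
  have rr: "((\<lambda>n. Re (R n)) has_sum Re r) A" "Im r = 0"
    using r has_sum_complex_of_real_iff[of A R r] R0 by auto
  have "h summable_on (Sigma A (\<lambda>_. S))"
    by (rule summable_on_SigmaI[OF rowr]) (use rr g0 in \<open>auto simp: h_def less_eq_complex_def has_sum_imp_summable\<close>)
  then have "(h has_sum Re r) (A \<times> S)"
    using has_sum_SigmaI[OF rowr rr(1)] by simp
  then have "((\<lambda>(s, n). h (n, s)) has_sum Re r) (S \<times> A)"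
    using has_sum_swap[where f = h and A = A and B = S] by (simp add: case_prod_unfold)
  then have "((\<lambda>s. Re (C s)) has_sum Re r) S"
    by (rule has_sum_SigmaD) (use colr in auto)
  then show ?thesis using has_sum_complex_of_real_iff[of S C r] C0 rr(2) by blast
qed

text \<open>
  The value of \<open>\<tau>\<close> on a possibly unbounded function \<open>a\<close> can be computed from any
  decomposition of \<open>a\<close> into bounded positive functions \<open>y\<^sub>n\<close>, by Tonelli's theorem for
  the double series of the \<open>\<tau>((y\<^sub>n)\<^sub>s)\<close>.
\<close>

lemma npf_has_sum_family:
  assumes fd: "fd B" and \<tau>: "npf B \<tau>" and y: "\<And>n. y n \<in> linf_pos B"
    and ya: "\<And>s i j. ((\<lambda>n. y n s i j) has_sum a s i j) A"
    and a: "a \<in> funs B"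
  shows "((\<lambda>n. \<tau> (y n)) has_sum r) A \<longleftrightarrow> ((\<lambda>s. \<tau> (cut s a)) has_sum r) UNIV"
proof -
  define g where "g n s = \<tau> (cut s (y n))" for n s
  have cutpos: "cut s (y n) \<in> linf_pos B" for n s
    using y[of n] by (intro cut_linf_pos[OF fd]) (simp add: linf_pos_iff)
  have g0: "0 \<le> g n s" for n s unfolding g_def by (rule npf_pos[OF \<tau> cutpos])
  have row: "((\<lambda>s. g n s) has_sum \<tau> (y n)) UNIV" for n
    unfolding g_def by (rule npf_has_sum[OF \<tau> y])
  have col: "((\<lambda>n. g n s) has_sum \<tau> (cut s a)) A" for s
    unfolding g_def linear_fun_cut[OF fd linf_funs[OF linf_posD[OF y]] npf_linear[OF \<tau>]]
      linear_fun_cut[OF fd a npf_linear[OF \<tau>]]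
    by (intro has_sum_sum has_sum_cmult_left ya)
  show ?thesis
    using has_sum_iterated_nonneg[of g, OF g0 row col]
      has_sum_iterated_nonneg[of "\<lambda>s n. g n s", OF g0 col row] by blast
qed

text \<open>
  Positive normal maps. All properties are tested by composition with the vector functionals
  \<open>x \<mapsto> \<langle>v, x\<^sub>u v\<rangle>\<close>, which separate points and determine the order.
\<close>

definition pnm :: "('i \<Rightarrow> 'b set) \<Rightarrow> ('j \<Rightarrow> 'c set) \<Rightarrow> (('i, 'b) fam \<Rightarrow> ('j, 'c) fam) \<Rightarrow> bool" where
  "pnm B C T \<longleftrightarrow> (\<forall>x\<in>linf B. T x \<in> linf C) \<and> (\<forall>u v. npf B (\<lambda>x. sesq C u v v (T x)))"

lemma pnm_linf: "pnm B C T \<Longrightarrow> x \<in> linf B \<Longrightarrow> T x \<in> linf C"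
  by (simp add: pnm_def)

lemma pnm_npf: "pnm B C T \<Longrightarrow> npf B (\<lambda>x. sesq C u v v (T x))"
  by (simp add: pnm_def)

lemma pnm_linf_pos: "pnm B C T \<Longrightarrow> x \<in> linf_pos B \<Longrightarrow> T x \<in> linf_pos C"
  using npf_pos[OF pnm_npf, of B C T x]
  by (auto simp: linf_pos_iff fpos_iff pnm_linf linf_funs)

lemma pnm_add:
  assumes fd: "fd C" and T: "pnm B C T" and ab: "a \<in> linf B" "b \<in> linf B"
  shows "T (a + b) = T a + T b"
proof (rule funs_eqI[OF fd])
  show "T (a + b) \<in> funs C" by (rule linf_funs[OF pnm_linf[OF T linf_add[OF ab]]])
  show "T a + T b \<in> funs C" by (intro funs_add linf_funs[OF pnm_linf[OF T]] ab)
  show "sesq C s v v (T (a + b)) = sesq C s v v (T a + T b)" for s v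
    unfolding sesq_add by (rule linear_fun_add[OF npf_linear[OF pnm_npf[OF T]] ab])
qed

lemma pnm_scale:
  assumes fd: "fd C" and T: "pnm B C T" and a: "a \<in> linf B"
  shows "T (fscale c a) = fscale c (T a)"
proof (rule funs_eqI[OF fd])
  show "T (fscale c a) \<in> funs C" by (rule linf_funs[OF pnm_linf[OF T linf_scale[OF a]]])
  show "fscale c (T a) \<in> funs C" by (intro funs_scale linf_funs[OF pnm_linf[OF T]] a)
  show "sesq C s v v (T (fscale c a)) = sesq C s v v (fscale c (T a))" for s v
    unfolding sesq_scale by (rule linear_fun_scale[OF npf_linear[OF pnm_npf[OF T]] a])
qed

lemma pnm_nfun_entry:
  assumes "fd C" "pnm B C T"
  shows "nfun B (\<lambda>x. T x u k l)"
  by (rule nfun_polarize[OF assms(1) linf_funs[OF pnm_linf[OF assms(2)]] nfun.npf[OF pnm_npf[OF assms(2)]]])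

text \<open>
  The blocks of \<open>a\<close> are mapped to bounded positive functions which sum up to \<open>T a\<close>, so normality
  of the composition is Tonelli's theorem.
\<close>

lemma npf_comp:
  assumes fd: "fd B" "fd C" and \<tau>: "npf C \<tau>" and T: "pnm B C T"
  shows "npf B (\<lambda>x. \<tau> (T x))"
  unfolding npf_def
proof (intro conjI ballI)
  show "linear_fun B (\<lambda>x. \<tau> (T x))"
    unfolding linear_fun_def
  proof (intro conjI ballI allI)
    fix a b assume ab: "a \<in> linf B" "b \<in> linf B"
    show "\<tau> (T (a + b)) = \<tau> (T a) + \<tau> (T b)"
      unfolding pnm_add[OF fd(2) T ab]
      by (rule linear_fun_add[OF npf_linear[OF \<tau>] pnm_linf[OF T ab(1)] pnm_linf[OF T ab(2)]])
  next
    fix c a assume a: "a \<in> linf B"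
    show "\<tau> (T (fscale c a)) = c * \<tau> (T a)"
      unfolding pnm_scale[OF fd(2) T a]
      by (rule linear_fun_scale[OF npf_linear[OF \<tau>] pnm_linf[OF T a]])
  qed
  fix a assume a: "a \<in> linf_pos B"
  show "0 \<le> \<tau> (T a)" by (rule npf_pos[OF \<tau> pnm_linf_pos[OF T a]])
  have cp: "T (cut s a) \<in> linf_pos C" for s
    using a by (intro pnm_linf_pos[OF T] cut_linf_pos fd) (simp add: linf_pos_iff)
  have ent: "((\<lambda>s. T (cut s a) u k l) has_sum T a u k l) UNIV" for u k l
    by (rule nfun_has_sum[OF fd(1) pnm_nfun_entry[OF fd(2) T] linf_posD[OF a]])
  show "((\<lambda>s. \<tau> (T (cut s a))) has_sum \<tau> (T a)) UNIV"
    unfolding npf_has_sum_family[OF fd(2) \<tau> cp ent linf_funs[OF pnm_linf[OF T linf_posD[OF a]]]]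
    by (rule npf_has_sum[OF \<tau> pnm_linf_pos[OF T a]])
qed

lemma nfun_comp:
  assumes fd: "fd B" "fd C" and T: "pnm B C T" and "nfun C \<tau>"
  shows "nfun B (\<lambda>x. \<tau> (T x))"
  using assms(4)
proof (induction rule: nfun.induct)
  case (npf \<tau>)
  then show ?case by (intro nfun.npf npf_comp[OF fd _ T])
next
  case (cong \<tau> \<sigma>)
  show ?case by (rule nfun.cong[OF cong.IH cong.hyps(2)[OF pnm_linf[OF T]]])
qed (auto intro: nfun.intros)

lemma pnm_comp:
  assumes fd: "fd B" "fd C" and S: "pnm C D S" and T: "pnm B C T"
  shows "pnm B D (\<lambda>x. S (T x))"
  using npf_comp[OF fd pnm_npf[OF S] T] pnm_linf[OF S pnm_linf[OF T]] by (simp add: pnm_def)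

section \<open>Slices of tensor products\<close>

definition vec_tens :: "('b \<Rightarrow> complex) \<Rightarrow> ('c \<Rightarrow> complex) \<Rightarrow> 'b \<times> 'c \<Rightarrow> complex" where
  "vec_tens w v = (\<lambda>(i, k). w i * v k)"

lemma sum_Times: "(\<Sum>p\<in>A \<times> A'. f p) = (\<Sum>x\<in>A. \<Sum>y\<in>A'. f (x, y))"
  by (simp add: sum.cartesian_product)

lemma sqnorm_vec_tens: "sqnorm (B \<otimes>\<^sub>B C) (s, t) (vec_tens w v) = sqnorm B s w * sqnorm C t v"
  by (simp add: sqnorm_def btens_def vec_tens_def sum_product sum.cartesian_product norm_mult
      power_mult_distrib case_prod_unfold)

text \<open>
  Slicing by the vector functional of \<open>w\<close> is compression of the first leg to \<open>w\<close>; hence it is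
  positive and bounded.
\<close>

lemma sesq_fun_id_sesq:
  "sesq C t v v (fun_id (sesq B s w w) y) = sesq (B \<otimes>\<^sub>B C) (s, t) (vec_tens w v) (vec_tens w v) y"
proof -
  have "sesq C t v v (fun_id (sesq B s w w) y) =
      (\<Sum>k\<in>C t. \<Sum>l\<in>C t. \<Sum>i\<in>B s. \<Sum>j\<in>B s. cnj (w i * v k) * y (s, t) (i, k) (j, l) * (w j * v l))"
    unfolding sesq_def fun_id_def slice1_def sum_distrib_left sum_distrib_right
    by (intro sum.cong refl) (simp add: mult_ac)
  also have "\<dots> = (\<Sum>k\<in>C t. \<Sum>i\<in>B s. \<Sum>l\<in>C t. \<Sum>j\<in>B s. cnj (w i * v k) * y (s, t) (i, k) (j, l) * (w j * v l))"
    by (intro sum.cong refl sum.swap)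
  also have "\<dots> = (\<Sum>i\<in>B s. \<Sum>k\<in>C t. \<Sum>l\<in>C t. \<Sum>j\<in>B s. cnj (w i * v k) * y (s, t) (i, k) (j, l) * (w j * v l))"
    by (rule sum.swap)
  also have "\<dots> = (\<Sum>i\<in>B s. \<Sum>k\<in>C t. \<Sum>j\<in>B s. \<Sum>l\<in>C t. cnj (w i * v k) * y (s, t) (i, k) (j, l) * (w j * v l))"
    by (intro sum.cong refl sum.swap)
  also have "\<dots> = sesq (B \<otimes>\<^sub>B C) (s, t) (vec_tens w v) (vec_tens w v) y"
    by (simp add: sesq_def btens_def vec_tens_def sum_Times)
  finally show ?thesis .
qed

text \<open>
  Exchanging the legs turns statements on slices of the first leg into those on slices of
  the second.
\<close>

definition flip :: "('i \<times> 'j, 'b \<times> 'c) fam \<Rightarrow> ('j \<times> 'i, 'c \<times> 'b) fam" where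
  "flip y = (\<lambda>(t, s) (k, i) (l, j). y (s, t) (i, k) (j, l))"

lemma id_fun_flip: "id_fun \<tau> y = fun_id \<tau> (flip y)"
  by (simp add: id_fun_def fun_id_def slice1_def slice2_def flip_def)

lemma sesq_flip: "sesq (C \<otimes>\<^sub>B B) (t, s) w v (flip y) = sesq (B \<otimes>\<^sub>B C) (s, t) (w \<circ> prod.swap) (v \<circ> prod.swap) y"
proof -
  have sw: "(\<Sum>p\<in>C t \<times> B s. f p) = (\<Sum>p\<in>B s \<times> C t. f (prod.swap p))" for f :: "_ \<Rightarrow> complex"
    by (rule sum.reindex_bij_witness[of _ prod.swap prod.swap]) auto
  show ?thesis
    unfolding sesq_def btens_def case_prod_conv sw
    by (intro sum.cong refl) (auto simp: flip_def prod.swap_def)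
qed

lemma sqnorm_swap: "sqnorm (B \<otimes>\<^sub>B C) (s, t) (v \<circ> prod.swap) = sqnorm (C \<otimes>\<^sub>B B) (t, s) v"
proof -
  have sw: "(\<Sum>p\<in>C t \<times> B s. f p) = (\<Sum>p\<in>B s \<times> C t. f (prod.swap p))" for f :: "_ \<Rightarrow> real"
    by (rule sum.reindex_bij_witness[of _ prod.swap prod.swap]) auto
  show ?thesis unfolding sqnorm_def btens_def case_prod_conv sw by simp
qed

lemma pnm_flip:
  assumes "fd B" "fd C"
  shows "pnm (B \<otimes>\<^sub>B C) (C \<otimes>\<^sub>B B) flip"
  unfolding pnm_def
proof (intro conjI ballI allI)
  fix x assume x: "x \<in> linf (B \<otimes>\<^sub>B C)"
  obtain c where c: "\<And>s v. cmod (sesq (B \<otimes>\<^sub>B C) s v v x) \<le> c * sqnorm (B \<otimes>\<^sub>B C) s v"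
    using linf_obtain[OF x] by metis
  have "flip x \<in> funs (C \<otimes>\<^sub>B B)"
    using linf_funs[OF x] by (auto simp: funs_def flip_def btens_def)
  moreover have "cmod (sesq (C \<otimes>\<^sub>B B) p v v (flip x)) \<le> c * sqnorm (C \<otimes>\<^sub>B B) p v" for p v
    using c[of "(snd p, fst p)" "v \<circ> prod.swap"] by (cases p) (simp add: sesq_flip sqnorm_swap)
  ultimately show "flip x \<in> linf (C \<otimes>\<^sub>B B)" by (auto simp: linf_iff)
next
  fix u v
  show "npf (B \<otimes>\<^sub>B C) (\<lambda>x. sesq (C \<otimes>\<^sub>B B) u v v (flip x))"
    by (cases u) (simp add: sesq_flip npf_sesq fd_tens assms)
qed

lemma pnm_fun_id_sesq:
  assumes fd: "fd B" "fd C"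
  shows "pnm (B \<otimes>\<^sub>B C) C (fun_id (sesq B s w w))"
  unfolding pnm_def sesq_fun_id_sesq
proof (intro conjI ballI allI npf_sesq fd_tens fd)
  fix x assume x: "x \<in> linf (B \<otimes>\<^sub>B C)"
  obtain c where c: "\<And>s v. cmod (sesq (B \<otimes>\<^sub>B C) s v v x) \<le> c * sqnorm (B \<otimes>\<^sub>B C) s v"
    using linf_obtain[OF x] by metis
  have "fun_id (sesq B s w w) x \<in> funs C"
  proof (rule funsI)
    fix t k l assume "k \<notin> C t \<or> l \<notin> C t"
    then have "x (s', t) (i, k) (j, l) = 0" for s' i j
      using funs_zero[OF linf_funs[OF x], of "(i, k)" "(s', t)" "(j, l)"] by (auto simp: btens_def)
    then show "fun_id (sesq B s w w) x t k l = 0" by (simp add: fun_id_def sesq_def slice1_def)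
  qed
  moreover have "cmod (sesq C t v v (fun_id (sesq B s w w) x)) \<le> (c * sqnorm B s w) * sqnorm C t v" for t v
    unfolding sesq_fun_id_sesq using c[of "(s, t)" "vec_tens w v"] by (simp add: sqnorm_vec_tens mult.assoc)
  ultimately show "fun_id (sesq B s w w) x \<in> linf C" by (auto simp: linf_iff)
qed

lemma pnm_id_fun_sesq:
  assumes fd: "fd B" "fd C"
  shows "pnm (B \<otimes>\<^sub>B C) B (id_fun (sesq C t w w))"
  unfolding id_fun_flip by (rule pnm_comp[OF fd_tens[OF fd] fd_tens[OF fd(2,1)] pnm_fun_id_sesq[OF fd(2,1)] pnm_flip[OF fd]])

lemma slice1_outside:
  assumes "y \<in> funs (B \<otimes>\<^sub>B C)" "\<not> (k \<in> C t \<and> l \<in> C t)"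
  shows "slice1 y t k l = 0"
proof (intro ext)
  fix s i j
  show "slice1 y t k l s i j = 0 s i j"
    using funs_zero[OF assms(1), of "(i, k)" "(s, t)" "(j, l)"] assms(2)
    by (auto simp: slice1_def btens_def)
qed

text \<open>
  By polarization a matrix coefficient in the second leg is a combination of slices by vector
  functionals.
\<close>

lemma slice1_linf:
  assumes fd: "fd B" "fd C" and y: "y \<in> linf (B \<otimes>\<^sub>B C)"
  shows "slice1 y t k l \<in> linf B"
proof (cases "k \<in> C t \<and> l \<in> C t")
  case True
  then have kl: "k \<in> C t" "l \<in> C t" by auto
  define v where "v = (\<lambda>c i. basis_vec k i + c * basis_vec l i)"
  let ?T = "\<lambda>c. id_fun (sesq C t (v c) (v c)) y"
  have "slice1 y t k l = fscale (1/4) (?T 1 + fscale (-1) (?T (-1)) + fscale (-\<i>) (?T \<i>) + fscale \<i> (?T (-\<i>)))"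
  proof (intro ext)
    fix s i j
    have "slice1 y t k l s i j = slice2 y s i j t k l" by (simp add: slice1_def slice2_def)
    also have "\<dots> = fscale (1/4) (?T 1 + fscale (-1) (?T (-1)) + fscale (-\<i>) (?T \<i>) + fscale \<i> (?T (-\<i>))) s i j"
      unfolding entry_polarization[OF fd(2) kl v_def] fscale_apply plus_fun_apply id_fun_def ..
    finally show "slice1 y t k l s i j = \<dots>" .
  qed
  also have "\<dots> \<in> linf B" by (intro linf_scale linf_add pnm_linf[OF pnm_id_fun_sesq[OF fd] y])
  finally show ?thesis .
next
  case False
  show ?thesis unfolding slice1_outside[OF linf_funs[OF y] False] by (rule linf_zero)
qed

lemma slice2_slice1_flip: "slice2 y s i j = slice1 (flip y) s i j"
  by (simp add: slice1_def slice2_def flip_def)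

lemma slice2_linf:
  assumes fd: "fd B" "fd C" and y: "y \<in> linf (B \<otimes>\<^sub>B C)"
  shows "slice2 y s i j \<in> linf C"
  unfolding slice2_slice1_flip by (rule slice1_linf[OF fd(2,1) pnm_linf[OF pnm_flip[OF fd] y]])

lemma fun_id_add:
  assumes fd: "fd B" "fd C" and \<tau>: "linear_fun B \<tau>" and y: "y \<in> linf (B \<otimes>\<^sub>B C)" "z \<in> linf (B \<otimes>\<^sub>B C)"
  shows "fun_id \<tau> (y + z) = fun_id \<tau> y + fun_id \<tau> z"
proof (intro ext)
  fix t k l
  have "slice1 (y + z) t k l = slice1 y t k l + slice1 z t k l" by (simp add: slice1_def fun_eq_iff)
  then have "\<tau> (slice1 (y + z) t k l) = \<tau> (slice1 y t k l + slice1 z t k l)" by (rule arg_cong)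
  also have "\<dots> = \<tau> (slice1 y t k l) + \<tau> (slice1 z t k l)"
    by (rule linear_fun_add[OF \<tau> slice1_linf[OF fd y(1)] slice1_linf[OF fd y(2)]])
  finally show "fun_id \<tau> (y + z) t k l = (fun_id \<tau> y + fun_id \<tau> z) t k l"
    by (simp only: fun_id_def plus_fun_apply)
qed

lemma fun_id_scale:
  assumes fd: "fd B" "fd C" and \<tau>: "linear_fun B \<tau>" and y: "y \<in> linf (B \<otimes>\<^sub>B C)"
  shows "fun_id \<tau> (fscale c y) = fscale c (fun_id \<tau> y)"
proof (intro ext)
  fix t k l
  have "slice1 (fscale c y) t k l = fscale c (slice1 y t k l)" by (simp add: slice1_def fun_eq_iff)
  then have "\<tau> (slice1 (fscale c y) t k l) = \<tau> (fscale c (slice1 y t k l))" by (rule arg_cong)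
  also have "\<dots> = c * \<tau> (slice1 y t k l)"
    by (rule linear_fun_scale[OF \<tau> slice1_linf[OF fd y]])
  finally show "fun_id \<tau> (fscale c y) t k l = fscale c (fun_id \<tau> y) t k l"
    by (simp only: fun_id_def fscale_apply)
qed

lemma sesq_fun_id:
  assumes fd: "fd B" "fd C" and \<tau>: "linear_fun B \<tau>" and y: "y \<in> linf (B \<otimes>\<^sub>B C)"
  shows "sesq C t v v (fun_id \<tau> y) = \<tau> (id_fun (sesq C t v v) y)"
proof -
  have "id_fun (sesq C t v v) y = (\<Sum>k\<in>C t. \<Sum>l\<in>C t. fscale (cnj (v k) * v l) (slice1 y t k l))"
    by (intro ext) (simp add: id_fun_def sesq_def slice2_def slice1_def fam_sum_apply mult_ac)
  then have "\<tau> (id_fun (sesq C t v v) y) = (\<Sum>k\<in>C t. \<Sum>l\<in>C t. (cnj (v k) * v l) * \<tau> (slice1 y t k l))"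
    by (simp add: linear_fun_sum[OF \<tau>] linf_sum linf_scale slice1_linf[OF fd y] linear_fun_scale[OF \<tau>])
  then show ?thesis by (simp add: sesq_def fun_id_def mult_ac)
qed

lemma fun_id_funs:
  assumes \<tau>: "linear_fun B \<tau>" and y: "y \<in> funs (B \<otimes>\<^sub>B C)"
  shows "fun_id \<tau> y \<in> funs C"
proof (rule funsI)
  fix t k l assume "k \<notin> C t \<or> l \<notin> C t"
  then have "slice1 y t k l = 0" by (intro slice1_outside[OF y]) blast
  then show "fun_id \<tau> y t k l = 0" by (simp only: fun_id_def linear_fun_zero[OF \<tau>])
qed

text \<open>
  The quadratic form of \<open>(\<tau> \<otimes> \<iota>)(y)\<close> at \<open>v\<close> is \<open>\<tau>\<close> of the compression of \<open>y\<close> to \<open>v\<close> in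
  the second leg. For \<open>0 \<le> y \<le> c\<close> this compression lies below \<open>c \<parallel>v\<parallel>\<^sup>2\<close>.
\<close>

lemma pnm_fun_id:
  assumes fd: "fd B" "fd C" and \<tau>: "npf B \<tau>"
  shows "pnm (B \<otimes>\<^sub>B C) C (fun_id \<tau>)"
  unfolding pnm_def
proof (intro conjI ballI allI)
  note lin = npf_linear[OF \<tau>] and fdt = fd_tens[OF fd]
  show "npf (B \<otimes>\<^sub>B C) (\<lambda>x. sesq C u v v (fun_id \<tau> x))" for u v
    by (rule npf_cong[OF npf_comp[OF fdt fd(1) \<tau> pnm_id_fun_sesq[OF fd]] fdt])
      (rule sesq_fun_id[OF fd lin])
  fix x assume "x \<in> linf (B \<otimes>\<^sub>B C)"
  with fdt show "fun_id \<tau> x \<in> linf C"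
  proof (induction rule: linf_induct)
    case (pos y)
    then have y: "y \<in> linf (B \<otimes>\<^sub>B C)" by (rule linf_posD)
    obtain c where c: "c \<ge> 0" "\<And>s v. cmod (sesq (B \<otimes>\<^sub>B C) s v v y) \<le> c * sqnorm (B \<otimes>\<^sub>B C) s v"
      using linf_obtain[OF y] by metis
    have "cmod (sesq C t v v (fun_id \<tau> y)) \<le> (c * cmod (\<tau> (fone B))) * sqnorm C t v" for t v
    proof -
      let ?z = "id_fun (sesq C t v v) y" and ?r = "c * sqnorm C t v"
      have z: "?z \<in> linf_pos B" by (rule pnm_linf_pos[OF pnm_id_fun_sesq[OF fd] pos])
      have le: "fle B ?z (fscale (of_real ?r) (fone B))"
      proof -
        have "sesq B s w w ?z \<le> sesq B s w w (fscale (of_real ?r) (fone B))" for s w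
        proof -
          have "sesq B s w w ?z = sesq (C \<otimes>\<^sub>B B) (t, s) (vec_tens v w) (vec_tens v w) (flip y)"
            unfolding id_fun_flip by (rule sesq_fun_id_sesq)
          also have "\<dots> = sesq (B \<otimes>\<^sub>B C) (s, t) (vec_tens w v) (vec_tens w v) y"
          proof -
            have "vec_tens v w \<circ> prod.swap = vec_tens w v" by (auto simp: vec_tens_def fun_eq_iff)
            then show ?thesis by (simp add: sesq_flip)
          qed
          finally have e: "sesq B s w w ?z = \<dots>" .
          have "0 \<le> sesq B s w w ?z" using z by (simp add: linf_pos_iff fposD)
          moreover have "cmod (sesq B s w w ?z) \<le> ?r * sqnorm B s w"
            unfolding e using c(2)[of "(s, t)" "vec_tens w v"] by (simp add: sqnorm_vec_tens mult_ac)
          ultimately show ?thesis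
            by (simp add: sesq_scale sesq_fone_self fd less_eq_complex_def cmod_eq_Re)
        qed
        then show ?thesis using z by (simp add: fle_iff linf_pos_iff linf_funs funs_scale)
      qed
      have "0 \<le> \<tau> ?z" by (rule npf_pos[OF \<tau> z])
      moreover have "\<tau> ?z \<le> of_real ?r * \<tau> (fone B)"
        using npf_mono[OF \<tau> linf_posD[OF z] linf_scale[OF fone_linf[OF fd(1)]] le]
        unfolding linear_fun_scale[OF lin fone_linf[OF fd(1)]] .
      ultimately have "cmod (\<tau> ?z) \<le> cmod (of_real ?r * \<tau> (fone B))"
        by (simp add: less_eq_complex_def cmod_eq_Re)
      then show ?thesis unfolding sesq_fun_id[OF fd lin y] using c(1) by (simp add: norm_mult mult_ac)
    qed
    then show ?case using fun_id_funs[OF lin linf_funs[OF y]] unfolding linf_iff by blast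
  next
    case (add a b)
    then show ?case unfolding fun_id_add[OF fd lin add(1,2)] by (intro linf_add)
  next
    case (scale c a)
    then show ?case unfolding fun_id_scale[OF fd lin scale(1)] by (intro linf_scale)
  qed
qed

lemma pnm_id_fun:
  assumes fd: "fd B" "fd C" and \<tau>: "npf C \<tau>"
  shows "pnm (B \<otimes>\<^sub>B C) B (id_fun \<tau>)"
  unfolding id_fun_flip by (rule pnm_comp[OF fd_tens[OF fd] fd_tens[OF fd(2,1)] pnm_fun_id[OF fd(2,1) \<tau>] pnm_flip[OF fd]])

lemma fun_id_linf:
  assumes fd: "fd B" "fd C" and "nfun B \<tau>" and y: "y \<in> linf (B \<otimes>\<^sub>B C)"
  shows "fun_id \<tau> y \<in> linf C"
  using assms(3)
proof (induction rule: nfun.induct)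
  case (npf \<tau>)
  show ?case by (rule pnm_linf[OF pnm_fun_id[OF fd npf] y])
next
  case (add \<tau> \<sigma>)
  have "fun_id (\<lambda>x. \<tau> x + \<sigma> x) y = fun_id \<tau> y + fun_id \<sigma> y" by (simp add: fun_id_def fun_eq_iff)
  then show ?case using linf_add[OF add.IH] by (simp only:)
next
  case (scale \<tau> c)
  have "fun_id (\<lambda>x. c * \<tau> x) y = fscale c (fun_id \<tau> y)" by (simp add: fun_id_def fun_eq_iff)
  then show ?case using linf_scale[OF scale.IH] by (simp only:)
next
  case (cong \<tau> \<sigma>)
  have "fun_id \<sigma> y = fun_id \<tau> y"
    unfolding fun_id_def by (intro ext cong.hyps(2) slice1_linf[OF fd y])
  then show ?case using cong.IH by (simp only:)
qed

lemma id_fun_linf: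
  assumes fd: "fd B" "fd C" and "nfun C \<tau>" and y: "y \<in> linf (B \<otimes>\<^sub>B C)"
  shows "id_fun \<tau> y \<in> linf B"
  unfolding id_fun_flip by (rule fun_id_linf[OF fd(2,1) assms(3) pnm_linf[OF pnm_flip[OF fd] y]])

lemma nfun_fun_id:
  assumes fd: "fd B" "fd C" and \<tau>: "nfun C \<tau>" and "nfun B \<omega>"
  shows "nfun (B \<otimes>\<^sub>B C) (\<lambda>y. \<tau> (fun_id \<omega> y))"
  using assms(4)
proof (induction rule: nfun.induct)
  case (npf \<omega>)
  show ?case by (rule nfun_comp[OF fd_tens[OF fd] fd(2) pnm_fun_id[OF fd npf] \<tau>])
next
  case (add \<omega> \<sigma>)
  show ?case
  proof (rule nfun.cong[OF nfun.add[OF add.IH]])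
    fix y assume y: "y \<in> linf (B \<otimes>\<^sub>B C)"
    have "fun_id (\<lambda>x. \<omega> x + \<sigma> x) y = fun_id \<omega> y + fun_id \<sigma> y" by (simp add: fun_id_def fun_eq_iff)
    then show "\<tau> (fun_id (\<lambda>x. \<omega> x + \<sigma> x) y) = \<tau> (fun_id \<omega> y) + \<tau> (fun_id \<sigma> y)"
      using linear_fun_add[OF nfun_linear[OF \<tau>] fun_id_linf[OF fd add.hyps(1) y] fun_id_linf[OF fd add.hyps(2) y]]
      by (simp only:)
  qed
next
  case (scale \<omega> c)
  show ?case
  proof (rule nfun.cong[OF nfun.scale[OF scale.IH, of c]])
    fix y assume y: "y \<in> linf (B \<otimes>\<^sub>B C)"
    have "fun_id (\<lambda>x. c * \<omega> x) y = fscale c (fun_id \<omega> y)" by (simp add: fun_id_def fun_eq_iff)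
    then show "\<tau> (fun_id (\<lambda>x. c * \<omega> x) y) = c * \<tau> (fun_id \<omega> y)"
      using linear_fun_scale[OF nfun_linear[OF \<tau>] fun_id_linf[OF fd scale.hyps(1) y]]
      by (simp only:)
  qed
next
  case (cong \<omega> \<sigma>)
  have "fun_id \<sigma> y = fun_id \<omega> y" if "y \<in> linf (B \<otimes>\<^sub>B C)" for y
    unfolding fun_id_def by (intro ext cong.hyps(2) slice1_linf[OF fd that])
  then show ?case by (intro nfun.cong[OF cong.IH] arg_cong[where f = \<tau>])
qed

lemma nfun_id_fun:
  assumes fd: "fd B" "fd C" and \<tau>: "nfun C \<tau>" and \<omega>: "nfun B \<omega>"
  shows "nfun (B \<otimes>\<^sub>B C) (\<lambda>y. \<omega> (id_fun \<tau> y))"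
  unfolding id_fun_flip
  by (rule nfun_comp[OF fd_tens[OF fd] fd_tens[OF fd(2,1)] pnm_flip[OF fd] nfun_fun_id[OF fd(2,1) \<omega> \<tau>]])

text \<open>
  Both sides are normal in \<open>y\<close>, and the matrix units of a tensor product are elementary
  tensors.
\<close>

lemma Fubini:
  assumes fd: "fd B" "fd C" and \<tau>: "nfun C \<tau>" and \<omega>: "nfun B \<omega>" and y: "y \<in> linf (B \<otimes>\<^sub>B C)"
  shows "\<omega> (id_fun \<tau> y) = \<tau> (fun_id \<omega> y)"
proof (rule nfun_eqI[OF fd_tens[OF fd] nfun_id_fun[OF fd \<tau> \<omega>] nfun_fun_id[OF fd \<tau> \<omega>] y])
  fix p a b assume ab: "a \<in> (B \<otimes>\<^sub>B C) p" "b \<in> (B \<otimes>\<^sub>B C) p"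
  obtain s t i k j l where p: "p = (s, t)" "a = (i, k)" "b = (j, l)" by (metis prod.exhaust)
  have mem: "i \<in> B s" "j \<in> B s" "k \<in> C t" "l \<in> C t" using ab by (auto simp: p btens_def)
  have z: "\<tau> 0 = 0" "\<omega> 0 = 0" by (rule linear_fun_zero[OF nfun_linear[OF \<tau>]] linear_fun_zero[OF nfun_linear[OF \<omega>]])+
  have 1: "slice2 (mat_unit p a b) s' i' j' = (if s' = s \<and> i' = i \<and> j' = j then mat_unit t k l else 0)"
    and 2: "slice1 (mat_unit p a b) t' k' l' = (if t' = t \<and> k' = k \<and> l' = l then mat_unit s i j else 0)"
    for s' i' j' t' k' l'
    by (auto simp: slice1_def slice2_def mat_unit_def p fun_eq_iff)
  have "id_fun \<tau> (mat_unit p a b) = fscale (\<tau> (mat_unit t k l)) (mat_unit s i j)"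
    unfolding id_fun_def 1 using z(1) by (intro ext) (simp only: fscale_apply mat_unit_def if_distrib[of \<tau>], auto)
  moreover have "fun_id \<omega> (mat_unit p a b) = fscale (\<omega> (mat_unit s i j)) (mat_unit t k l)"
    unfolding fun_id_def 2 using z(2) by (intro ext) (simp only: fscale_apply mat_unit_def if_distrib[of \<omega>], auto)
  ultimately show "\<omega> (id_fun \<tau> (mat_unit p a b)) = \<tau> (fun_id \<omega> (mat_unit p a b))"
    using linear_fun_scale[OF nfun_linear[OF \<tau>] mat_unit_linf[OF fd(2) mem(3,4)]]
      linear_fun_scale[OF nfun_linear[OF \<omega>] mat_unit_linf[OF fd(1) mem(1,2)]]
    by (simp only: mult.commute)
qed

text \<open>
  Slicing one leg commutes with a normal map on the other leg: this is Fubini for \<open>\<omega>\<close> and the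
  matrix coefficients of \<open>T\<close>. The same holds with the legs exchanged.
\<close>

lemma fun_id_id_map:
  assumes fd: "fd B" "fd C" "fd D" and T: "pnm C D T" and \<omega>: "nfun B \<omega>" and y: "y \<in> linf (B \<otimes>\<^sub>B C)"
  shows "fun_id \<omega> (id_map T y) = T (fun_id \<omega> y)"
proof (intro ext)
  fix p d e
  have "slice1 (id_map T y) p d e = id_fun (\<lambda>z. T z p d e) y"
    by (simp add: slice1_def id_map_def id_fun_def)
  then have "fun_id \<omega> (id_map T y) p d e = \<omega> (id_fun (\<lambda>z. T z p d e) y)" by (simp only: fun_id_def)
  also have "\<dots> = T (fun_id \<omega> y) p d e"
    by (rule Fubini[OF fd(1,2) pnm_nfun_entry[OF fd(3) T] \<omega> y])
  finally show "fun_id \<omega> (id_map T y) p d e = T (fun_id \<omega> y) p d e" .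
qed

lemma id_fun_map_id:
  assumes fd: "fd B" "fd C" "fd D" and T: "pnm B D T" and \<sigma>: "nfun C \<sigma>" and y: "y \<in> linf (B \<otimes>\<^sub>B C)"
  shows "id_fun \<sigma> (map_id T y) = T (id_fun \<sigma> y)"
proof (intro ext)
  fix p d e
  have "slice2 (map_id T y) p d e = fun_id (\<lambda>z. T z p d e) y"
    by (simp add: slice2_def map_id_def fun_id_def)
  then have "id_fun \<sigma> (map_id T y) p d e = \<sigma> (fun_id (\<lambda>z. T z p d e) y)" by (simp only: id_fun_def)
  also have "\<dots> = T (id_fun \<sigma> y) p d e"
    by (rule Fubini[OF fd(1,2) \<sigma> pnm_nfun_entry[OF fd(3) T] y, symmetric])
  finally show "id_fun \<sigma> (map_id T y) p d e = T (id_fun \<sigma> y) p d e" .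
qed

section \<open>Normal states and normal homomorphisms\<close>

lemma sesq_sum: "sesq B t w v (\<Sum>a\<in>A. f a) = (\<Sum>a\<in>A. sesq B t w v (f a))"
proof (induction A rule: infinite_finite_induct)
  case (insert a A)
  then show ?case by (simp only: sum.insert[OF insert.hyps] sesq_add)
qed (simp_all only: sum.empty sum.infinite sesq_zero not_False_eq_True)

lemma sesq_sum_cut:
  "finite F \<Longrightarrow> sesq B t w v (\<Sum>s\<in>F. cut s x) = (if t \<in> F then sesq B t w v x else 0)"
  unfolding sesq_sum sesq_cut by simp

definition finite_cuts :: "('i, 'b) fam \<Rightarrow> ('i, 'b) fam set" where
  "finite_cuts x = (\<lambda>F. \<Sum>s\<in>F. cut s x) ` {F. finite F}"

text \<open>
  The truncations of \<open>x\<close> to finitely many blocks form a net to which the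
  definition of normality by suprema applies.
\<close>

lemma finite_cuts:
  assumes fd: "fd B" and x: "x \<in> linf_pos B"
  shows "finite_cuts x \<subseteq> linf_pos B" "upward_directed B (finite_cuts x)" "is_sup B (finite_cuts x) x"
proof -
  have xp: "fpos B x" and xl: "x \<in> linf B" using x by (auto simp: linf_pos_iff)
  have p: "(\<Sum>s\<in>F. cut s x) \<in> linf_pos B" for F
    by (intro linf_pos_sum cut_linf_pos fd xp)
  note pf = linf_funs[OF linf_posD[OF p]]
  show "finite_cuts x \<subseteq> linf_pos B" using p by (auto simp: finite_cuts_def)
  show "upward_directed B (finite_cuts x)"
    unfolding upward_directed_def
  proof (intro conjI ballI)
    show "finite_cuts x \<noteq> {}" by (auto simp: finite_cuts_def)
    fix y z assume "y \<in> finite_cuts x" "z \<in> finite_cuts x"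
    then obtain F F' where F: "finite F" "finite F'" and yz: "y = (\<Sum>s\<in>F. cut s x)" "z = (\<Sum>s\<in>F'. cut s x)"
      by (auto simp: finite_cuts_def)
    have "fle B y (\<Sum>s\<in>F \<union> F'. cut s x)" "fle B z (\<Sum>s\<in>F \<union> F'. cut s x)"
      using F by (auto simp: yz fle_iff pf sesq_sum_cut fposD[OF xp])
    moreover have "(\<Sum>s\<in>F \<union> F'. cut s x) \<in> finite_cuts x"
      using F by (auto simp: finite_cuts_def)
    ultimately show "\<exists>w\<in>finite_cuts x. fle B y w \<and> fle B z w" by blast
  qed
  show "is_sup B (finite_cuts x) x"
    unfolding is_sup_def
  proof (intro conjI ballI impI xl)
    fix y assume "y \<in> finite_cuts x"
    then show "fle B y x"
      by (auto simp: finite_cuts_def fle_iff pf linf_funs[OF xl] sesq_sum_cut fposD[OF xp])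
  next
    fix z assume z: "z \<in> linf B" "\<forall>y\<in>finite_cuts x. fle B y z"
    have "sesq B s v v x \<le> sesq B s v v z" for s v
    proof -
      have "(\<Sum>t\<in>{s}. cut t x) \<in> finite_cuts x" unfolding finite_cuts_def by blast
      then have "fle B (\<Sum>t\<in>{s}. cut t x) z" using z by blast
      then have "sesq B s v v (\<Sum>t\<in>{s}. cut t x) \<le> sesq B s v v z"
        unfolding fle_iff[OF pf linf_funs[OF z(1)]] by blast
      then show ?thesis by (simp add: sesq_sum_cut del: sum.insert)
    qed
    then show "fle B x z" by (simp add: fle_iff linf_funs[OF xl] linf_funs[OF z(1)])
  qed
qed

lemma npf_normal_state:
  assumes fd: "fd B" and \<phi>: "normal_state B \<phi>"
  shows "npf B \<phi>"
proof -
  have lin: "linear_fun B \<phi>" using \<phi> by (simp add: normal_state_def linear_fun_def)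
  have pos: "0 \<le> \<phi> a" if "a \<in> linf_pos B" for a using \<phi> that by (simp add: normal_state_def)
  have "((\<lambda>s. \<phi> (cut s x)) has_sum \<phi> x) UNIV" if x: "x \<in> linf_pos B" for x
  proof -
    have xp: "fpos B x" and xl: "x \<in> linf B" using x by (auto simp: linf_pos_iff)
    let ?g = "\<lambda>s. Re (\<phi> (cut s x))"
    have cl: "cut s x \<in> linf_pos B" for s by (rule cut_linf_pos[OF fd xp])
    have g0: "0 \<le> ?g s" for s using pos[OF cl] by (simp add: less_eq_complex_def)
    have sum: "Re (\<phi> (\<Sum>s\<in>F. cut s x)) = sum ?g F" for F
      by (simp add: linear_fun_sum[OF lin linf_posD[OF cl]])
    have bd: "sum ?g F \<le> Re (\<phi> x)" if "finite F" for F
    proof -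
      have "fle B (\<Sum>s\<in>F. cut s x) x"
        using finite_cuts(3)[OF fd x] that by (auto simp: is_sup_def finite_cuts_def)
      then have "x - (\<Sum>s\<in>F. cut s x) \<in> linf_pos B"
        by (simp add: fle_def linf_pos_iff linf_diff linf_sum linf_posD[OF cl] xl)
      then have "0 \<le> \<phi> (x - (\<Sum>s\<in>F. cut s x))" by (rule pos)
      also have "\<dots> = \<phi> x - \<phi> (\<Sum>s\<in>F. cut s x)"
        by (rule linear_fun_diff[OF lin xl linf_sum[OF linf_posD[OF cl]]])
      finally have "0 \<le> \<phi> x - \<phi> (\<Sum>s\<in>F. cut s x)" .
      then show ?thesis by (simp add: less_eq_complex_def flip: sum)
    qed
    have "?g summable_on UNIV"
      by (rule nonneg_bdd_above_summable_on) (use g0 bd in \<open>auto intro!: bdd_aboveI\<close>)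
    then have "(?g has_sum (SUP F\<in>{F. finite F \<and> F \<subseteq> UNIV}. sum ?g F)) UNIV"
      by (rule has_sum_nonneg_SUPREMUM_real) (rule g0)
    also have "(SUP F\<in>{F. finite F \<and> F \<subseteq> UNIV}. sum ?g F) = (SUP y\<in>finite_cuts x. Re (\<phi> y))"
      by (simp add: finite_cuts_def image_image sum)
    also have "\<dots> = Re (\<phi> x)"
      using \<phi> finite_cuts[OF fd x] by (auto simp: normal_state_def)
    finally show ?thesis
      using has_sum_complex_of_real_iff[of UNIV "\<lambda>s. \<phi> (cut s x)" "\<phi> x"] pos[OF cl] pos[OF x]
      by (simp add: less_eq_complex_def)
  qed
  then show ?thesis using lin pos by (simp add: npf_def)
qed

lemma fmult_rank_one_self:
  "fmult B (rank_one B s v) (fadj (rank_one B s v)) = fscale (of_real (sqnorm B s v)) (rank_one B s v)"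
proof (intro ext)
  fix t i j
  have "fmult B (rank_one B s v) (fadj (rank_one B s v)) t i j
      = (\<Sum>k\<in>B t. if t = s \<and> i \<in> B s \<and> j \<in> B s then (v i * cnj (v j)) * (cnj (v k) * v k) else 0)"
    unfolding fmult_def fadj_def rank_one_def by (intro sum.cong refl) auto
  also have "\<dots> = fscale (of_real (sqnorm B s v)) (rank_one B s v) t i j"
    by (auto simp: rank_one_def sum_distrib_left[symmetric] sesq_self_sqnorm)
  finally show "fmult B (rank_one B s v) (fadj (rank_one B s v)) t i j
      = fscale (of_real (sqnorm B s v)) (rank_one B s v) t i j" .
qed

lemma sesq_fmult_fadj_nonneg: "0 \<le> sesq C u w w (fmult C a (fadj a))"
proof -
  have "sesq C u w w (fmult C a (fadj a)) = (\<Sum>i\<in>C u. \<Sum>j\<in>C u. \<Sum>k\<in>C u. (cnj (w i) * a u i k) * cnj (cnj (w j) * a u j k))"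
    unfolding sesq_def fmult_def fadj_def sum_distrib_left sum_distrib_right
    by (intro sum.cong refl) (simp add: mult_ac)
  also have "\<dots> = (\<Sum>i\<in>C u. \<Sum>k\<in>C u. \<Sum>j\<in>C u. (cnj (w i) * a u i k) * cnj (cnj (w j) * a u j k))"
    by (intro sum.cong refl sum.swap)
  also have "\<dots> = (\<Sum>k\<in>C u. \<Sum>i\<in>C u. \<Sum>j\<in>C u. (cnj (w i) * a u i k) * cnj (cnj (w j) * a u j k))"
    by (rule sum.swap)
  also have "\<dots> = (\<Sum>k\<in>C u. (\<Sum>i\<in>C u. cnj (w i) * a u i k) * cnj (\<Sum>i\<in>C u. cnj (w i) * a u i k))"
    by (simp add: sum_product)
  also have "\<dots> = of_real (\<Sum>k\<in>C u. (cmod (\<Sum>i\<in>C u. cnj (w i) * a u i k))\<^sup>2)"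
    unfolding of_real_sum complex_norm_square ..
  also have "0 \<le> \<dots>" by (simp add: less_eq_complex_def sum_nonneg del: of_real_sum)
  finally show ?thesis .
qed

lemma star_hom_linear:
  assumes "star_hom B C T"
  shows "linear_fun B (\<lambda>x. sesq C u v w (T x))"
  using assms by (auto simp: star_hom_def linear_fun_def sesq_add sesq_scale)

lemma star_hom_linf: "star_hom B C T \<Longrightarrow> x \<in> linf B \<Longrightarrow> T x \<in> linf C"
  by (simp add: star_hom_def)

text \<open>
  For \<open>r = v v\<^sup>*\<close> the image of \<open>\<parallel>v\<parallel>\<^sup>2 r = r r\<^sup>*\<close> is \<open>T(r) T(r)\<^sup>*\<close>.
\<close>

lemma star_hom_rank_one_pos:
  assumes fd: "fd B" and T: "star_hom B C T"
  shows "0 \<le> sesq C u w w (T (rank_one B s v))"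
proof (cases "sqnorm B s v = 0")
  case True
  then have "rank_one B s v = 0" by (auto simp: rank_one_def sqnorm_eq_0_iff[OF fd] fun_eq_iff)
  then show ?thesis using linear_fun_zero[OF star_hom_linear[OF T]] by (metis order_refl)
next
  case False
  let ?r = "rank_one B s v"
  have r: "?r \<in> linf B" by (rule rank_one_linf[OF fd])
  have "fmult C (T ?r) (fadj (T ?r)) = fscale (of_real (sqnorm B s v)) (T ?r)"
    using T r fmult_rank_one_self[of B s v] linf_adj[OF r] unfolding star_hom_def by metis
  then have "0 \<le> of_real (sqnorm B s v) * sesq C u w w (T ?r)"
    using sesq_fmult_fadj_nonneg[of C u w "T ?r"] by (simp only: sesq_scale)
  moreover have "sqnorm B s v > 0" using False sqnorm_nonneg[of B s v] by linarith
  ultimately show ?thesis by (simp add: less_eq_complex_def zero_le_mult_iff)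
qed

text \<open>
  The images of the truncations of \<open>x \<ge> 0\<close> increase and are bounded by \<open>T x\<close>. Hence they converge
  entrywise to some \<open>y \<le> T x\<close>, and \<open>y\<close> is a bounded upper bound of all of them. Since \<open>T x\<close> is
  their supremum, \<open>y = T x\<close>.
\<close>

lemma pnm_normal_star_hom:
  assumes fd: "fd B" "fd C" and T: "star_hom B C T" and n: "normal_map B C T"
  shows "pnm B C T"
proof -
  let ?q = "\<lambda>u v x. sesq C u v v (T x)"
  note lin = star_hom_linear[OF T] and TC = star_hom_linf[OF T]
  have cutpos: "0 \<le> ?q u v (cut s x)" if "fpos B x" for u v s x
    using cut_le_from_rank_one[OF fd(1) npf_linear[OF npf_zero] lin that star_hom_rank_one_pos[OF fd(1) T]] by simp
  have main: "((\<lambda>s. ?q u v (cut s x)) has_sum ?q u v x) UNIV" if x: "x \<in> linf_pos B" for u v x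
  proof -
    have xp: "fpos B x" and xl: "x \<in> linf B" using x by (auto simp: linf_pos_iff)
    have cl: "cut s x \<in> linf B" for s by (rule linf_posD[OF cut_linf_pos[OF fd(1) xp]])
    let ?p = "\<lambda>F. \<Sum>s\<in>F. cut s x"
    have pl: "?p F \<in> linf B" for F by (intro linf_sum cl)
    have sup: "is_sup C (T ` finite_cuts x) (T x)"
      using n finite_cuts[OF fd(1) x] by (auto simp: normal_map_def)
    have part: "?q u v (?p F) = (\<Sum>s\<in>F. ?q u v (cut s x))" for F u v
      by (rule linear_fun_sum[OF lin cl])
    have le: "(\<Sum>s\<in>F. ?q u v (cut s x)) \<le> ?q u v x" if "finite F" for F u v
    proof -
      have "fle C (T (?p F)) (T x)" using sup that by (auto simp: is_sup_def finite_cuts_def)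
      then show ?thesis
        unfolding part[symmetric] fle_iff[OF linf_funs[OF TC[OF pl]] linf_funs[OF TC[OF xl]]] by blast
    qed
    have le': "(\<Sum>s\<in>F. Re (?q u v (cut s x))) \<le> Re (?q u v x)" if "finite F" for F u v
      using le[OF that, of u v] by (simp add: less_eq_complex_def)
    have summ: "(\<lambda>s. ?q u v (cut s x)) summable_on UNIV" for u v
    proof -
      have "(\<lambda>s. Re (?q u v (cut s x))) summable_on UNIV"
        by (rule nonneg_bdd_above_summable_on)
          (use le' cutpos[OF xp] in \<open>auto simp: less_eq_complex_def intro!: bdd_aboveI\<close>)
      then obtain r where r: "((\<lambda>s. Re (?q u v (cut s x))) has_sum r) UNIV" by (auto simp: summable_on_def)
      have "((\<lambda>s. ?q u v (cut s x)) has_sum of_real r) UNIV"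
        using has_sum_complex_of_real_iff[of UNIV "\<lambda>s. ?q u v (cut s x)" "of_real r"] cutpos[OF xp] r by simp
      then show ?thesis by (rule has_sum_imp_summable)
    qed
    have summ_ent: "(\<lambda>s. T (cut s x) u k l) summable_on UNIV" for u k l
      by (rule summable_polarize[OF fd(2) linf_funs[OF TC[OF cl]] summ])
    define y where "y = (\<lambda>u k l. infsum (\<lambda>s. T (cut s x) u k l) UNIV)"
    have y: "((\<lambda>s. T (cut s x) u k l) has_sum y u k l) UNIV" for u k l
      unfolding y_def using summ_ent by simp
    have qy: "((\<lambda>s. ?q u v (cut s x)) has_sum sesq C u v v y) UNIV" for u v
      by (rule has_sum_sesq) (rule y)
    have yf: "y \<in> funs C"
    proof (rule funsI)
      fix u k l assume "k \<notin> C u \<or> l \<notin> C u"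
      then have "T (cut s x) u k l = 0" for s using funs_zero[OF linf_funs[OF TC[OF cl]]] by blast
      then show "y u k l = 0" by (simp add: y_def)
    qed
    have yp: "fpos C y"
      unfolding fpos_iff using yf has_sum_nonneg_complex[OF qy] cutpos[OF xp] by blast
    have qyr: "((\<lambda>s. Re (?q u v (cut s x))) has_sum Re (sesq C u v v y)) UNIV" for u v
      by (rule has_sum_Re[OF qy])
    have Tx0: "Im (?q u v x) = 0" for u v
      using le[of "{}" u v] by (simp add: less_eq_complex_def)
    have ylex: "sesq C u v v y \<le> ?q u v x" for u v
      using has_sum_le_finite_sums[OF qyr[of u v] le'] fposD[OF yp, of u v] Tx0[of u v]
      by (simp add: less_eq_complex_def)
    have yl: "y \<in> linf C"
      by (rule linf_posD[OF fpos_dominated_linf[OF yp TC[OF xl] ylex]])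
    have "fle C z y" if z: "z \<in> T ` finite_cuts x" for z
    proof -
      obtain F where F: "finite F" "z = T (?p F)" using z by (auto simp: finite_cuts_def)
      have "?q u v (?p F) \<le> sesq C u v v y" for u v
      proof -
        have "(\<Sum>s\<in>F. Re (?q u v (cut s x))) \<le> Re (sesq C u v v y)"
          by (rule finite_sum_le_has_sum[OF qyr]) (use F cutpos[OF xp] in \<open>auto simp: less_eq_complex_def\<close>)
        moreover have "Im (\<Sum>s\<in>F. ?q u v (cut s x)) = 0"
          using cutpos[OF xp] by (simp add: less_eq_complex_def)
        ultimately show ?thesis unfolding part using fposD[OF yp, of u v] by (simp add: less_eq_complex_def)
      qed
      then show ?thesis unfolding F(2) fle_iff[OF linf_funs[OF TC[OF pl]] yf] by blast
    qed
    then have "fle C (T x) y" using sup yl by (auto simp: is_sup_def)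
    then have "?q u v x \<le> sesq C u v v y" for u v
      unfolding fle_iff[OF linf_funs[OF TC[OF xl]] yf] by blast
    with ylex have "sesq C u v v y = ?q u v x" for u v by (intro antisym)
    with qy show ?thesis by simp
  qed
  have pos: "0 \<le> ?q u v x" if "x \<in> linf_pos B" for u v x
    by (rule has_sum_nonneg_complex[OF main[OF that]]) (use that cutpos in \<open>auto simp: linf_pos_iff\<close>)
  show ?thesis unfolding pnm_def npf_def by (intro conjI ballI allI TC lin pos main)
qed

section \<open>Convolution\<close>

text \<open>
  The map \<open>(\<iota> \<otimes> \<phi>)\<Delta>\<close>, the right-handed counterpart of \<open>conv_op\<close>.
\<close>

definition rconv_op ::
    "(('i, 'b) fam \<Rightarrow> ('i \<times> 'i, 'b \<times> 'b) fam) \<Rightarrow> (('i, 'b) fam \<Rightarrow> complex) \<Rightarrow>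
     ('i, 'b) fam \<Rightarrow> ('i, 'b) fam" where
  "rconv_op \<Delta> \<phi> a = id_fun \<phi> (\<Delta> a)"

lemma conv_eq_rconv_op: "conv \<Delta> \<omega> \<tau> x = \<omega> (rconv_op \<Delta> \<tau> x)"
  by (simp add: conv_def rconv_op_def)

context discrete_quantum_group
begin

lemma fdB: "fd B"
  by (simp add: fd_def finite_dim)

lemma fdBB: "fd (B \<otimes>\<^sub>B B)"
  by (rule fd_tens[OF fdB fdB])

lemma pnm_comult: "pnm B (B \<otimes>\<^sub>B B) \<Delta>"
  by (rule pnm_normal_star_hom[OF fdB fdBB comult_hom comult_normal])

lemma comult_linf: "x \<in> linf B \<Longrightarrow> \<Delta> x \<in> linf (B \<otimes>\<^sub>B B)"
  by (rule pnm_linf[OF pnm_comult])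

lemma pnm_conv_op: "npf B \<omega> \<Longrightarrow> pnm B B (conv_op \<Delta> \<omega>)"
  unfolding conv_op_def[abs_def] by (rule pnm_comp[OF fdB fdBB pnm_fun_id[OF fdB fdB] pnm_comult])

lemma pnm_rconv_op: "npf B \<omega> \<Longrightarrow> pnm B B (rconv_op \<Delta> \<omega>)"
  unfolding rconv_op_def[abs_def] by (rule pnm_comp[OF fdB fdBB pnm_id_fun[OF fdB fdB] pnm_comult])

lemma conv_op_linf: "nfun B \<omega> \<Longrightarrow> x \<in> linf B \<Longrightarrow> conv_op \<Delta> \<omega> x \<in> linf B"
  unfolding conv_op_def by (rule fun_id_linf[OF fdB fdB _ comult_linf])

lemma rconv_op_linf: "nfun B \<omega> \<Longrightarrow> x \<in> linf B \<Longrightarrow> rconv_op \<Delta> \<omega> x \<in> linf B"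
  unfolding rconv_op_def by (rule id_fun_linf[OF fdB fdB _ comult_linf])

lemma conv_eq_conv_op: "nfun B \<omega> \<Longrightarrow> nfun B \<tau> \<Longrightarrow> x \<in> linf B \<Longrightarrow> conv \<Delta> \<omega> \<tau> x = \<tau> (conv_op \<Delta> \<omega> x)"
  unfolding conv_def conv_op_def by (rule Fubini[OF fdB fdB _ _ comult_linf])

lemma npf_conv: "npf B \<omega> \<Longrightarrow> npf B \<tau> \<Longrightarrow> npf B (conv \<Delta> \<omega> \<tau>)"
  unfolding conv_eq_rconv_op[abs_def] by (rule npf_comp[OF fdB fdB _ pnm_rconv_op])

lemma nfun_conv: "nfun B \<omega> \<Longrightarrow> nfun B \<tau> \<Longrightarrow> nfun B (conv \<Delta> \<omega> \<tau>)"
  unfolding conv_def[abs_def] by (rule nfun_comp[OF fdB fdBB pnm_comult nfun_id_fun[OF fdB fdB]])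

lemma conv_cong_left:
  assumes "nfun B \<tau>" "x \<in> linf B" "\<And>y. y \<in> linf B \<Longrightarrow> \<omega> y = \<omega>' y"
  shows "conv \<Delta> \<omega> \<tau> x = conv \<Delta> \<omega>' \<tau> x"
  unfolding conv_eq_rconv_op by (rule assms(3)[OF rconv_op_linf[OF assms(1,2)]])

lemma conv_cong_right:
  assumes "x \<in> linf B" "\<And>y. y \<in> linf B \<Longrightarrow> \<tau> y = \<tau>' y"
  shows "conv \<Delta> \<omega> \<tau> x = conv \<Delta> \<omega> \<tau>' x"
proof -
  have "id_fun \<tau> (\<Delta> x) = id_fun \<tau>' (\<Delta> x)"
    unfolding id_fun_def by (intro ext assms(2) slice2_linf[OF fdB fdB comult_linf[OF assms(1)]])
  then show ?thesis by (simp only: conv_def)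
qed

text \<open>
  Moving \<open>\<Delta>\<close> through the slice by \<open>\<sigma>\<close> turns the left-hand side into \<open>\<omega> \<otimes> \<tau> \<otimes> \<sigma>\<close> applied to
  \<open>(\<Delta> \<otimes> \<iota>)\<Delta>(x)\<close>; the right-hand side is the same for \<open>(\<iota> \<otimes> \<Delta>)\<Delta>(x)\<close>.
\<close>

lemma conv_assoc:
  assumes \<sigma>: "nfun B \<sigma>" and x: "x \<in> linf B"
  shows "conv \<Delta> (conv \<Delta> \<omega> \<tau>) \<sigma> x = conv \<Delta> \<omega> (conv \<Delta> \<tau> \<sigma>) x"
proof -
  let ?z = "map_id \<Delta> (\<Delta> x)"
  have "\<Delta> (id_fun \<sigma> (\<Delta> x)) = id_fun \<sigma> ?z"
    by (rule id_fun_map_id[OF fdB fdB fdBB pnm_comult \<sigma> comult_linf[OF x], symmetric])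
  then have "conv \<Delta> (conv \<Delta> \<omega> \<tau>) \<sigma> x = \<omega> (id_fun \<tau> (id_fun \<sigma> ?z))"
    by (simp only: conv_def)
  also have "id_fun \<tau> (id_fun \<sigma> ?z) = id_fun (conv \<Delta> \<tau> \<sigma>) (\<Delta> x)"
  proof (intro ext)
    fix s i j
    have "slice2 (id_fun \<sigma> ?z) s i j = id_fun \<sigma> (\<Delta> (slice2 (\<Delta> x) s i j))"
    proof (intro ext)
      fix t k l
      have "slice2 ?z (s, t) (i, k) (j, l) = slice2 (slice2 (reassoc ?z) s i j) t k l"
        by (simp add: slice2_def reassoc_def)
      also have "\<dots> = slice2 (\<Delta> (slice2 (\<Delta> x) s i j)) t k l"
        unfolding coassoc[OF x] by (auto simp: slice2_def id_map_def fun_eq_iff)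
      finally have "slice2 ?z (s, t) (i, k) (j, l) = slice2 (\<Delta> (slice2 (\<Delta> x) s i j)) t k l" .
      moreover have "slice2 (id_fun \<sigma> ?z) s i j t k l = \<sigma> (slice2 ?z (s, t) (i, k) (j, l))"
        by (simp add: slice2_def id_fun_def)
      ultimately show "slice2 (id_fun \<sigma> ?z) s i j t k l = id_fun \<sigma> (\<Delta> (slice2 (\<Delta> x) s i j)) t k l"
        by (simp only: id_fun_def)
    qed
    then have "\<tau> (slice2 (id_fun \<sigma> ?z) s i j) = \<tau> (id_fun \<sigma> (\<Delta> (slice2 (\<Delta> x) s i j)))"
      by (rule arg_cong)
    then show "id_fun \<tau> (id_fun \<sigma> ?z) s i j = id_fun (conv \<Delta> \<tau> \<sigma>) (\<Delta> x) s i j"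
      by (simp only: id_fun_def[of \<tau>] id_fun_def[of "conv \<Delta> \<tau> \<sigma>"] conv_def)
  qed
  finally show ?thesis by (simp only: conv_def)
qed

lemma conv_one:
  assumes "linear_fun B \<omega>" "linear_fun B \<tau>"
  shows "conv \<Delta> \<omega> \<tau> (fone B) = \<omega> (fone B) * \<tau> (fone B)"
proof -
  have "slice2 (fone (B \<otimes>\<^sub>B B)) s i j = fscale (fone B s i j) (fone B)" for s i j
    by (auto simp: slice2_def fone_def btens_def fun_eq_iff)
  then have "id_fun \<tau> (\<Delta> (fone B)) s i j = fscale (\<tau> (fone B)) (fone B) s i j" for s i j
    unfolding comult_one id_fun_def
    using linear_fun_scale[OF assms(2) fone_linf[OF fdB]] by (simp only: fscale_apply mult.commute)
  then have "id_fun \<tau> (\<Delta> (fone B)) = fscale (\<tau> (fone B)) (fone B)" by (intro ext)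
  then show ?thesis
    using linear_fun_scale[OF assms(1) fone_linf[OF fdB]] by (simp only: conv_def mult.commute)
qed

lemma npf_conv_pow: "npf B \<phi> \<Longrightarrow> npf B (conv_pow_Suc \<Delta> \<phi> n)"
  by (induction n) (auto intro: npf_conv)

lemma conv_pow_one: "npf B \<phi> \<Longrightarrow> \<phi> (fone B) = 1 \<Longrightarrow> conv_pow_Suc \<Delta> \<phi> n (fone B) = 1"
  by (induction n) (simp_all add: conv_one npf_linear npf_conv_pow)

end

section \<open>Domination of normal functionals by compactness\<close>

text \<open>
  Vectors are extended by zero outside the basis, since otherwise the sphere would not be compact
  in the space of all functions.
\<close>

definition unit_sphere :: "('i \<Rightarrow> 'b set) \<Rightarrow> 'i \<Rightarrow> ('b \<Rightarrow> complex) set" where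
  "unit_sphere B s = {v. (\<forall>i. i \<notin> B s \<longrightarrow> v i = 0) \<and> sqnorm B s v = 1}"

lemma continuous_coordinate [continuous_intros]:
  "continuous_on S f \<Longrightarrow> continuous_on S (\<lambda>x. (f x :: 'b \<Rightarrow> complex) i)"
  by (rule continuous_on_compose2[OF continuous_on_product_coordinates]) auto

lemma compact_unit_sphere:
  assumes fd: "fd B"
  shows "compact (unit_sphere B s)"
proof -
  let ?S = "\<lambda>i. if i \<in> B s then cball (0::complex) 1 else {0}"
  have "compactin (product_topology (\<lambda>i. euclidean) UNIV) (PiE UNIV ?S)"
    by (subst compactin_PiE) (auto simp: compactin_euclidean_iff)
  then have c: "compact (PiE UNIV ?S)"
    by (simp add: euclidean_product_topology compactin_euclidean_iff)
  have cl: "closed {v. sqnorm B s v = 1}"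
    unfolding sqnorm_def by (intro closed_Collect_eq continuous_intros)
  have le1: "cmod (v i) \<le> 1" if "sqnorm B s v = 1" "i \<in> B s" for v i
  proof -
    have "(cmod (v i))\<^sup>2 \<le> sqnorm B s v"
      unfolding sqnorm_def using that fdD[OF fd] by (intro member_le_sum) auto
    then show ?thesis using that(1) by (simp add: power2_le_iff_abs_le[of 1, simplified] abs_square_le_1)
  qed
  have "unit_sphere B s = PiE UNIV ?S \<inter> {v. sqnorm B s v = 1}"
    by (auto simp: unit_sphere_def PiE_iff le1 split: if_splits)
  then show ?thesis using compact_Int_closed[OF c cl] by simp
qed

text \<open>
  The sets where some \<open>f m\<close> is positive cover \<open>K\<close>, so finitely many of them do, and the
  corresponding sum attains a positive minimum.
\<close>

lemma compact_sum_bounded_below: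
  fixes f :: "nat \<Rightarrow> 'x::topological_space \<Rightarrow> real"
  assumes K: "compact K" and f: "\<And>m. continuous_on UNIV (f m)" and f0: "\<And>m x. 0 \<le> f m x"
    and ex: "\<And>x. x \<in> K \<Longrightarrow> \<exists>m. f m x \<noteq> 0"
  shows "\<exists>M \<delta>. \<delta> > 0 \<and> (\<forall>x\<in>K. \<delta> \<le> (\<Sum>m<M. f m x))"
proof (cases "K = {}")
  case True
  then show ?thesis by (intro exI[of _ 0] exI[of _ 1]) auto
next
  case False
  have op: "open {x. 0 < f m x}" for m by (intro open_Collect_less continuous_intros f)
  have cov: "K \<subseteq> (\<Union>m\<in>UNIV. {x. 0 < f m x})"
    using ex f0 by (force simp: less_le)
  obtain C where C: "finite C" "K \<subseteq> (\<Union>m\<in>C. {x. 0 < f m x})"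
    using compactE_image[OF K, of UNIV "\<lambda>m. {x. 0 < f m x}"] op cov by metis
  define M where "M = Suc (Max (insert 0 C))"
  have CM: "m < M" if "m \<in> C" for m using that C(1) by (simp add: M_def less_Suc_eq_le)
  have pos: "0 < (\<Sum>m<M. f m x)" if x: "x \<in> K" for x
  proof -
    obtain m where m: "m \<in> C" "0 < f m x" using C(2) x by blast
    then have "m \<in> {..<M}" using CM by simp
    then show ?thesis by (intro sum_pos2[of _ m]) (use m f0 in auto)
  qed
  obtain x0 where x0: "x0 \<in> K" "\<And>x. x \<in> K \<Longrightarrow> (\<Sum>m<M. f m x0) \<le> (\<Sum>m<M. f m x)"
  proof -
    have "continuous_on K (\<lambda>x. \<Sum>m<M. f m x)"
      by (intro continuous_on_sum continuous_on_subset[OF f]) auto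
    from continuous_attains_inf[OF K False this] show thesis using that by blast
  qed
  show ?thesis
    by (intro exI[of _ M] exI[of _ "\<Sum>m<M. f m x0"]) (use pos x0 in auto)
qed

lemma linear_fun_rank_one:
  assumes fd: "fd B" and \<tau>: "linear_fun B \<tau>"
  shows "\<tau> (rank_one B s v) = (\<Sum>i\<in>B s. \<Sum>j\<in>B s. v i * cnj (v j) * \<tau> (mat_unit s i j))"
proof -
  have "\<tau> (rank_one B s v) = \<tau> (cut s (rank_one B s v))" by (simp only: cut_rank_one)
  also have "\<dots> = (\<Sum>i\<in>B s. \<Sum>j\<in>B s. rank_one B s v s i j * \<tau> (mat_unit s i j))"
    by (rule linear_fun_cut[OF fd linf_funs[OF rank_one_linf[OF fd]] \<tau>])
  also have "\<dots> = (\<Sum>i\<in>B s. \<Sum>j\<in>B s. v i * cnj (v j) * \<tau> (mat_unit s i j))"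
    by (intro sum.cong refl) (simp add: rank_one_def)
  finally show ?thesis .
qed

lemma unit_vector:
  assumes "fd B" "sqnorm B s v \<noteq> 0"
  obtains u where "u \<in> unit_sphere B s" "\<And>i. i \<in> B s \<Longrightarrow> v i = of_real (sqrt (sqnorm B s v)) * u i"
proof -
  let ?r = "sqrt (sqnorm B s v)"
  have r: "?r > 0" using assms(2) sqnorm_nonneg[of B s v] by (simp add: less_le)
  define u where "u i = (if i \<in> B s then v i / of_real ?r else 0)" for i
  have "sqnorm B s u = (\<Sum>i\<in>B s. (cmod (v i))\<^sup>2 / sqnorm B s v)"
    unfolding sqnorm_def[of B s u] by (intro sum.cong refl) (simp add: u_def norm_divide power_divide)
  also have "\<dots> = 1" using assms(2) by (simp add: sum_divide_distrib[symmetric] flip: sqnorm_def)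
  finally have "u \<in> unit_sphere B s" by (simp add: unit_sphere_def u_def)
  then show thesis using that r by (simp add: u_def)
qed

lemma rank_one_scale:
  assumes "\<And>i. i \<in> B s \<Longrightarrow> v i = c * u i"
  shows "rank_one B s v = fscale (c * cnj c) (rank_one B s u)"
  by (auto simp: rank_one_def fun_eq_iff assms)

text \<open>
  Both sides are homogeneous of degree two in \<open>v\<close>.
\<close>

lemma rank_one_le_from_sphere:
  assumes fd: "fd B" and \<sigma>: "linear_fun B \<sigma>" and \<tau>: "linear_fun B \<tau>"
    and le: "\<And>u. u \<in> unit_sphere B s \<Longrightarrow> \<sigma> (rank_one B s u) \<le> \<tau> (rank_one B s u)"
  shows "\<sigma> (rank_one B s v) \<le> \<tau> (rank_one B s v)"
proof (cases "sqnorm B s v = 0")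
  case True
  then have "rank_one B s v = 0" by (auto simp: rank_one_def sqnorm_eq_0_iff[OF fd] fun_eq_iff)
  then show ?thesis by (simp only: linear_fun_zero[OF \<sigma>] linear_fun_zero[OF \<tau>] order_refl)
next
  case False
  obtain u where u: "u \<in> unit_sphere B s" "\<And>i. i \<in> B s \<Longrightarrow> v i = of_real (sqrt (sqnorm B s v)) * u i"
    using unit_vector[OF fd False] by blast
  let ?c = "of_real (sqrt (sqnorm B s v)) * cnj (of_real (sqrt (sqnorm B s v))) :: complex"
  have c: "?c = of_real (sqnorm B s v)" by (simp flip: of_real_mult)
  have "?c * \<sigma> (rank_one B s u) \<le> ?c * \<tau> (rank_one B s u)"
    unfolding c using le[OF u(1)] by (auto simp: less_eq_complex_def mult_left_mono)
  moreover have e: "rank_one B s v = fscale ?c (rank_one B s u)"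
    by (rule rank_one_scale) (rule u(2))
  have "\<sigma> (rank_one B s v) = ?c * \<sigma> (rank_one B s u)" "\<tau> (rank_one B s v) = ?c * \<tau> (rank_one B s u)"
    unfolding e by (rule linear_fun_scale[OF \<sigma> rank_one_linf[OF fd]] linear_fun_scale[OF \<tau> rank_one_linf[OF fd]])+
  ultimately show ?thesis by (simp only:)
qed

lemma continuous_rank_one:
  assumes "fd B" "linear_fun B \<tau>"
  shows "continuous_on S (\<lambda>v. \<tau> (rank_one B s v))"
  unfolding linear_fun_rank_one[OF assms] by (intro continuous_intros continuous_on_id)

text \<open>
  On the unit sphere of a block a finite sum of the \<open>\<tau> m\<close> is bounded below and \<open>\<omega>\<close> is bounded
  above.
\<close>

lemma npf_block_dominated:
  fixes \<tau> :: "nat \<Rightarrow> ('i, 'b) fam \<Rightarrow> complex"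
  assumes fd: "fd B" and \<omega>: "npf B \<omega>" and \<tau>: "\<And>m. npf B (\<tau> m)"
    and ex: "\<And>v. sqnorm B s v \<noteq> 0 \<Longrightarrow> \<exists>m. \<tau> m (rank_one B s v) \<noteq> 0"
  shows "\<exists>M C. C \<ge> 0 \<and> (\<forall>x. fpos B x \<longrightarrow> \<omega> (cut s x) \<le> of_real C * (\<Sum>m<M. \<tau> m (cut s x)))"
proof -
  note lin = npf_linear[OF \<tau>] and K = compact_unit_sphere[OF fd, of s]
  have pos: "0 \<le> \<tau> m (rank_one B s v)" "0 \<le> \<omega> (rank_one B s v)" for m v
    by (rule npf_pos[OF \<tau> rank_one_linf_pos[OF fd]] npf_pos[OF \<omega> rank_one_linf_pos[OF fd]])+
  obtain M \<delta> where \<delta>: "\<delta> > 0" "\<And>u. u \<in> unit_sphere B s \<Longrightarrow> \<delta> \<le> (\<Sum>m<M. Re (\<tau> m (rank_one B s u)))"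
  proof -
    have "\<exists>M \<delta>. \<delta> > 0 \<and> (\<forall>u\<in>unit_sphere B s. \<delta> \<le> (\<Sum>m<M. Re (\<tau> m (rank_one B s u))))"
    proof (rule compact_sum_bounded_below[OF K, where f = "\<lambda>m v. Re (\<tau> m (rank_one B s v))"])
      show "continuous_on UNIV (\<lambda>v. Re (\<tau> m (rank_one B s v)))" for m
        by (rule continuous_on_Re[OF continuous_rank_one[OF fd lin]])
      show "0 \<le> Re (\<tau> m (rank_one B s v))" for m v using pos(1) by (simp add: less_eq_complex_def)
      fix u assume "u \<in> unit_sphere B s"
      then obtain m where "\<tau> m (rank_one B s u) \<noteq> 0" using ex[of u] by (auto simp: unit_sphere_def)
      then show "\<exists>m. Re (\<tau> m (rank_one B s u)) \<noteq> 0"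
        using pos(1)[of m u] by (auto simp: less_eq_complex_def complex_eq_iff)
    qed
    then show thesis using that by blast
  qed
  obtain K0 where K0: "\<And>u. u \<in> unit_sphere B s \<Longrightarrow> cmod (\<omega> (rank_one B s u)) \<le> K0"
  proof -
    have "compact ((\<lambda>v. \<omega> (rank_one B s v)) ` unit_sphere B s)"
      by (rule compact_continuous_image[OF continuous_rank_one[OF fd npf_linear[OF \<omega>]] K])
    then have "bounded ((\<lambda>v. \<omega> (rank_one B s v)) ` unit_sphere B s)" by (rule compact_imp_bounded)
    then show thesis using that by (auto simp: bounded_iff)
  qed
  define C where "C = \<bar>K0\<bar> / \<delta>"
  have C: "C \<ge> 0" using \<delta>(1) by (simp add: C_def)
  let ?\<psi> = "\<lambda>x. of_real C * (\<Sum>m<M. \<tau> m x)"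
  have \<psi>: "npf B ?\<psi>" by (intro npf_scale npf_sum \<tau> C)
  have "\<omega> (rank_one B s v) \<le> ?\<psi> (rank_one B s v)" for v
  proof (rule rank_one_le_from_sphere[OF fd npf_linear[OF \<omega>] npf_linear[OF \<psi>]])
    fix u assume u: "u \<in> unit_sphere B s"
    have "Re (\<omega> (rank_one B s u)) \<le> \<bar>K0\<bar>" using K0[OF u] complex_Re_le_cmod[of "\<omega> (rank_one B s u)"] by linarith
    also have "\<bar>K0\<bar> = C * \<delta>" using \<delta>(1) by (simp add: C_def)
    also have "\<dots> \<le> C * (\<Sum>m<M. Re (\<tau> m (rank_one B s u)))" by (intro mult_left_mono \<delta>(2)[OF u] C)
    also have "\<dots> = Re (?\<psi> (rank_one B s u))" by simp
    finally show "\<omega> (rank_one B s u) \<le> ?\<psi> (rank_one B s u)"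
      using pos(2)[of u] npf_pos[OF \<psi> rank_one_linf_pos[OF fd, of s u]] by (simp add: less_eq_complex_def)
  qed
  then have "\<omega> (cut s x) \<le> ?\<psi> (cut s x)" if "fpos B x" for x
    by (rule cut_le_from_rank_one[OF fd npf_linear[OF \<omega>] npf_linear[OF \<psi>] that])
  then show ?thesis using C by blast
qed

lemma npf_dominated:
  fixes \<tau> :: "nat \<Rightarrow> ('i, 'b) fam \<Rightarrow> complex"
  assumes fd: "fd B" and \<omega>: "npf B \<omega>" and \<tau>: "\<And>m. npf B (\<tau> m)"
    and F: "finite F" and supp: "\<And>x. x \<in> linf_pos B \<Longrightarrow> \<omega> x = (\<Sum>s\<in>F. \<omega> (cut s x))"
    and ex: "\<And>s v. s \<in> F \<Longrightarrow> sqnorm B s v \<noteq> 0 \<Longrightarrow> \<exists>m. \<tau> m (rank_one B s v) \<noteq> 0"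
  shows "\<exists>M C. C \<ge> 0 \<and> (\<forall>x\<in>linf_pos B. \<omega> x \<le> of_real C * (\<Sum>m<M. \<tau> m x))"
proof -
  have "\<exists>M C. C \<ge> 0 \<and> (\<forall>x. fpos B x \<longrightarrow> \<omega> (cut s x) \<le> of_real C * (\<Sum>m<M. \<tau> m (cut s x)))" if "s \<in> F" for s
    by (rule npf_block_dominated[OF fd \<omega> \<tau> ex[OF that]])
  then obtain M C where MC: "\<And>s. s \<in> F \<Longrightarrow> C s \<ge> 0"
    "\<And>s x. s \<in> F \<Longrightarrow> fpos B x \<Longrightarrow> \<omega> (cut s x) \<le> of_real (C s) * (\<Sum>m<M s. \<tau> m (cut s x))"
    by metis
  define M' where "M' = (\<Sum>s\<in>F. M s)"
  define C' where "C' = (\<Sum>s\<in>F. C s)"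
  have C': "C' \<ge> 0" by (simp add: C'_def MC(1) sum_nonneg)
  have \<psi>: "npf B (\<lambda>x. \<Sum>m<M'. \<tau> m x)" by (intro npf_sum \<tau>)
  have "\<omega> x \<le> of_real C' * (\<Sum>m<M'. \<tau> m x)" if x: "x \<in> linf_pos B" for x
  proof -
    have xp: "fpos B x" using x by (simp add: linf_pos_iff)
    have t0: "0 \<le> Re (\<tau> m (cut s x))" for m s
      using npf_pos[OF \<tau> cut_linf_pos[OF fd xp]] by (simp add: less_eq_complex_def)
    have le: "Re (\<Sum>m<M'. \<tau> m (cut s x)) \<le> Re (\<Sum>m<M'. \<tau> m x)" for s
    proof -
      have "Re (\<tau> m (cut s x)) \<le> Re (\<tau> m x)" for m
      proof -
        have "sum (\<lambda>s. Re (\<tau> m (cut s x))) {s} \<le> Re (\<tau> m x)"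
          by (rule finite_sum_le_has_sum[OF has_sum_Re[OF npf_has_sum[OF \<tau> x]]]) (use t0 in auto)
        then show ?thesis by simp
      qed
      then show ?thesis by (simp add: sum_mono)
    qed
    have "Re (\<omega> x) = (\<Sum>s\<in>F. Re (\<omega> (cut s x)))" using supp[OF x] by simp
    also have "\<dots> \<le> (\<Sum>s\<in>F. C s * Re (\<Sum>m<M'. \<tau> m x))"
    proof (rule sum_mono)
      fix s assume s: "s \<in> F"
      have "Re (\<omega> (cut s x)) \<le> C s * Re (\<Sum>m<M s. \<tau> m (cut s x))"
        using MC(2)[OF s xp] by (simp add: less_eq_complex_def)
      also have "M s \<le> M'" unfolding M'_def using s F by (intro member_le_sum) auto
      then have "Re (\<Sum>m<M s. \<tau> m (cut s x)) \<le> Re (\<Sum>m<M'. \<tau> m (cut s x))"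
        using t0 by (simp add: sum_mono2)
      then have "C s * Re (\<Sum>m<M s. \<tau> m (cut s x)) \<le> C s * Re (\<Sum>m<M'. \<tau> m x)"
        using le[of s] MC(1)[OF s] by (intro mult_left_mono) auto
      finally show "Re (\<omega> (cut s x)) \<le> C s * Re (\<Sum>m<M'. \<tau> m x)" by simp
    qed
    also have "\<dots> = C' * Re (\<Sum>m<M'. \<tau> m x)" by (simp only: C'_def sum_distrib_right)
    finally show ?thesis
      using npf_pos[OF \<omega> x] npf_pos[OF \<psi> x] by (simp add: less_eq_complex_def)
  qed
  then show ?thesis using C' by blast
qed

section \<open>Nondegeneracy of the comultiplication\<close>

text \<open>
  The assumption says that the expectation of the positive operator \<open>y\<close> in each vector
  \<open>v \<otimes> e\<^sub>k\<close> is zero, so \<open>y\<close> annihilates these vectors.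
\<close>

lemma fun_id_vector_kernel:
  assumes fd: "fd B" "fd C" and yp: "fpos (B \<otimes>\<^sub>B C) y" and z: "fun_id (sesq B s v v) y = 0"
  shows "(\<Sum>m\<in>B s. y (s, t) a (m, k) * v m) = 0"
proof (cases "a \<in> (B \<otimes>\<^sub>B C) (s, t) \<and> k \<in> C t")
  case True
  let ?u = "vec_tens v (basis_vec k)"
  have "sesq (B \<otimes>\<^sub>B C) (s, t) ?u ?u y = 0"
    unfolding sesq_fun_id_sesq[symmetric] z by simp
  then have "sesq (B \<otimes>\<^sub>B C) (s, t) (basis_vec a) ?u y = 0" by (rule fpos_kernel[OF yp])
  moreover have "sesq (B \<otimes>\<^sub>B C) (s, t) (basis_vec a) ?u y = (\<Sum>p\<in>B s \<times> C t. y (s, t) a p * ?u p)"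
  proof -
    have "sesq (B \<otimes>\<^sub>B C) (s, t) (basis_vec a) ?u y
      = (\<Sum>c\<in>(B \<otimes>\<^sub>B C) (s, t). if c = a then (\<Sum>p\<in>B s \<times> C t. y (s, t) c p * ?u p) else 0)"
      unfolding sesq_def by (intro sum.cong refl) (auto simp: basis_vec_def btens_def)
    also have "\<dots> = (\<Sum>p\<in>B s \<times> C t. y (s, t) a p * ?u p)"
      using True by (subst sum.delta[OF fdD[OF fd_tens[OF fd]]]) simp
    finally show ?thesis .
  qed
  moreover have "(\<Sum>p\<in>B s \<times> C t. y (s, t) a p * ?u p) = (\<Sum>m\<in>B s. y (s, t) a (m, k) * v m)"
    unfolding sum_Times
  proof (intro sum.cong refl)
    fix m
    have "(\<Sum>l\<in>C t. y (s, t) a (m, l) * ?u (m, l)) = (\<Sum>l\<in>C t. if l = k then y (s, t) a (m, l) * v m else 0)"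
      by (intro sum.cong refl) (simp add: vec_tens_def basis_vec_def)
    also have "\<dots> = y (s, t) a (m, k) * v m"
      using True by (subst sum.delta[OF fdD[OF fd(2)]]) simp
    finally show "(\<Sum>l\<in>C t. y (s, t) a (m, l) * ?u (m, l)) = y (s, t) a (m, k) * v m" .
  qed
  ultimately show ?thesis by simp
next
  case False
  have "y (s, t) a (m, k) = 0" for m
    using funs_zero[OF conjunct1[OF yp[unfolded fpos_iff]], of a "(s, t)" "(m, k)"] False by (auto simp: btens_def)
  then show ?thesis by simp
qed

context discrete_quantum_group
begin

lemma tens_rank_one_zero:
  assumes fd: "fd B" and v: "sqnorm B s v \<noteq> 0"
  shows "(\<And>p a b. (rank_one B s v \<otimes>\<^sub>F x) p a b = 0) \<Longrightarrow> x = 0"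
    "(\<And>p a b. (x \<otimes>\<^sub>F rank_one B s v) p a b = 0) \<Longrightarrow> x = 0"
proof -
  obtain i where i: "i \<in> B s" "v i \<noteq> 0" using v by (auto simp: sqnorm_eq_0_iff[OF fd])
  then have r: "rank_one B s v s i i \<noteq> 0" by (simp add: rank_one_def)
  show "x = 0" if z: "\<And>p a b. (rank_one B s v \<otimes>\<^sub>F x) p a b = 0"
  proof (intro ext)
    fix t k l show "x t k l = 0 t k l"
      using z[of "(s, t)" "(i, k)" "(i, l)"] r by (simp add: ftens_def)
  qed
  show "x = 0" if z: "\<And>p a b. (x \<otimes>\<^sub>F rank_one B s v) p a b = 0"
  proof (intro ext)
    fix t k l show "x t k l = 0 t k l"
      using z[of "(t, s)" "(k, i)" "(l, i)"] r by (simp add: ftens_def)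
  qed
qed

text \<open>
  Since \<open>\<Delta>(x)\<close> annihilates \<open>v \<otimes> H\<^sub>t\<close> for all \<open>t\<close>, \<open>(v v\<^sup>* \<otimes> 1)\<Delta>(x) = 0\<close>, and the canonical map
  \<open>a \<otimes> b \<mapsto> (a \<otimes> 1)\<Delta>(b)\<close> is injective.
\<close>

lemma conv_op_vector_zeroD:
  assumes x: "fpos B x" "x \<in> cfin B" and v: "sqnorm B s v \<noteq> 0"
    and z: "conv_op \<Delta> (sesq B s v v) x = 0"
  shows "x = 0"
proof -
  let ?y = "\<Delta> x" and ?r = "rank_one B s v"
  have xl: "x \<in> linf_pos B" using x cfin_linf[OF fdB] by (simp add: linf_pos_iff)
  have y: "?y \<in> linf_pos (B \<otimes>\<^sub>B B)" by (rule pnm_linf_pos[OF pnm_comult xl])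
  then have yp: "fpos (B \<otimes>\<^sub>B B) ?y" by (simp add: linf_pos_iff)
  have ker: "(\<Sum>m\<in>B s. ?y (s, t) a (m, k) * v m) = 0" for t a k
    by (rule fun_id_vector_kernel[OF fdB fdB yp z[unfolded conv_op_def]])
  have "fmult (B \<otimes>\<^sub>B B) (?r \<otimes>\<^sub>F fone B) ?y p a b = 0" for p a b
  proof -
    obtain s' t i k where p: "p = (s', t)" "a = (i, k)" by (metis prod.exhaust)
    have "fmult (B \<otimes>\<^sub>B B) (?r \<otimes>\<^sub>F fone B) ?y p a b
        = (\<Sum>m\<in>B s'. \<Sum>n\<in>B t. ?r s' i m * fone B t k n * ?y (s', t) (m, n) b)"
      by (simp add: fmult_def btens_def p sum_Times ftens_def)
    also have "\<dots> = (\<Sum>m\<in>B s'. \<Sum>n\<in>B t. if n = k then ?r s' i m * ?y (s', t) (m, n) b else 0)"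
      by (intro sum.cong refl) (auto simp: fone_def)
    also have "\<dots> = (\<Sum>m\<in>B s'. if k \<in> B t then ?r s' i m * ?y (s', t) (m, k) b else 0)"
      by (intro sum.cong refl) (subst sum.delta[OF fdD[OF fdB]], simp)
    also have "\<dots> = 0"
    proof (cases "s' = s \<and> k \<in> B t \<and> i \<in> B s")
      case True
      have "(\<Sum>m\<in>B s'. if k \<in> B t then ?r s' i m * ?y (s', t) (m, k) b else 0)
          = (\<Sum>m\<in>B s. v i * cnj (?y (s, t) b (m, k) * v m))"
        using True by (intro sum.cong) (auto simp: rank_one_def fpos_hermitian[OF fdBB yp, of "(s, t)" _ b])
      also have "\<dots> = v i * cnj (\<Sum>m\<in>B s. ?y (s, t) b (m, k) * v m)"
        by (simp only: sum_distrib_left cnj_sum)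
      finally show ?thesis by (simp only: ker) simp
    next
      case False
      then show ?thesis by (intro sum.neutral) (auto simp: rank_one_def)
    qed
    finally show ?thesis .
  qed
  then have "fmult (B \<otimes>\<^sub>B B) (?r \<otimes>\<^sub>F fone B) ?y = 0" by (intro ext) (simp only: zero_fun_apply)
  moreover have "[(?r, x)] \<in> lists (cfin B \<times> cfin B)" using x(2) rank_one_cfin by simp
  ultimately have "?r \<otimes>\<^sub>F x = 0"
    using T2_inj[of "[(?r, x)]"] by (simp only: list.map sum_list.Nil sum_list.Cons add_0_right case_prod_conv)
  then show "x = 0" by (intro tens_rank_one_zero(1)[OF fdB v]) (simp only: zero_fun_apply)
qed

text \<open>
  Here \<open>\<Delta>(x)(1 \<otimes> v v\<^sup>*) = 0\<close>, and \<open>a \<otimes> b \<mapsto> \<Delta>(a)(1 \<otimes> b)\<close> is injective.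
\<close>

lemma rconv_op_vector_zeroD:
  assumes x: "fpos B x" "x \<in> cfin B" and v: "sqnorm B s v \<noteq> 0"
    and z: "rconv_op \<Delta> (sesq B s v v) x = 0"
  shows "x = 0"
proof -
  let ?y = "\<Delta> x" and ?r = "rank_one B s v"
  have xl: "x \<in> linf_pos B" using x cfin_linf[OF fdB] by (simp add: linf_pos_iff)
  have y: "?y \<in> linf_pos (B \<otimes>\<^sub>B B)" by (rule pnm_linf_pos[OF pnm_comult xl])
  then have yp: "fpos (B \<otimes>\<^sub>B B) ?y" by (simp add: linf_pos_iff)
  have fyp: "fpos (B \<otimes>\<^sub>B B) (flip ?y)"
    using pnm_linf_pos[OF pnm_flip[OF fdB fdB] y] by (simp add: linf_pos_iff)
  have ker: "(\<Sum>m\<in>B s. ?y (t, s) a (k, m) * v m) = 0" for t a k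
    using fun_id_vector_kernel[OF fdB fdB fyp z[unfolded rconv_op_def id_fun_flip], of t "prod.swap a" k]
    by (cases a) (simp add: flip_def)
  have "fmult (B \<otimes>\<^sub>B B) ?y (fone B \<otimes>\<^sub>F ?r) p a b = 0" for p a b
  proof -
    obtain t s' k i where p: "p = (t, s')" "b = (k, i)" by (metis prod.exhaust)
    have "fmult (B \<otimes>\<^sub>B B) ?y (fone B \<otimes>\<^sub>F ?r) p a b
        = (\<Sum>n\<in>B t. \<Sum>m\<in>B s'. ?y (t, s') a (n, m) * (fone B t n k * ?r s' m i))"
      by (simp add: fmult_def btens_def p sum_Times ftens_def)
    also have "\<dots> = (\<Sum>n\<in>B t. if n = k then (\<Sum>m\<in>B s'. ?y (t, s') a (n, m) * ?r s' m i) else 0)"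
      by (intro sum.cong refl) (auto simp: fone_def)
    also have "\<dots> = 0"
    proof (cases "s' = s \<and> i \<in> B s")
      case True
      have "(\<Sum>m\<in>B s'. ?y (t, s') a (n, m) * ?r s' m i) = (\<Sum>m\<in>B s. ?y (t, s) a (n, m) * v m) * cnj (v i)" for n
        unfolding sum_distrib_right using True by (intro sum.cong) (auto simp: rank_one_def)
      then show ?thesis by (simp only: ker mult_zero_left if_cancel sum.neutral_const)
    next
      case False
      then show ?thesis by (intro sum.neutral) (auto simp: rank_one_def)
    qed
    finally show ?thesis .
  qed
  then have "fmult (B \<otimes>\<^sub>B B) ?y (fone B \<otimes>\<^sub>F ?r) = 0" by (intro ext) (simp only: zero_fun_apply)
  moreover have "[(x, ?r)] \<in> lists (cfin B \<times> cfin B)" using x(2) rank_one_cfin by simp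
  ultimately have "x \<otimes>\<^sub>F ?r = 0"
    using T1_inj[of "[(x, ?r)]"] by (simp only: list.map sum_list.Nil sum_list.Cons add_0_right case_prod_conv)
  then show "x = 0" by (intro tens_rank_one_zero(2)[OF fdB v]) (simp only: zero_fun_apply)
qed

end

section \<open>The Haar state of a finite quantum group\<close>

lemma npf_diff:
  assumes \<tau>: "npf B \<tau>" and \<sigma>: "npf B \<sigma>" and le: "\<And>x. x \<in> linf_pos B \<Longrightarrow> \<sigma> x \<le> \<tau> x"
  shows "npf B (\<lambda>x. \<tau> x - \<sigma> x)"
proof -
  have "linear_fun B (\<lambda>x. \<tau> x - \<sigma> x)"
    using npf_linear[OF \<tau>] npf_linear[OF \<sigma>] unfolding linear_fun_def by (auto simp: algebra_simps)
  moreover have "((\<lambda>s. \<tau> (cut s a) - \<sigma> (cut s a)) has_sum \<tau> a - \<sigma> a) UNIV" if "a \<in> linf_pos B" for a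
    using has_sum_add[OF npf_has_sum[OF \<tau> that] has_sum_uminusI[OF npf_has_sum[OF \<sigma> that]]] by simp
  ultimately show ?thesis using le by (simp add: npf_def)
qed

text \<open>
  Doeblin's argument. If every state is moved by one step to a convex combination with the
  common part \<open>\<delta> e\<close>, then differences shrink by the factor \<open>1 - \<delta>\<close> per step.
\<close>

lemma contraction_bound:
  fixes \<Phi> :: "nat \<Rightarrow> 'a \<Rightarrow> complex" and \<delta> :: real
  assumes \<delta>: "0 \<le> \<delta>" "\<delta> \<le> 1"
    and step: "\<And>\<tau>. \<tau> \<in> S \<Longrightarrow> \<exists>\<tau>'\<in>S. \<forall>n. \<Phi> (Suc n) \<tau> = of_real \<delta> * e n + of_real (1 - \<delta>) * \<Phi> n \<tau>'"
    and bd: "\<And>\<tau>. \<tau> \<in> S \<Longrightarrow> cmod (\<Phi> 0 \<tau>) \<le> K"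
    and "\<tau> \<in> S" "\<sigma> \<in> S"
  shows "cmod (\<Phi> n \<tau> - \<Phi> n \<sigma>) \<le> (1 - \<delta>) ^ n * (2 * K)"
  using assms(5,6)
proof (induction n arbitrary: \<tau> \<sigma>)
  case 0
  show ?case using norm_triangle_ineq4[of "\<Phi> 0 \<tau>" "\<Phi> 0 \<sigma>"] bd[OF 0(1)] bd[OF 0(2)] by simp
next
  case (Suc n)
  obtain \<tau>' \<sigma>' where t: "\<tau>' \<in> S" "\<sigma>' \<in> S"
    and e: "\<Phi> (Suc n) \<tau> = of_real \<delta> * e n + of_real (1 - \<delta>) * \<Phi> n \<tau>'"
      "\<Phi> (Suc n) \<sigma> = of_real \<delta> * e n + of_real (1 - \<delta>) * \<Phi> n \<sigma>'"
    using step[OF Suc.prems(1)] step[OF Suc.prems(2)] by blast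
  have "\<Phi> (Suc n) \<tau> - \<Phi> (Suc n) \<sigma> = of_real (1 - \<delta>) * (\<Phi> n \<tau>' - \<Phi> n \<sigma>')"
    unfolding e by (simp add: algebra_simps)
  also have "cmod \<dots> \<le> (1 - \<delta>) * ((1 - \<delta>) ^ n * (2 * K))"
    unfolding norm_mult norm_of_real using \<delta> Suc.IH[OF t] by (intro mult_mono) auto
  finally show ?case by simp
qed

lemma convergent_geometric:
  fixes a :: "nat \<Rightarrow> complex"
  assumes r: "0 \<le> r" "r < 1" and le: "\<And>n. cmod (a (Suc n) - a n) \<le> r ^ n * K"
  shows "convergent a"
proof -
  have "summable (\<lambda>n. r ^ n * K)" using r by (intro summable_mult2 summable_geometric) simp
  then have "summable (\<lambda>n. a (Suc n) - a n)"
    by (rule summable_comparison_test[rotated]) (use le in auto)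
  then have "(\<lambda>n. \<Sum>k<n. a (Suc k) - a k) \<longlonglongrightarrow> (\<Sum>n. a (Suc n) - a n)" by (rule summable_LIMSEQ)
  then have "(\<lambda>n. a n - a 0) \<longlonglongrightarrow> (\<Sum>n. a (Suc n) - a n)" by (simp add: sum_lessThan_telescope)
  then have "(\<lambda>n. (a n - a 0) + a 0) \<longlonglongrightarrow> (\<Sum>n. a (Suc n) - a n) + a 0" by (intro tendsto_intros)
  then show ?thesis by (auto simp: convergent_def)
qed

definition states :: "('i \<Rightarrow> 'b set) \<Rightarrow> (('i, 'b) fam \<Rightarrow> complex) set" where
  "states B = {\<tau>. npf B \<tau> \<and> \<tau> (fone B) = 1}"

lemma states_npf: "\<tau> \<in> states B \<Longrightarrow> npf B \<tau>"
  by (simp add: states_def)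

lemma states_one: "\<tau> \<in> states B \<Longrightarrow> \<tau> (fone B) = 1"
  by (simp add: states_def)

lemma state_bound:
  assumes fd: "fd B" and x: "x \<in> linf_pos B"
  obtains K where "\<And>\<tau>. \<tau> \<in> states B \<Longrightarrow> cmod (\<tau> x) \<le> K"
proof -
  have xl: "x \<in> linf B" and xp: "fpos B x" using x by (auto simp: linf_pos_iff)
  obtain c where c: "c \<ge> 0" "\<And>s v. cmod (sesq B s v v x) \<le> c * sqnorm B s v"
    using linf_obtain[OF xl] by metis
  have "sesq B s v v x \<le> sesq B s v v (fscale (of_real c) (fone B))" for s v
    using c(2)[of s v] fposD[OF xp, of s v]
    by (simp add: sesq_scale sesq_fone_self fd less_eq_complex_def cmod_eq_Re)
  then have le: "fle B x (fscale (of_real c) (fone B))"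
    by (simp add: fle_iff linf_funs[OF xl] funs_scale)
  have "cmod (\<tau> x) \<le> c" if "\<tau> \<in> states B" for \<tau>
  proof -
    note \<tau> = states_npf[OF that] and 1 = states_one[OF that]
    have "\<tau> x \<le> \<tau> (fscale (of_real c) (fone B))"
      by (rule npf_mono[OF \<tau> xl linf_scale[OF fone_linf[OF fd]] le])
    also have "\<dots> = of_real c"
      using linear_fun_scale[OF npf_linear[OF \<tau>] fone_linf[OF fd]] 1 by (simp only: mult_1_right)
    finally show ?thesis using npf_pos[OF \<tau> x] by (simp add: less_eq_complex_def cmod_eq_Re)
  qed
  then show thesis using that by blast
qed

text \<open>
  A state above \<open>\<delta> \<theta>\<close> is a convex combination of \<open>\<theta>\<close> and a state.
\<close>

lemma minorized_state_split:
  assumes \<theta>: "\<theta> \<in> states B" and \<sigma>: "\<sigma> \<in> states B" and \<delta>: "0 < \<delta>" "\<delta> < 1"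
    and le: "\<And>x. x \<in> linf_pos B \<Longrightarrow> of_real \<delta> * \<theta> x \<le> \<sigma> x"
  shows "\<exists>\<tau>\<in>states B. \<forall>y. \<sigma> y = of_real \<delta> * \<theta> y + of_real (1 - \<delta>) * \<tau> y"
proof -
  let ?t = "\<lambda>y. of_real (1 / (1 - \<delta>)) * (\<sigma> y - of_real \<delta> * \<theta> y)"
  have "npf B ?t"
    using \<delta> le by (intro npf_scale npf_diff states_npf[OF \<theta>] states_npf[OF \<sigma>]) auto
  moreover have "?t (fone B) = 1"
  proof -
    have "\<sigma> (fone B) - of_real \<delta> * \<theta> (fone B) = of_real (1 - \<delta>)"
      by (simp add: states_one[OF \<theta>] states_one[OF \<sigma>])
    then have "?t (fone B) = of_real (1 / (1 - \<delta>) * (1 - \<delta>))" by (simp only: of_real_mult)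
    then show ?thesis using \<delta> by simp
  qed
  moreover have "\<sigma> y = of_real \<delta> * \<theta> y + of_real (1 - \<delta>) * ?t y" for y
  proof -
    have "of_real (1 - \<delta>) * ?t y = of_real ((1 - \<delta>) * (1 / (1 - \<delta>))) * (\<sigma> y - of_real \<delta> * \<theta> y)"
      by (simp only: of_real_mult mult.assoc)
    also have "(1 - \<delta>) * (1 / (1 - \<delta>)) = 1" using \<delta> by simp
    finally show ?thesis by simp
  qed
  ultimately show ?thesis by (intro bexI[of _ ?t]) (auto simp: states_def)
qed

lemma sesq_cong: "(\<And>i. i \<in> B s \<Longrightarrow> w i = w' i) \<Longrightarrow> sesq B s w w x = sesq B s w' w' x"
  by (simp add: sesq_def)

context discrete_quantum_group
begin

lemma conv_pow_commute:
  assumes \<theta>: "npf B \<theta>" and x: "x \<in> linf B"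
  shows "conv_pow_Suc \<Delta> \<theta> (Suc n) x = conv \<Delta> \<theta> (conv_pow_Suc \<Delta> \<theta> n) x"
  using x
proof (induction n arbitrary: x)
  case (Suc n)
  note nth = nfun.npf[OF \<theta>]
  have "conv_pow_Suc \<Delta> \<theta> (Suc (Suc n)) x = conv \<Delta> (conv_pow_Suc \<Delta> \<theta> (Suc n)) \<theta> x" by simp
  also have "\<dots> = conv \<Delta> (conv \<Delta> \<theta> (conv_pow_Suc \<Delta> \<theta> n)) \<theta> x"
    by (rule conv_cong_left[OF nth Suc.prems Suc.IH])
  also have "\<dots> = conv \<Delta> \<theta> (conv \<Delta> (conv_pow_Suc \<Delta> \<theta> n) \<theta>) x" by (rule conv_assoc[OF nth Suc.prems])
  finally show ?case by simp
qed simp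

lemma conv_states: "\<tau> \<in> states B \<Longrightarrow> \<sigma> \<in> states B \<Longrightarrow> conv \<Delta> \<tau> \<sigma> \<in> states B"
  by (simp add: states_def npf_conv conv_one npf_linear)

end

context finite_quantum_group
begin

lemma sum_cuts:
  fixes x :: "('i, 'b) fam"
  shows "(\<Sum>s\<in>UNIV. cut s x) = x"
proof (intro ext)
  fix t i j
  have "(\<Sum>s\<in>UNIV. cut s x) t i j = (\<Sum>s\<in>UNIV. if s = t then x t i j else 0)"
    unfolding fam_sum_apply by (intro sum.cong refl) (auto simp: cut_def)
  also have "\<dots> = x t i j" by (subst sum.delta[OF finite_index]) simp
  finally show "(\<Sum>s\<in>UNIV. cut s x) t i j = x t i j" .
qed

lemma linear_fun_sum_cuts:
  assumes \<tau>: "linear_fun B \<tau>" and x: "x \<in> linf B"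
  shows "\<tau> x = (\<Sum>s\<in>UNIV. \<tau> (cut s x))"
proof -
  have "\<tau> x = \<tau> (\<Sum>s\<in>UNIV. cut s x)" unfolding sum_cuts ..
  also have "\<dots> = (\<Sum>s\<in>UNIV. \<tau> (cut s x))"
    by (rule linear_fun_sum[OF \<tau> cut_linf[OF fdB linf_funs[OF x]]])
  finally show ?thesis .
qed

lemma npf_finite:
  assumes \<tau>: "linear_fun B \<tau>" and pos: "\<And>x. x \<in> linf_pos B \<Longrightarrow> 0 \<le> \<tau> x"
  shows "npf B \<tau>"
  unfolding npf_def using \<tau> pos
  by (auto intro!: has_sum_finiteI[OF finite_index] linear_fun_sum_cuts linf_posD)

definition total_dim :: nat where "total_dim = (\<Sum>s\<in>UNIV. card (B s))"

text \<open>
  The normalized trace, written as a combination of vector functionals so that normality and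
  positivity are visible.
\<close>

definition trace_state :: "('i, 'b) fam \<Rightarrow> complex" where
  "trace_state x = of_real (1 / real total_dim) *
     (\<Sum>s\<in>UNIV. \<Sum>i\<in>B s. sesq B s (basis_vec i) (basis_vec i) x)"

lemma total_dim_ge_1: "1 \<le> total_dim"
proof -
  fix s :: 'i
  have "0 < card (B s)" using finite_dim nonzero_dim by (simp add: card_gt_0_iff)
  also have "card (B s) \<le> total_dim"
    unfolding total_dim_def by (rule member_le_sum) (auto simp: finite_index)
  finally show ?thesis by simp
qed

lemma npf_trace: "npf B trace_state"
  unfolding trace_state_def[abs_def] by (intro npf_scale npf_sum npf_sesq fdB) simp

lemma trace_one: "trace_state (fone B) = 1"
proof -
  have "(\<Sum>s\<in>UNIV. \<Sum>i\<in>B s. sesq B s (basis_vec i) (basis_vec i) (fone B)) = (\<Sum>s\<in>UNIV. \<Sum>i\<in>B s. 1)"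
    by (intro sum.cong refl) (simp add: sesq_basis fdB, simp add: fone_def)
  also have "\<dots> = of_nat total_dim" by (simp add: total_dim_def)
  finally show ?thesis using total_dim_ge_1 by (simp add: trace_state_def)
qed

lemma trace_rank_one: "trace_state (rank_one B s v) = of_real (sqnorm B s v / real total_dim)"
proof -
  have "(\<Sum>t\<in>UNIV. \<Sum>i\<in>B t. sesq B t (basis_vec i) (basis_vec i) (rank_one B s v))
      = (\<Sum>t\<in>UNIV. if t = s then of_real (sqnorm B s v) else 0)"
  proof (intro sum.cong refl)
    fix t
    show "(\<Sum>i\<in>B t. sesq B t (basis_vec i) (basis_vec i) (rank_one B s v)) = (if t = s then of_real (sqnorm B s v) else 0)"
    proof (cases "t = s")
      case True
      have "(\<Sum>i\<in>B s. sesq B s (basis_vec i) (basis_vec i) (rank_one B s v)) = (\<Sum>i\<in>B s. of_real ((cmod (v i))\<^sup>2))"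
        by (intro sum.cong refl) (simp add: sesq_basis fdB rank_one_def complex_norm_square del: of_real_power)
      with True show ?thesis by (simp add: sqnorm_def)
    next
      case False
      then show ?thesis by (simp add: sesq_rank_one)
    qed
  qed
  also have "\<dots> = of_real (sqnorm B s v)" by (subst sum.delta[OF finite_index]) simp
  finally show ?thesis by (simp add: trace_state_def)
qed

lemma trace_faithful:
  assumes x: "x \<in> linf_pos B" and z: "trace_state x = 0"
  shows "x = 0"
proof -
  have xp: "fpos B x" and xf: "x \<in> funs B" using x by (auto simp: linf_pos_iff fpos_iff)
  have "(\<Sum>s\<in>UNIV. \<Sum>i\<in>B s. sesq B s (basis_vec i) (basis_vec i) x) = 0"
    using z total_dim_ge_1 by (simp add: trace_state_def)
  then have "\<forall>s\<in>UNIV. (\<Sum>i\<in>B s. sesq B s (basis_vec i) (basis_vec i) x) = 0"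
    by (subst (asm) sum_nonneg_eq_0_iff[OF finite_index]) (auto intro!: sum_nonneg fposD[OF xp])
  then have d: "sesq B s (basis_vec i) (basis_vec i) x = 0" if "i \<in> B s" for s i
    using that by (subst (asm) sum_nonneg_eq_0_iff[OF finite_dim]) (auto intro!: fposD[OF xp])
  have "x s i j = 0" for s i j
  proof (cases "i \<in> B s \<and> j \<in> B s")
    case True
    then show ?thesis
      using fpos_kernel[OF xp d[of j s], of "basis_vec i"] by (simp add: sesq_basis fdB)
  next
    case False
    then show ?thesis using funs_zero[OF xf] by blast
  qed
  then show ?thesis by (intro ext) (simp only: zero_fun_apply)
qed

text \<open>
  If \<open>T\<close> sends no nonzero rank one matrix to a singular one, then \<open>T(x) \<ge> \<delta> \<theta>(x) 1\<close> for the normalized trace \<open>\<theta>\<close>: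
  the quadratic form of \<open>T(v v\<^sup>*)\<close> at \<open>w\<close> is continuous and positive on a compact product of
  unit spheres.
\<close>

lemma strictly_positive_map_bound:
  assumes T: "pnm B B T"
    and nd: "\<And>s j v w. sqnorm B s v \<noteq> 0 \<Longrightarrow> sqnorm B j w \<noteq> 0 \<Longrightarrow> sesq B j w w (T (rank_one B s v)) \<noteq> 0"
  shows "\<exists>\<delta>>0. \<forall>\<tau> x. npf B \<tau> \<longrightarrow> x \<in> linf_pos B \<longrightarrow>
    of_real \<delta> * \<tau> (fone B) * trace_state x \<le> \<tau> (T x)"
proof -
  note lin = npf_linear[OF pnm_npf[OF T]]
  have block: "\<exists>\<delta>>0. \<forall>w\<in>unit_sphere B j. \<forall>v\<in>unit_sphere B s. \<delta> \<le> Re (sesq B j w w (T (rank_one B s v)))" for j s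
  proof (cases "unit_sphere B j \<times> unit_sphere B s = {}")
    case True
    then show ?thesis by (intro exI[of _ 1]) auto
  next
    case False
    let ?F = "\<lambda>p. Re (sesq B j (fst p) (fst p) (T (rank_one B s (snd p))))"
    have c: "continuous_on (unit_sphere B j \<times> unit_sphere B s) ?F"
      unfolding sesq_def linear_fun_rank_one[OF fdB nfun_linear[OF pnm_nfun_entry[OF fdB T]]]
      by (intro continuous_intros)
    have "compact (unit_sphere B j \<times> unit_sphere B s)"
      by (intro compact_Times compact_unit_sphere fdB)
    from continuous_attains_inf[OF this False c] obtain p where
      p: "p \<in> unit_sphere B j \<times> unit_sphere B s" "\<And>q. q \<in> unit_sphere B j \<times> unit_sphere B s \<Longrightarrow> ?F p \<le> ?F q"
      by blast
    have "sesq B j (fst p) (fst p) (T (rank_one B s (snd p))) \<noteq> 0"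
      using p(1) by (intro nd) (auto simp: unit_sphere_def)
    moreover have "0 \<le> sesq B j (fst p) (fst p) (T (rank_one B s (snd p)))"
      by (rule npf_pos[OF pnm_npf[OF T] rank_one_linf_pos[OF fdB]])
    ultimately have "0 < ?F p" by (auto simp: less_eq_complex_def complex_eq_iff)
    then show ?thesis using p(2) by (intro exI[of _ "?F p"]) force
  qed
  then obtain d where d: "\<And>j s. d j s > 0"
    "\<And>j s w v. w \<in> unit_sphere B j \<Longrightarrow> v \<in> unit_sphere B s \<Longrightarrow> d j s \<le> Re (sesq B j w w (T (rank_one B s v)))"
    by metis
  define \<delta> where "\<delta> = Min (range (\<lambda>p. d (fst p) (snd p)))"
  have fr: "finite (range (\<lambda>p. d (fst p) (snd p)))"
    by (intro finite_imageI) (simp add: finite_index finite_prod)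
  have \<delta>: "\<delta> > 0" "\<And>j s. \<delta> \<le> d j s"
    unfolding \<delta>_def using fr d(1) by (auto intro!: Min_le image_eqI[of _ _ "(j, s)" for j s])
  have unit: "of_real \<delta> * trace_state x \<le> sesq B j u u (T x)" if u: "u \<in> unit_sphere B j" and x: "x \<in> linf_pos B" for u j x
  proof -
    have xp: "fpos B x" and xl: "x \<in> linf B" using x by (auto simp: linf_pos_iff)
    let ?\<sigma> = "\<lambda>x. of_real \<delta> * trace_state x" and ?\<tau> = "\<lambda>x. sesq B j u u (T x)"
    have \<sigma>: "npf B ?\<sigma>" using \<delta>(1) by (intro npf_scale npf_trace) simp
    have "?\<sigma> (rank_one B s v) \<le> ?\<tau> (rank_one B s v)" for s v
    proof (rule rank_one_le_from_sphere[OF fdB npf_linear[OF \<sigma>] lin])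
      fix v assume v: "v \<in> unit_sphere B s"
      have "\<delta> / real total_dim \<le> \<delta>" using \<delta>(1) total_dim_ge_1 by (simp add: divide_le_eq)
      also have "\<dots> \<le> Re (?\<tau> (rank_one B s v))" using \<delta>(2)[of j s] d(2)[OF u v] by linarith
      finally have "\<delta> / real total_dim \<le> Re (?\<tau> (rank_one B s v))" .
      moreover have "?\<sigma> (rank_one B s v) = of_real (\<delta> / real total_dim)"
        using v by (simp add: trace_rank_one unit_sphere_def)
      ultimately show "?\<sigma> (rank_one B s v) \<le> ?\<tau> (rank_one B s v)"
        using npf_pos[OF pnm_npf[OF T] rank_one_linf_pos[OF fdB, of s v], of j u] by (simp add: less_eq_complex_def)
    qed
    then have "?\<sigma> (cut s x) \<le> ?\<tau> (cut s x)" for s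
      by (rule cut_le_from_rank_one[OF fdB npf_linear[OF \<sigma>] lin xp])
    then have "(\<Sum>s\<in>UNIV. ?\<sigma> (cut s x)) \<le> (\<Sum>s\<in>UNIV. ?\<tau> (cut s x))" by (rule sum_mono)
    then show ?thesis
      unfolding linear_fun_sum_cuts[OF npf_linear[OF \<sigma>] xl, symmetric] linear_fun_sum_cuts[OF lin xl, symmetric] .
  qed
  have "of_real \<delta> * \<tau> (fone B) * trace_state x \<le> \<tau> (T x)" if \<tau>: "npf B \<tau>" and x: "x \<in> linf_pos B" for \<tau> x
  proof -
    let ?y = "fscale (of_real \<delta> * trace_state x) (fone B)"
    have Tx: "T x \<in> linf_pos B" by (rule pnm_linf_pos[OF T x])
    have yl: "?y \<in> linf B" by (rule linf_scale[OF fone_linf[OF fdB]])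
    have "sesq B j w w ?y \<le> sesq B j w w (T x)" for j w
    proof (cases "sqnorm B j w = 0")
      case True
      then show ?thesis
        using Tx by (simp add: sesq_scale sesq_fone_self fdB linf_pos_iff fposD)
    next
      case False
      obtain u where u: "u \<in> unit_sphere B j" "\<And>i. i \<in> B j \<Longrightarrow> w i = of_real (sqrt (sqnorm B j w)) * u i"
        using unit_vector[OF fdB False] by blast
      have "sesq B j w w (T x) = sesq B j (\<lambda>i. of_real (sqrt (sqnorm B j w)) * u i) (\<lambda>i. of_real (sqrt (sqnorm B j w)) * u i) (T x)"
        by (rule sesq_cong[OF u(2)])
      also have "\<dots> = of_real (sqnorm B j w) * sesq B j u u (T x)"
        by (simp add: sesq_scale_left sesq_scale_right mult.assoc[symmetric] flip: of_real_mult)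
      finally have e: "sesq B j w w (T x) = of_real (sqnorm B j w) * sesq B j u u (T x)" .
      have "of_real (sqnorm B j w) * (of_real \<delta> * trace_state x) \<le> of_real (sqnorm B j w) * sesq B j u u (T x)"
        using unit[OF u(1) x] by (intro mult_left_mono) (auto simp: less_eq_complex_def)
      then show ?thesis unfolding e by (simp add: sesq_scale sesq_fone_self fdB mult_ac)
    qed
    then have "fle B ?y (T x)"
      unfolding fle_iff[OF linf_funs[OF yl] linf_funs[OF linf_posD[OF Tx]]] by blast
    then have "\<tau> ?y \<le> \<tau> (T x)" by (rule npf_mono[OF \<tau> yl linf_posD[OF Tx]])
    then show ?thesis
      unfolding linear_fun_scale[OF npf_linear[OF \<tau>] fone_linf[OF fdB]] by (simp only: mult_ac)
  qed
  then show ?thesis using \<delta>(1) by blast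
qed

lemma rank_one_nonzero: "sqnorm B s v \<noteq> 0 \<Longrightarrow> rank_one B s v \<noteq> 0"
  by (auto simp: rank_one_def sqnorm_eq_0_iff[OF fdB] fun_eq_iff)

text \<open>
  If the quadratic form of \<open>(\<iota> \<otimes> \<theta>)\<Delta>(v v\<^sup>*)\<close> at \<open>w\<close> were zero, then the slice of \<open>\<Delta>(v v\<^sup>*)\<close> by the
  vector functional of \<open>w\<close> in the first leg would be zero, because the trace is faithful. Nondegeneracy excludes this,
  and likewise for the other leg.
\<close>

lemma convolution_minorization:
  "\<exists>\<delta>>0. \<delta> < 1 \<and> (\<forall>\<tau> x. npf B \<tau> \<longrightarrow> x \<in> linf_pos B \<longrightarrow>
     of_real \<delta> * \<tau> (fone B) * trace_state x \<le> conv \<Delta> \<tau> trace_state x \<and>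
     of_real \<delta> * \<tau> (fone B) * trace_state x \<le> conv \<Delta> trace_state \<tau> x)"
proof -
  note ntr = nfun.npf[OF npf_trace]
  have rp: "fpos B (rank_one B s v)" for s v using rank_one_linf_pos[OF fdB] by (auto simp: linf_pos_iff)
  have nfq: "nfun B (sesq B j w w)" for j w by (rule nfun.npf[OF npf_sesq[OF fdB]])
  have 1: "sesq B j w w (rconv_op \<Delta> trace_state (rank_one B s v)) \<noteq> 0"
    if v: "sqnorm B s v \<noteq> 0" and w: "sqnorm B j w \<noteq> 0" for s j v w
  proof
    assume "sesq B j w w (rconv_op \<Delta> trace_state (rank_one B s v)) = 0"
    then have "trace_state (conv_op \<Delta> (sesq B j w w) (rank_one B s v)) = 0"
      unfolding conv_eq_rconv_op[symmetric] conv_eq_conv_op[OF nfq ntr rank_one_linf[OF fdB]] .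
    then have "conv_op \<Delta> (sesq B j w w) (rank_one B s v) = 0"
      by (rule trace_faithful[OF pnm_linf_pos[OF pnm_conv_op[OF npf_sesq[OF fdB]] rank_one_linf_pos[OF fdB]]])
    then have "rank_one B s v = 0" by (rule conv_op_vector_zeroD[OF rp rank_one_cfin w])
    then show False using rank_one_nonzero[OF v] by blast
  qed
  have 2: "sesq B j w w (conv_op \<Delta> trace_state (rank_one B s v)) \<noteq> 0"
    if v: "sqnorm B s v \<noteq> 0" and w: "sqnorm B j w \<noteq> 0" for s j v w
  proof
    assume "sesq B j w w (conv_op \<Delta> trace_state (rank_one B s v)) = 0"
    then have "trace_state (rconv_op \<Delta> (sesq B j w w) (rank_one B s v)) = 0"
      unfolding conv_eq_conv_op[OF ntr nfq rank_one_linf[OF fdB], symmetric] conv_eq_rconv_op .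
    then have "rconv_op \<Delta> (sesq B j w w) (rank_one B s v) = 0"
      by (rule trace_faithful[OF pnm_linf_pos[OF pnm_rconv_op[OF npf_sesq[OF fdB]] rank_one_linf_pos[OF fdB]]])
    then have "rank_one B s v = 0" by (rule rconv_op_vector_zeroD[OF rp rank_one_cfin w])
    then show False using rank_one_nonzero[OF v] by blast
  qed
  obtain \<delta>1 where d1: "\<delta>1 > 0" "\<And>\<tau> x. npf B \<tau> \<Longrightarrow> x \<in> linf_pos B \<Longrightarrow>
      of_real \<delta>1 * \<tau> (fone B) * trace_state x \<le> conv \<Delta> \<tau> trace_state x"
    using strictly_positive_map_bound[OF pnm_rconv_op[OF npf_trace] 1] unfolding conv_eq_rconv_op by blast
  obtain \<delta>2 where d2: "\<delta>2 > 0" "\<And>\<tau> x. npf B \<tau> \<Longrightarrow> x \<in> linf_pos B \<Longrightarrow>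
      of_real \<delta>2 * \<tau> (fone B) * trace_state x \<le> \<tau> (conv_op \<Delta> trace_state x)"
    using strictly_positive_map_bound[OF pnm_conv_op[OF npf_trace] 2] by blast
  define \<delta> where "\<delta> = min (1/2) (min \<delta>1 \<delta>2)"
  have mono: "of_real \<delta> * \<tau> (fone B) * trace_state x \<le> of_real d * \<tau> (fone B) * trace_state x"
    if "npf B \<tau>" "x \<in> linf_pos B" "\<delta> \<le> d" for \<tau> x d
  proof -
    have "0 \<le> \<tau> (fone B) * trace_state x"
      by (intro mult_nonneg_nonneg npf_pos[OF that(1) fone_linf_pos[OF fdB]] npf_pos[OF npf_trace that(2)])
    then show ?thesis
      using that(3) mult_right_mono[of "of_real \<delta> :: complex" "of_real d" "\<tau> (fone B) * trace_state x"]
      by (simp add: mult.assoc less_eq_complex_def)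
  qed
  have "of_real \<delta> * \<tau> (fone B) * trace_state x \<le> conv \<Delta> \<tau> trace_state x \<and>
     of_real \<delta> * \<tau> (fone B) * trace_state x \<le> conv \<Delta> trace_state \<tau> x" if \<tau>: "npf B \<tau>" and x: "x \<in> linf_pos B" for \<tau> x
    using order_trans[OF mono[OF \<tau> x] d1(2)[OF \<tau> x]] order_trans[OF mono[OF \<tau> x] d2(2)[OF \<tau> x]]
      conv_eq_conv_op[OF ntr nfun.npf[OF \<tau>] linf_posD[OF x]]
    by (simp add: \<delta>_def)
  then show ?thesis using d1(1) d2(1) by (intro exI[of _ \<delta>]) (auto simp: \<delta>_def)
qed

text \<open>
  Right convolution \<open>\<tau> \<mapsto> \<tau> \<star> \<theta>\<^sup>n\<close> brings all states together at a geometric rate, so the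
  powers \<open>\<theta>\<^sup>n\<close> of the trace converge to a state \<open>h\<close> with \<open>\<tau> \<star> h = h\<close>. As \<open>h \<star> \<theta> = h\<close>, the states
  \<open>h \<star> \<tau>\<close> and \<open>h \<star> \<theta> \<star> \<tau>\<close> agree; the minorization of \<open>\<theta> \<star> \<tau>\<close> makes \<open>h \<star> \<tau>\<close> independent of \<open>\<tau>\<close>.
  Finally \<open>h = h \<star> \<theta>\<close> lies above a multiple of the trace, so \<open>h\<close> is faithful.
\<close>

lemma haar_state:
  "\<exists>h c. npf B h \<and> h (fone B) = 1 \<and> c > 0 \<and>
     (\<forall>x\<in>linf B. conv_op \<Delta> h x = fscale (h x) (fone B) \<and> rconv_op \<Delta> h x = fscale (h x) (fone B)) \<and>
     (\<forall>x\<in>linf_pos B. of_real c * trace_state x \<le> h x)"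
proof -
  define \<theta> where "\<theta> = trace_state"
  define P where "P n = conv_pow_Suc \<Delta> \<theta> n" for n
  have \<theta>: "\<theta> \<in> states B" by (simp add: states_def \<theta>_def npf_trace trace_one)
  note npf\<theta> = states_npf[OF \<theta>] and \<theta>1 = states_one[OF \<theta>]
  have P: "npf B (P n)" for n unfolding P_def by (rule npf_conv_pow[OF npf\<theta>])
  note n\<theta> = nfun.npf[OF npf\<theta>] and nP = nfun.npf[OF P]
  have P1: "P n (fone B) = 1" for n unfolding P_def by (rule conv_pow_one[OF npf\<theta> \<theta>1])
  have PS: "P (Suc n) x = conv \<Delta> (P n) \<theta> x" for n x by (simp add: P_def)
  have PS': "P (Suc n) x = conv \<Delta> \<theta> (P n) x" if "x \<in> linf B" for n x
    unfolding P_def by (rule conv_pow_commute[OF npf\<theta> that])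
  obtain \<delta> where \<delta>: "\<delta> > 0" "\<delta> < 1"
    and min: "\<And>\<tau> x. npf B \<tau> \<Longrightarrow> x \<in> linf_pos B \<Longrightarrow>
      of_real \<delta> * \<tau> (fone B) * \<theta> x \<le> conv \<Delta> \<tau> \<theta> x \<and> of_real \<delta> * \<tau> (fone B) * \<theta> x \<le> conv \<Delta> \<theta> \<tau> x"
    using convolution_minorization unfolding \<theta>_def by blast
  have minR: "of_real \<delta> * \<theta> x \<le> conv \<Delta> \<tau> \<theta> x" and minL: "of_real \<delta> * \<theta> x \<le> conv \<Delta> \<theta> \<tau> x"
    if "\<tau> \<in> states B" "x \<in> linf_pos B" for \<tau> x
    using min[OF states_npf[OF that(1)] that(2)] by (simp_all add: states_one[OF that(1)])
  have R_contract: "\<exists>K. \<forall>\<tau>\<in>states B. \<forall>\<sigma>\<in>states B. \<forall>n. cmod (conv \<Delta> \<tau> (P n) x - conv \<Delta> \<sigma> (P n) x) \<le> (1 - \<delta>) ^ n * K"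
    if x: "x \<in> linf_pos B" for x
  proof -
    have xl: "x \<in> linf B" by (rule linf_posD[OF x])
    obtain K where K: "\<And>\<tau>. \<tau> \<in> states B \<Longrightarrow> cmod (\<tau> x) \<le> K" using state_bound[OF fdB x] by blast
    have "cmod (conv \<Delta> \<tau> (P n) x - conv \<Delta> \<sigma> (P n) x) \<le> (1 - \<delta>) ^ n * (2 * K)" if "\<tau> \<in> states B" "\<sigma> \<in> states B" for \<tau> \<sigma> n
    proof (rule contraction_bound[where \<Phi> = "\<lambda>n \<tau>. conv \<Delta> \<tau> (P n) x" and e = "\<lambda>n. conv \<Delta> \<theta> (P n) x", OF _ _ _ _ that])
      fix \<rho> assume \<rho>: "\<rho> \<in> states B"
      obtain \<tau>' where \<tau>': "\<tau>' \<in> states B" "\<And>y. conv \<Delta> \<rho> \<theta> y = of_real \<delta> * \<theta> y + of_real (1 - \<delta>) * \<tau>' y"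
        using minorized_state_split[OF \<theta> conv_states[OF \<rho> \<theta>] \<delta> minR[OF \<rho>]] by blast
      have "conv \<Delta> \<rho> (P (Suc n)) x = of_real \<delta> * conv \<Delta> \<theta> (P n) x + of_real (1 - \<delta>) * conv \<Delta> \<tau>' (P n) x" for n
      proof -
        have "conv \<Delta> \<rho> (P (Suc n)) x = conv \<Delta> \<rho> (conv \<Delta> \<theta> (P n)) x"
          by (rule conv_cong_right[OF xl PS'])
        also have "\<dots> = conv \<Delta> (conv \<Delta> \<rho> \<theta>) (P n) x" by (rule conv_assoc[OF nP xl, symmetric])
        also have "\<dots> = of_real \<delta> * conv \<Delta> \<theta> (P n) x + of_real (1 - \<delta>) * conv \<Delta> \<tau>' (P n) x"
          unfolding conv_eq_rconv_op[of \<Delta> _ "P n"] \<tau>'(2) ..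
        finally show ?thesis .
      qed
      then show "\<exists>\<tau>'\<in>states B. \<forall>n. conv \<Delta> \<rho> (P (Suc n)) x = of_real \<delta> * conv \<Delta> \<theta> (P n) x + of_real (1 - \<delta>) * conv \<Delta> \<tau>' (P n) x"
        using \<tau>'(1) by blast
      have "conv \<Delta> \<rho> (P 0) \<in> states B" by (rule conv_states[OF \<rho>]) (simp add: P_def \<theta>)
      then show "cmod (conv \<Delta> \<rho> (P 0) x) \<le> K" by (rule K)
    qed (use \<delta> in auto)
    then show ?thesis by blast
  qed
  have conv: "convergent (\<lambda>n. P n x)" if "x \<in> linf B" for x
    using fdB that
  proof (induction rule: linf_induct)
    case (pos x)
    have xl: "x \<in> linf B" by (rule linf_posD[OF pos])
    obtain K where K: "\<And>\<tau> \<sigma> n. \<tau> \<in> states B \<Longrightarrow> \<sigma> \<in> states B \<Longrightarrow> cmod (conv \<Delta> \<tau> (P n) x - conv \<Delta> \<sigma> (P n) x) \<le> (1 - \<delta>) ^ n * K"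
      using R_contract[OF pos] by blast
    have "convergent (\<lambda>n. P (Suc n) x)"
    proof (rule convergent_geometric)
      fix n
      have "P (Suc (Suc n)) x = conv \<Delta> (conv \<Delta> \<theta> \<theta>) (P n) x"
      proof -
        have "P (Suc (Suc n)) x = conv \<Delta> \<theta> (P (Suc n)) x" by (rule PS'[OF xl])
        also have "\<dots> = conv \<Delta> \<theta> (conv \<Delta> \<theta> (P n)) x" by (rule conv_cong_right[OF xl PS'])
        also have "\<dots> = conv \<Delta> (conv \<Delta> \<theta> \<theta>) (P n) x" by (rule conv_assoc[OF nP xl, symmetric])
        finally show ?thesis .
      qed
      then show "cmod (P (Suc (Suc n)) x - P (Suc n) x) \<le> (1 - \<delta>) ^ n * K"
        unfolding PS'[OF xl, of n] using K[OF conv_states[OF \<theta> \<theta>] \<theta>, of n] by (simp only:)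
    qed (use \<delta> in auto)
    then show ?case by (subst (asm) convergent_Suc_iff)
  next
    case (add a b)
    then show ?case unfolding linear_fun_add[OF npf_linear[OF P] add(1,2)] by (intro convergent_add)
  next
    case (scale c a)
    then show ?case unfolding linear_fun_scale[OF npf_linear[OF P] scale(1)]
      by (intro convergent_mult convergent_const)
  qed
  define h where "h x = lim (\<lambda>n. P n x)" for x
  have lim: "(\<lambda>n. P n x) \<longlonglongrightarrow> h x" if "x \<in> linf B" for x
    using conv[OF that] by (simp add: h_def convergent_LIMSEQ_iff)
  have hlin: "linear_fun B h"
    unfolding linear_fun_def
  proof (intro conjI ballI allI)
    fix a b assume ab: "a \<in> linf B" "b \<in> linf B"
    have "(\<lambda>n. P n (a + b)) \<longlonglongrightarrow> h a + h b"
      unfolding linear_fun_add[OF npf_linear[OF P] ab] by (intro tendsto_add lim ab)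
    then show "h (a + b) = h a + h b" by (rule LIMSEQ_unique[OF lim[OF linf_add[OF ab]]])
  next
    fix c a assume a: "a \<in> linf B"
    have "(\<lambda>n. P n (fscale c a)) \<longlonglongrightarrow> c * h a"
      unfolding linear_fun_scale[OF npf_linear[OF P] a] by (intro tendsto_mult tendsto_const lim a)
    then show "h (fscale c a) = c * h a" by (rule LIMSEQ_unique[OF lim[OF linf_scale[OF a]]])
  qed
  have hpos: "0 \<le> h x" if x: "x \<in> linf_pos B" for x
  proof -
    have l: "(\<lambda>n. P n x) \<longlonglongrightarrow> h x" by (rule lim[OF linf_posD[OF x]])
    have p: "0 \<le> Re (P n x)" "Im (P n x) = 0" for n
      using npf_pos[OF P x] by (auto simp: less_eq_complex_def)
    have "0 \<le> Re (h x)" by (rule LIMSEQ_le_const[OF tendsto_Re[OF l]]) (use p(1) in blast)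
    moreover have "(\<lambda>n. 0) \<longlonglongrightarrow> Im (h x)" using tendsto_Im[OF l] unfolding p(2) .
    then have "Im (h x) = 0" by (simp add: LIMSEQ_const_iff)
    ultimately show ?thesis by (simp add: less_eq_complex_def)
  qed
  have h: "npf B h" by (rule npf_finite[OF hlin hpos])
  note nh = nfun.npf[OF h]
  have h1: "h (fone B) = 1"
    using lim[OF fone_linf[OF fdB]] unfolding P1 by (simp add: LIMSEQ_const_iff)
  have geo: "(\<lambda>n. (1 - \<delta>) ^ n * K) \<longlonglongrightarrow> 0" for K
  proof -
    have "(\<lambda>n. (1 - \<delta>) ^ n * K) \<longlonglongrightarrow> 0 * K" using \<delta> by (intro tendsto_mult tendsto_const LIMSEQ_power_zero) auto
    then show ?thesis by simp
  qed
  have invR: "\<tau> (rconv_op \<Delta> h x) = h x" if \<tau>: "\<tau> \<in> states B" and x: "x \<in> linf_pos B" for \<tau> x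
  proof -
    have xl: "x \<in> linf B" by (rule linf_posD[OF x])
    have n\<tau>: "nfun B \<tau>" by (rule nfun.npf[OF states_npf[OF \<tau>]])
    obtain K where K: "\<And>\<tau> \<sigma> n. \<tau> \<in> states B \<Longrightarrow> \<sigma> \<in> states B \<Longrightarrow> cmod (conv \<Delta> \<tau> (P n) x - conv \<Delta> \<sigma> (P n) x) \<le> (1 - \<delta>) ^ n * K"
      using R_contract[OF x] by blast
    have "(\<lambda>n. conv \<Delta> \<tau> (P n) x - P (Suc n) x) \<longlonglongrightarrow> 0"
      by (rule Lim_null_comparison[OF always_eventually geo[of K]])
        (use K[OF \<tau> \<theta>] in \<open>simp only: PS'[OF xl]; blast\<close>)
    then have "(\<lambda>n. (conv \<Delta> \<tau> (P n) x - P (Suc n) x) + P (Suc n) x) \<longlonglongrightarrow> 0 + h x"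
      by (rule tendsto_add) (rule LIMSEQ_Suc[OF lim[OF xl]])
    then have "(\<lambda>n. P n (conv_op \<Delta> \<tau> x)) \<longlonglongrightarrow> h x"
      unfolding conv_eq_conv_op[OF n\<tau> nP xl, symmetric] by simp
    then have "h (conv_op \<Delta> \<tau> x) = h x" by (rule LIMSEQ_unique[OF lim[OF conv_op_linf[OF n\<tau> xl]]])
    then show ?thesis unfolding conv_eq_conv_op[OF n\<tau> nh xl, symmetric] conv_eq_rconv_op .
  qed
  have h\<theta>: "conv \<Delta> h \<theta> x = h x" if x: "x \<in> linf B" for x
  proof -
    have "(\<lambda>n. P (Suc n) x) \<longlonglongrightarrow> conv \<Delta> h \<theta> x"
      unfolding PS conv_eq_rconv_op by (rule lim[OF rconv_op_linf[OF n\<theta> x]])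
    then show ?thesis by (rule LIMSEQ_unique[OF _ LIMSEQ_Suc[OF lim[OF x]]])
  qed
  have invL: "\<tau> (conv_op \<Delta> h x) = h x" if \<tau>: "\<tau> \<in> states B" and x: "x \<in> linf_pos B" for \<tau> x
  proof -
    let ?y = "conv_op \<Delta> h x"
    have xl: "x \<in> linf B" by (rule linf_posD[OF x])
    have y: "?y \<in> linf_pos B" by (rule pnm_linf_pos[OF pnm_conv_op[OF h] x])
    have \<theta>y: "\<theta> ?y = h x" unfolding conv_eq_conv_op[OF nh n\<theta> xl, symmetric] by (rule h\<theta>[OF xl])
    obtain K where K: "\<And>\<tau>. \<tau> \<in> states B \<Longrightarrow> cmod (\<tau> ?y) \<le> K" using state_bound[OF fdB y] by blast
    have "cmod (\<tau> ?y - \<theta> ?y) \<le> (1 - \<delta>) ^ n * (2 * K)" for n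
    proof (rule contraction_bound[where \<Phi> = "\<lambda>_ \<tau>. \<tau> ?y" and e = "\<lambda>_. \<theta> ?y" and S = "states B", OF _ _ _ _ \<tau> \<theta>])
      fix \<rho> assume \<rho>: "\<rho> \<in> states B"
      note n\<rho> = nfun.npf[OF states_npf[OF \<rho>]]
      obtain \<tau>' where \<tau>': "\<tau>' \<in> states B" "\<And>y. conv \<Delta> \<theta> \<rho> y = of_real \<delta> * \<theta> y + of_real (1 - \<delta>) * \<tau>' y"
        using minorized_state_split[OF \<theta> conv_states[OF \<theta> \<rho>] \<delta> minL[OF \<rho>]] by blast
      have "\<rho> ?y = conv \<Delta> (conv \<Delta> h \<theta>) \<rho> x"
        unfolding conv_eq_conv_op[OF nh n\<rho> xl, symmetric] by (rule conv_cong_left[OF n\<rho> xl h\<theta>[symmetric]])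
      also have "\<dots> = conv \<Delta> \<theta> \<rho> ?y"
        unfolding conv_assoc[OF n\<rho> xl] by (rule conv_eq_conv_op[OF nh nfun_conv[OF n\<theta> n\<rho>] xl])
      finally have "\<rho> ?y = of_real \<delta> * \<theta> ?y + of_real (1 - \<delta>) * \<tau>' ?y" by (simp only: \<tau>'(2))
      then show "\<exists>\<tau>'\<in>states B. \<forall>n::nat. \<rho> ?y = of_real \<delta> * \<theta> ?y + of_real (1 - \<delta>) * \<tau>' ?y"
        using \<tau>'(1) by blast
      show "cmod (\<rho> ?y) \<le> K" by (rule K[OF \<rho>])
    qed (use \<delta> in auto)
    then have "cmod (\<tau> ?y - \<theta> ?y) \<le> 0" by (intro LIMSEQ_le_const[OF geo]) blast
    then show ?thesis using \<theta>y by simp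
  qed
  have const: "R x = fscale (h x) (fone B)"
    if R: "pnm B B R" and inv: "\<And>\<tau> x. \<tau> \<in> states B \<Longrightarrow> x \<in> linf_pos B \<Longrightarrow> \<tau> (R x) = h x" and "x \<in> linf B" for R x
    using fdB that(3)
  proof (induction rule: linf_induct)
    case (pos x)
    have xl: "x \<in> linf B" by (rule linf_posD[OF pos])
    show ?case
    proof (rule funs_eqI[OF fdB linf_funs[OF pnm_linf[OF R xl]] funs_scale[OF fone_funs]])
      fix s v
      \<comment> \<open>The functional \<open>y \<mapsto> \<langle>v, y v\<rangle> + \<theta>(y)\<close> can be normalized to a state also for \<open>v = 0\<close>; the
        known value of \<open>\<theta>\<close> is subtracted afterwards.\<close>
      let ?n = "sqnorm B s v"
      let ?\<tau> = "\<lambda>y. of_real (1 / (?n + 1)) * (sesq B s v v y + \<theta> y)"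
      have n: "?n + 1 > 0" using sqnorm_nonneg[of B s v] by linarith
      have "npf B ?\<tau>" using n by (intro npf_scale npf_add npf_sesq fdB npf\<theta>) simp
      moreover have "?\<tau> (fone B) = 1"
      proof -
        have "sesq B s v v (fone B) + \<theta> (fone B) = of_real (?n + 1)"
          by (simp add: sesq_fone_self fdB \<theta>1)
        then have "?\<tau> (fone B) = of_real (1 / (?n + 1) * (?n + 1))" by (simp only: of_real_mult)
        then show ?thesis using n by simp
      qed
      ultimately have "?\<tau> (R x) = h x" by (intro inv pos) (simp add: states_def)
      moreover have "\<theta> (R x) = h x" by (rule inv[OF \<theta> pos])
      ultimately have "of_real (1 / (?n + 1)) * (sesq B s v v (R x) + h x) = h x" by (simp only:)
      then have "of_real (?n + 1) * (of_real (1 / (?n + 1)) * (sesq B s v v (R x) + h x)) = of_real (?n + 1) * h x"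
        by (rule arg_cong)
      moreover have "of_real (?n + 1) * (of_real (1 / (?n + 1)) * (sesq B s v v (R x) + h x)) = sesq B s v v (R x) + h x"
        unfolding mult.assoc[symmetric] of_real_mult[symmetric] using n by simp
      ultimately show "sesq B s v v (R x) = sesq B s v v (fscale (h x) (fone B))"
        by (simp add: sesq_scale sesq_fone_self fdB algebra_simps)
    qed
  next
    case (add a b)
    have "R (a + b) = fscale (h a) (fone B) + fscale (h b) (fone B)"
      unfolding pnm_add[OF fdB R add(1,2)] add(3,4) ..
    also have "\<dots> = fscale (h (a + b)) (fone B)"
      unfolding linear_fun_add[OF hlin add(1,2)] by (intro ext) (simp add: algebra_simps)
    finally show ?case .
  next
    case (scale c a)
    have "R (fscale c a) = fscale c (fscale (h a) (fone B))"
      unfolding pnm_scale[OF fdB R scale(1)] scale(2) ..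
    also have "\<dots> = fscale (h (fscale c a)) (fone B)"
      unfolding linear_fun_scale[OF hlin scale(1)] by (intro ext) simp
    finally show ?case .
  qed
  have cL: "conv_op \<Delta> h x = fscale (h x) (fone B)" if "x \<in> linf B" for x
    by (rule const[OF pnm_conv_op[OF h] _ that]) (rule invL)
  have cR: "rconv_op \<Delta> h x = fscale (h x) (fone B)" if "x \<in> linf B" for x
    by (rule const[OF pnm_rconv_op[OF h] _ that]) (rule invR)
  have "of_real \<delta> * trace_state x \<le> h x" if x: "x \<in> linf_pos B" for x
  proof -
    have xl: "x \<in> linf B" by (rule linf_posD[OF x])
    have "of_real \<delta> * \<theta> x \<le> conv \<Delta> h \<theta> x" using h h1 by (intro minR x) (simp add: states_def)
    also have "\<dots> = h x" by (rule h\<theta>[OF xl])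
    finally show ?thesis by (simp add: \<theta>_def)
  qed
  then show ?thesis using h h1 \<delta>(1) cL cR by blast
qed

end

section \<open>Projections and supports\<close>

lemma fadj_rank_one: "fadj (rank_one B s v) = rank_one B s v"
  by (auto simp: fadj_def rank_one_def fun_eq_iff)

lemma fmult_diff_left: "fmult B (a - b) c = fmult B a c - fmult B b c"
  by (intro ext) (simp add: fmult_def left_diff_distrib sum_subtractf)

lemma fmult_diff_right: "fmult B a (b - c) = fmult B a b - fmult B a c"
  by (intro ext) (simp add: fmult_def right_diff_distrib sum_subtractf)

lemma fmult_scale_left: "fmult B (fscale c a) b = fscale c (fmult B a b)"
  by (intro ext) (simp add: fmult_def sum_distrib_left mult.assoc)

lemma fmult_scale_right: "fmult B a (fscale c b) = fscale c (fmult B a b)"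
  by (intro ext) (simp add: fmult_def sum_distrib_left mult_ac)

lemma fmult_cut_one:
  assumes fd: "fd B" and x: "x \<in> funs B"
  shows "fmult B (cut s (fone B)) x = cut s x"
proof (intro ext)
  fix t i j
  have "fmult B (cut s (fone B)) x t i j = (\<Sum>k\<in>B t. if k = i then (if t = s \<and> i \<in> B t then x t i j else 0) else 0)"
    unfolding fmult_def by (intro sum.cong refl) (auto simp: cut_def fone_def)
  also have "\<dots> = cut s x t i j"
    using funs_zero[OF x, of i t j] by (subst sum.delta[OF fdD[OF fd]]) (auto simp: cut_def)
  finally show "fmult B (cut s (fone B)) x t i j = cut s x t i j" .
qed

lemma fmult_one_left:
  assumes fd: "fd B" and x: "x \<in> funs B"
  shows "fmult B (fone B) x = x"
proof (intro ext)
  fix t i j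
  have "fmult B (fone B) x t i j = (\<Sum>k\<in>B t. if k = i then (if i \<in> B t then x t i j else 0) else 0)"
    unfolding fmult_def by (intro sum.cong refl) (auto simp: fone_def)
  also have "\<dots> = x t i j"
    using funs_zero[OF x, of i t j] by (subst sum.delta[OF fdD[OF fd]]) auto
  finally show "fmult B (fone B) x t i j = x t i j" .
qed

lemma fmult_one_right:
  assumes fd: "fd B" and x: "x \<in> funs B"
  shows "fmult B x (fone B) = x"
proof (intro ext)
  fix t i j
  have "fmult B x (fone B) t i j = (\<Sum>k\<in>B t. if k = j then (if j \<in> B t then x t i j else 0) else 0)"
    unfolding fmult_def by (intro sum.cong refl) (auto simp: fone_def)
  also have "\<dots> = x t i j"
    using funs_zero[OF x, of i t j] by (subst sum.delta[OF fdD[OF fd]]) auto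
  finally show "fmult B x (fone B) t i j = x t i j" .
qed

lemma fmult_mat_unit_right:
  assumes "fd B" "l \<in> B s"
  shows "fmult B z (mat_unit s l j) t m b = (if t = s \<and> b = j then z s m l else 0)"
proof -
  have "fmult B z (mat_unit s l j) t m b = (\<Sum>n\<in>B t. if n = l then (if t = s \<and> b = j then z s m l else 0) else 0)"
    unfolding fmult_def by (intro sum.cong refl) (auto simp: mat_unit_def)
  also have "\<dots> = (if t = s \<and> b = j then z s m l else 0)"
    using assms(2) by (subst sum.delta[OF fdD[OF assms(1)]]) auto
  finally show ?thesis .
qed

lemma fmult_mat_units:
  assumes fd: "fd B" and ij: "k \<in> B s" "l \<in> B s"
  shows "fmult B (mat_unit s i k) (fmult B z (mat_unit s l j)) = fscale (z s k l) (mat_unit s i j)"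
proof (intro ext)
  fix t a b
  note 1 = fmult_mat_unit_right[where B = B and l = l and s = s, OF fd ij(2)]
  have "fmult B (mat_unit s i k) (fmult B z (mat_unit s l j)) t a b
      = (\<Sum>m\<in>B t. if m = k then (if t = s \<and> a = i \<and> b = j then z s k l else 0) else 0)"
    unfolding fmult_def[of B "mat_unit s i k"] 1 by (intro sum.cong refl) (auto simp: mat_unit_def)
  also have "\<dots> = fscale (z s k l) (mat_unit s i j) t a b"
    using ij by (subst sum.delta[OF fdD[OF fd]]) (auto simp: mat_unit_def)
  finally show "fmult B (mat_unit s i k) (fmult B z (mat_unit s l j)) t a b = fscale (z s k l) (mat_unit s i j) t a b" .
qed

text \<open>
  The complement of the projection onto the line spanned by \<open>v\<close>.
\<close>

lemma one_minus_rank_one_projection: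
  assumes fd: "fd B" and v: "sqnorm B s v \<noteq> 0"
  shows "fone B - fscale (of_real (1 / sqnorm B s v)) (rank_one B s v) \<in> projections B"
proof -
  let ?r = "rank_one B s v" and ?c = "of_real (1 / sqnorm B s v) :: complex"
  let ?p = "fscale ?c ?r"
  have rf: "?r \<in> funs B" by (rule linf_funs[OF rank_one_linf[OF fd]])
  have pf: "?p \<in> funs B" by (rule funs_scale[OF rf])
  have "fmult B ?r ?r = fscale (of_real (sqnorm B s v)) ?r"
    using fmult_rank_one_self[of B s v] by (simp only: fadj_rank_one)
  then have "fmult B ?p ?p = fscale ?c (fscale ?c (fscale (of_real (sqnorm B s v)) ?r))"
    by (simp only: fmult_scale_left fmult_scale_right)
  also have "\<dots> = ?p"
    using v by (intro ext) (simp flip: of_real_mult)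
  finally have pp: "fmult B ?p ?p = ?p" .
  have "fmult B (fone B - ?p) (fone B - ?p) = fone B - ?p"
    unfolding fmult_diff_left fmult_diff_right fmult_one_left[OF fd fone_funs] fmult_one_left[OF fd pf]
      fmult_one_right[OF fd pf] pp by (intro ext) simp
  moreover have "fadj (fone B - ?p) = fone B - ?p"
    by (auto simp: fadj_def fun_eq_iff fone_def rank_one_def)
  moreover have "fone B - ?p \<in> linf B"
    by (intro linf_diff linf_scale fone_linf rank_one_linf fd)
  ultimately show ?thesis by (simp only: projections_def mem_Collect_eq)
qed

lemma sesq_rank_one_self: "sesq B s v v (rank_one B s v) = of_real ((sqnorm B s v)\<^sup>2)"
proof -
  have "cmod (\<Sum>i\<in>B s. cnj (v i) * v i) = sqnorm B s v" unfolding sesq_self_sqnorm by simp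
  then show ?thesis by (simp add: sesq_rank_one)
qed

context discrete_quantum_group
begin

text \<open>
  Otherwise all convolution powers take the value \<open>1\<close> on the complement of the projection onto
  \<open>v\<close>. This complement then contains all supports, and hence \<open>1\<close>.
\<close>

lemma generating_faithful:
  assumes \<phi>: "npf B \<phi>" "\<phi> (fone B) = 1" and gen: "generating B \<Delta> \<phi>" and v: "sqnorm B s v \<noteq> 0"
  shows "\<exists>n. conv_pow_Suc \<Delta> \<phi> n (rank_one B s v) \<noteq> 0"
proof (rule ccontr)
  assume "\<not> (\<exists>n. conv_pow_Suc \<Delta> \<phi> n (rank_one B s v) \<noteq> 0)"
  then have z: "conv_pow_Suc \<Delta> \<phi> n (rank_one B s v) = 0" for n by blast
  let ?c = "of_real (1 / sqnorm B s v) :: complex"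
  let ?q = "fone B - fscale ?c (rank_one B s v)"
  have q: "?q \<in> projections B" by (rule one_minus_rank_one_projection[OF fdB v])
  have "conv_pow_Suc \<Delta> \<phi> n ?q = 1" for n
  proof -
    note lin = npf_linear[OF npf_conv_pow[OF \<phi>(1), of n]]
    have "conv_pow_Suc \<Delta> \<phi> n ?q = conv_pow_Suc \<Delta> \<phi> n (fone B) - ?c * conv_pow_Suc \<Delta> \<phi> n (rank_one B s v)"
      unfolding linear_fun_diff[OF lin fone_linf[OF fdB] linf_scale[OF rank_one_linf[OF fdB]]]
        linear_fun_scale[OF lin rank_one_linf[OF fdB]] ..
    then show ?thesis by (simp add: z conv_pow_one[OF \<phi>])
  qed
  then have "fle B p ?q" if "p \<in> {p. \<exists>n. is_support B (conv_pow_Suc \<Delta> \<phi> n) p}" for p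
    using that q unfolding is_support_def by blast
  then have le: "fle B (fone B) ?q"
    using gen q unfolding generating_def is_join_def by blast
  have "?q \<in> funs B" using q by (simp only: projections_def mem_Collect_eq linf_funs)
  then have "sesq B s v v (fone B) \<le> sesq B s v v ?q"
    using le unfolding fle_iff[OF fone_funs \<open>?q \<in> funs B\<close>] by blast
  then have "0 \<le> - (?c * of_real ((sqnorm B s v)\<^sup>2))"
    by (simp add: sesq_diff sesq_scale sesq_rank_one_self)
  moreover have "?c * of_real ((sqnorm B s v)\<^sup>2) = of_real (sqnorm B s v)"
    using v by (simp add: power2_eq_square)
  ultimately have "0 \<le> - complex_of_real (sqnorm B s v)" by (simp only:)
  then have "sqnorm B s v \<le> 0" by (simp add: less_eq_complex_def)
  then show False using v sqnorm_nonneg[of B s v] by simp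
qed

end

context finite_quantum_group
begin

text \<open>
  A nonzero projection \<open>p\<close> lies above the projection onto any nonzero column \<open>w\<close> of its matrix, by
  the Cauchy-Schwarz inequality for the form of \<open>p\<close>. The normalized trace of a rank one
  projection is \<open>1 / N\<close>, where \<open>N\<close> is the total dimension of the Hilbert spaces.
\<close>

lemma trace_projection_bound:
  assumes p: "p \<in> linf_pos B" and pp: "fmult B p p = p" and nz: "p \<noteq> 0"
  shows "1 / real total_dim \<le> Re (trace_state p)"
proof -
  have fp: "fpos B p" and pf: "p \<in> funs B" and pl: "p \<in> linf B" using p by (auto simp: linf_pos_iff fpos_iff)
  obtain j l where l: "l \<in> B j" "sesq B j (basis_vec l) (basis_vec l) p \<noteq> 0"
  proof -
    have "\<exists>j. \<exists>l\<in>B j. sesq B j (basis_vec l) (basis_vec l) p \<noteq> 0"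
    proof (rule ccontr)
      assume "\<not> (\<exists>j. \<exists>l\<in>B j. sesq B j (basis_vec l) (basis_vec l) p \<noteq> 0)"
      then have "trace_state p = 0" by (simp add: trace_state_def)
      then show False using trace_faithful[OF p] nz by blast
    qed
    then show thesis using that by blast
  qed
  define w where "w k = p j k l" for k
  have "p j l l = (\<Sum>k\<in>B j. p j l k * p j k l)"
    using fun_cong[OF fun_cong[OF fun_cong[OF pp, of j], of l], of l] by (simp add: fmult_def)
  also have "\<dots> = (\<Sum>k\<in>B j. cnj (w k) * w k)"
    unfolding w_def by (intro sum.cong refl) (subst fpos_hermitian[OF fdB fp, of j l], simp)
  finally have pll: "sesq B j (basis_vec l) (basis_vec l) p = of_real (sqnorm B j w)"
    by (simp add: sesq_basis fdB l sesq_self_sqnorm)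
  then have w: "sqnorm B j w > 0" using l(2) sqnorm_nonneg[of B j w] by (auto simp: less_le)
  let ?r = "fscale (of_real (1 / sqnorm B j w)) (rank_one B j w)"
  have rl: "?r \<in> linf B" by (rule linf_scale[OF rank_one_linf[OF fdB]])
  have "sesq B s v v ?r \<le> sesq B s v v p" for s v
  proof (cases "s = j")
    case True
    have "(\<Sum>i\<in>B j. cnj (v i) * w i) = sesq B j v (basis_vec l) p"
      by (simp add: sesq_basis_right fdB l w_def)
    then have "(cmod (\<Sum>i\<in>B j. cnj (v i) * w i))\<^sup>2 \<le> Re (sesq B j v v p) * sqnorm B j w"
      using fpos_Cauchy_Schwarz[OF fp, of j v "basis_vec l"] pll by simp
    then have "1 / sqnorm B j w * (cmod (\<Sum>i\<in>B j. cnj (v i) * w i))\<^sup>2 \<le> Re (sesq B j v v p)"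
      using w by (simp add: divide_le_eq)
    moreover have "sesq B j v v ?r = of_real (1 / sqnorm B j w * (cmod (\<Sum>i\<in>B j. cnj (v i) * w i))\<^sup>2)"
      by (simp add: sesq_scale sesq_rank_one)
    ultimately show ?thesis using fposD[OF fp, of j v] True by (simp only: less_eq_complex_def) simp
  next
    case False
    then show ?thesis using fposD[OF fp, of s v] by (simp add: sesq_scale sesq_rank_one)
  qed
  then have "fle B ?r p" unfolding fle_iff[OF linf_funs[OF rl] pf] by blast
  then have "trace_state ?r \<le> trace_state p" by (rule npf_mono[OF npf_trace rl pl])
  moreover have "trace_state ?r = of_real (1 / real total_dim)"
    unfolding linear_fun_scale[OF npf_linear[OF npf_trace] rank_one_linf[OF fdB]] trace_rank_one
    using w by (simp flip: of_real_mult)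
  ultimately show ?thesis by (simp add: less_eq_complex_def)
qed

end

section \<open>Finite normal quantum subgroups\<close>

context finite_normal_quantum_subgroup
begin

lemma pnm_res: "pnm BH BG \<pi>"
  by (rule pnm_normal_star_hom[OF H.fdB G.fdB res_hom res_normal])

lemma res_linf: "x \<in> linf BH \<Longrightarrow> \<pi> x \<in> linf BG"
  by (rule pnm_linf[OF pnm_res])

lemma res_mult: "a \<in> linf BH \<Longrightarrow> b \<in> linf BH \<Longrightarrow> \<pi> (fmult BH a b) = fmult BG (\<pi> a) (\<pi> b)"
  using res_hom by (simp add: star_hom_def)

lemma res_one: "\<pi> (fone BH) = fone BG"
proof -
  obtain e where e: "e \<in> linf BH" "\<pi> e = fone BG"
    using res_surj fone_linf[OF G.fdB] by (metis imageE)
  have "fone BG = \<pi> (fmult BH (fone BH) e)" by (simp only: fmult_one_left[OF H.fdB linf_funs[OF e(1)]] e(2))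
  also have "\<dots> = fmult BG (\<pi> (fone BH)) (fone BG)" by (simp only: res_mult[OF fone_linf[OF H.fdB] e(1)] e(2))
  also have "\<dots> = \<pi> (fone BH)"
    by (rule fmult_one_right[OF G.fdB linf_funs[OF res_linf[OF fone_linf[OF H.fdB]]]])
  finally show ?thesis ..
qed

lemma npf_res: "npf BG \<eta> \<Longrightarrow> npf BH (\<lambda>x. \<eta> (\<pi> x))"
  by (rule npf_comp[OF H.fdB G.fdB _ pnm_res])

lemma nfun_res: "nfun BG \<eta> \<Longrightarrow> nfun BH (\<lambda>x. \<eta> (\<pi> x))"
  by (rule nfun_comp[OF H.fdB G.fdB pnm_res])

lemma nfun_res_entry: "nfun BH (\<lambda>x. \<pi> x j k l)"
  by (rule pnm_nfun_entry[OF G.fdB pnm_res])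

lemma nfun_entryH: "nfun BH (\<lambda>x. x t k l)"
  by (rule nfun_polarize[OF H.fdB]) (auto intro: linf_funs nfun.npf npf_sesq H.fdB)

lemma nfun_entryG: "nfun BG (\<lambda>x. x t k l)"
  by (rule nfun_polarize[OF G.fdB]) (auto intro: linf_funs nfun.npf npf_sesq G.fdB)

text \<open>
  Compatibility of \<open>\<pi>\<close> with the coproducts, expressed by functionals.
\<close>

lemma conv_res:
  assumes \<eta>: "nfun BG \<eta>" and \<zeta>: "nfun BG \<zeta>" and x: "x \<in> linf BH"
  shows "conv \<Delta>G \<eta> \<zeta> (\<pi> x) = conv \<Delta>H (\<lambda>x. \<eta> (\<pi> x)) (\<lambda>x. \<zeta> (\<pi> x)) x"
proof -
  let ?y = "\<Delta>H x"
  have y: "?y \<in> linf (BH \<otimes>\<^sub>B BH)" by (rule H.comult_linf[OF x])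
  have "id_fun \<zeta> (map_id \<pi> (id_map \<pi> ?y)) j k l = \<pi> (id_fun (\<lambda>x. \<zeta> (\<pi> x)) ?y) j k l" for j k l
  proof -
    let ?e = "\<lambda>x. \<pi> x j k l"
    have "slice2 (map_id \<pi> (id_map \<pi> ?y)) j k l = fun_id ?e (id_map \<pi> ?y)"
      by (simp add: slice2_def map_id_def fun_id_def)
    then have "id_fun \<zeta> (map_id \<pi> (id_map \<pi> ?y)) j k l = \<zeta> (fun_id ?e (id_map \<pi> ?y))"
      by (simp only: id_fun_def)
    also have "fun_id ?e (id_map \<pi> ?y) = \<pi> (fun_id ?e ?y)"
      by (rule fun_id_id_map[OF H.fdB H.fdB G.fdB pnm_res nfun_res_entry y])
    also have "\<zeta> (\<pi> (fun_id ?e ?y)) = ?e (id_fun (\<lambda>x. \<zeta> (\<pi> x)) ?y)"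
      by (rule Fubini[OF H.fdB H.fdB nfun_res[OF \<zeta>] nfun_res_entry y, symmetric])
    finally show ?thesis .
  qed
  then have "id_fun \<zeta> (\<Delta>G (\<pi> x)) = \<pi> (id_fun (\<lambda>x. \<zeta> (\<pi> x)) ?y)"
    unfolding res_comult[OF x] by (intro ext)
  then show ?thesis by (simp only: conv_def)
qed

text \<open>
  The images of the central projections \<open>1\<^sub>s\<close> are projections in a finite dimensional algebra with
  sum \<open>1\<close>. Their traces add up to \<open>1\<close>, and the nonzero ones are bounded below.
\<close>

lemma finite_res_support: "finite {s. \<pi> (cut s (fone BH)) \<noteq> 0}"
proof (rule ccontr)
  let ?A = "{s. \<pi> (cut s (fone BH)) \<noteq> 0}"
  let ?N = "G.total_dim"
  assume "infinite ?A"
  then obtain F where F: "finite F" "card F = Suc ?N" "F \<subseteq> ?A"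
    using infinite_arbitrarily_large by blast
  let ?g = "\<lambda>s. G.trace_state (\<pi> (cut s (fone BH)))"
  have one: "fone BH \<in> linf_pos BH" by (rule fone_linf_pos[OF H.fdB])
  have cp: "cut s (fone BH) \<in> linf_pos BH" for s
    using one by (intro cut_linf_pos[OF H.fdB]) (simp add: linf_pos_iff)
  have g0: "0 \<le> ?g s" for s by (rule npf_pos[OF npf_res[OF G.npf_trace] cp])
  have "((\<lambda>s. Re (?g s)) has_sum Re (G.trace_state (\<pi> (fone BH)))) UNIV"
    by (rule has_sum_Re[OF npf_has_sum[OF npf_res[OF G.npf_trace] one]])
  then have "(\<Sum>s\<in>F. Re (?g s)) \<le> Re (G.trace_state (\<pi> (fone BH)))"
    by (rule finite_sum_le_has_sum) (use F g0 in \<open>auto simp: less_eq_complex_def\<close>)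
  then have "(\<Sum>s\<in>F. Re (?g s)) \<le> 1" by (simp add: res_one G.trace_one)
  moreover have "(\<Sum>s\<in>F. 1 / real ?N) \<le> (\<Sum>s\<in>F. Re (?g s))"
  proof (rule sum_mono)
    fix s assume "s \<in> F"
    then have nz: "\<pi> (cut s (fone BH)) \<noteq> 0" using F(3) by blast
    have "fmult BH (cut s (fone BH)) (cut s (fone BH)) = cut s (cut s (fone BH))"
      by (rule fmult_cut_one[OF H.fdB cut_funs[OF fone_funs]])
    also have "\<dots> = cut s (fone BH)" by (auto simp: cut_def)
    finally have "fmult BG (\<pi> (cut s (fone BH))) (\<pi> (cut s (fone BH))) = \<pi> (cut s (fone BH))"
      by (simp only: res_mult[OF linf_posD[OF cp] linf_posD[OF cp], symmetric])
    then show "1 / real ?N \<le> Re (?g s)"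
      by (rule G.trace_projection_bound[OF pnm_linf_pos[OF pnm_res cp] _ nz])
  qed
  ultimately have "real (Suc ?N) * (1 / real ?N) \<le> 1" using F(2) by simp
  then show False using G.total_dim_ge_1 by (simp add: field_simps)
qed

lemma res_cut_outside:
  assumes "\<pi> (cut s (fone BH)) = 0" and x: "x \<in> linf BH"
  shows "\<pi> (cut s x) = 0"
proof -
  have "\<pi> (cut s x) = \<pi> (fmult BH (cut s (fone BH)) x)"
    by (simp only: fmult_cut_one[OF H.fdB linf_funs[OF x]])
  also have "\<dots> = fmult BG 0 (\<pi> x)"
    by (simp only: res_mult[OF cut_linf[OF H.fdB fone_funs] x] assms(1))
  also have "\<dots> = 0" by (intro ext) (simp add: fmult_def)
  finally show ?thesis .
qed

text \<open>
  A matrix block is a simple algebra: from a nonzero entry of \<open>z\<close> all matrix units of the block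
  arise by multiplication with matrix units, so \<open>\<pi>\<close> would vanish on the whole block.
\<close>

lemma res_zero_block:
  assumes s: "\<pi> (cut s (fone BH)) \<noteq> 0" and z: "z \<in> linf BH" "\<pi> z = 0"
  shows "z s k l = 0"
proof (rule ccontr)
  assume nz: "z s k l \<noteq> 0"
  then have kl: "k \<in> BH s" "l \<in> BH s" using funs_zero[OF linf_funs[OF z(1)], of k s l] by blast+
  have mu: "\<pi> (mat_unit s i i) = 0" if i: "i \<in> BH s" for i
  proof -
    note m1 = mat_unit_linf[OF H.fdB i kl(1)] and m2 = mat_unit_linf[OF H.fdB kl(2) i]
      and m = mat_unit_linf[OF H.fdB i i]
    have e: "fmult BH (mat_unit s i k) (fmult BH z (mat_unit s l i)) = fscale (z s k l) (mat_unit s i i)"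
      by (rule fmult_mat_units[OF H.fdB kl])
    have zl: "fmult BH z (mat_unit s l i) \<in> linf BH"
    proof (rule cfin_linf[OF H.fdB])
      note e = fmult_mat_unit_right[where B = BH and l = l and s = s, OF H.fdB kl(2)]
      have "{t. fmult BH z (mat_unit s l i) t \<noteq> 0} \<subseteq> {s}"
        by (auto simp: e fun_eq_iff split: if_splits)
      then show "fmult BH z (mat_unit s l i) \<in> cfin BH"
        using linf_funs[OF z(1)] i
        by (auto simp: cfin_def funs_def e intro: finite_subset split: if_splits)
    qed
    have "fscale (z s k l) (\<pi> (mat_unit s i i)) = \<pi> (fmult BH (mat_unit s i k) (fmult BH z (mat_unit s l i)))"
      unfolding e by (rule pnm_scale[OF G.fdB pnm_res m, symmetric])
    also have "\<dots> = fmult BG (\<pi> (mat_unit s i k)) (fmult BG (\<pi> z) (\<pi> (mat_unit s l i)))"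
      by (simp only: res_mult[OF m1 zl] res_mult[OF z(1) m2])
    also have "\<dots> = 0" unfolding z(2) by (intro ext) (simp add: fmult_def)
    finally have "z s k l * \<pi> (mat_unit s i i) j a b = 0" for j a b
      by (simp only: fscale_apply[symmetric] zero_fun_apply)
    then have "\<pi> (mat_unit s i i) j a b = 0" for j a b using nz by simp
    then show ?thesis by (intro ext) (simp only: zero_fun_apply)
  qed
  have "\<pi> (cut s (fone BH)) j a b = 0" for j a b
  proof -
    have "\<pi> (cut s (fone BH)) j a b
        = (\<Sum>i\<in>BH s. \<Sum>i'\<in>BH s. fone BH s i i' * \<pi> (mat_unit s i i') j a b)"
      by (rule linear_fun_cut[OF H.fdB fone_funs nfun_linear[OF nfun_res_entry]])
    also have "\<dots> = 0"
      by (intro sum.neutral ballI) (auto simp: fone_def mu)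
    finally show ?thesis .
  qed
  then have "\<pi> (cut s (fone BH)) = 0" by (intro ext) (simp only: zero_fun_apply)
  then show False using s by blast
qed

lemma res_support_nonempty: "\<exists>s. \<pi> (cut s (fone BH)) \<noteq> 0"
proof (rule ccontr)
  assume "\<not> (\<exists>s. \<pi> (cut s (fone BH)) \<noteq> 0)"
  then have z: "\<pi> (cut s (fone BH)) = 0" for s by blast
  have "((\<lambda>s. G.trace_state (\<pi> (cut s (fone BH)))) has_sum G.trace_state (\<pi> (fone BH))) UNIV"
    by (rule npf_has_sum[OF npf_res[OF G.npf_trace] fone_linf_pos[OF H.fdB]])
  then have "((\<lambda>s::'i. 0::complex) has_sum 1) UNIV"
    unfolding z res_one G.trace_one linear_fun_zero[OF npf_linear[OF G.npf_trace]] .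
  then show False using has_sum_unique[OF has_sum_0_simp] by force
qed


section \<open>Averaging over the subgroup\<close>

text \<open>
  The properties of \<open>\<omega> = h \<circ> \<pi>\<close>, for the Haar state \<open>h\<close> of \<open>G\<close>, on which the argument relies:
  two-sided invariance, and faithfulness of \<open>h\<close> in the last clause.
\<close>

definition averaging_state :: "(('i, 'b) fam \<Rightarrow> complex) \<Rightarrow> bool" where
  "averaging_state \<omega> \<longleftrightarrow> npf BH \<omega> \<and> \<omega> (fone BH) = 1 \<and>
     (\<forall>\<eta> x. nfun BG \<eta> \<longrightarrow> x \<in> linf BH \<longrightarrow>
        conv \<Delta>H \<omega> (\<lambda>x. \<eta> (\<pi> x)) x = \<eta> (fone BG) * \<omega> x \<and>
        conv \<Delta>H (\<lambda>x. \<eta> (\<pi> x)) \<omega> x = \<eta> (fone BG) * \<omega> x) \<and>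
     (\<exists>h. nfun BG h \<and> (\<forall>x. \<omega> x = h (\<pi> x))) \<and>
     (\<forall>x\<in>linf_pos BH. \<omega> x = 0 \<longrightarrow> \<pi> x = 0)"

lemma averaging_state_exists: "\<exists>\<omega>. averaging_state \<omega>"
proof -
  obtain h c where h: "npf BG h" "h (fone BG) = 1" and c: "c > 0"
    and inv: "\<And>x. x \<in> linf BG \<Longrightarrow> conv_op \<Delta>G h x = fscale (h x) (fone BG)"
      "\<And>x. x \<in> linf BG \<Longrightarrow> rconv_op \<Delta>G h x = fscale (h x) (fone BG)"
    and le: "\<And>x. x \<in> linf_pos BG \<Longrightarrow> of_real c * G.trace_state x \<le> h x"
    using G.haar_state by blast
  note nh = nfun.npf[OF h(1)]
  let ?\<omega> = "\<lambda>x. h (\<pi> x)"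
  have "averaging_state ?\<omega>"
    unfolding averaging_state_def
  proof (intro conjI allI impI ballI)
    show "npf BH ?\<omega>" by (rule npf_res[OF h(1)])
    show "h (\<pi> (fone BH)) = 1" by (simp add: res_one h)
    fix \<eta> x assume \<eta>: "nfun BG \<eta>" and x: "x \<in> linf BH"
    note s = linear_fun_scale[OF nfun_linear[OF \<eta>] fone_linf[OF G.fdB]]
    have "conv \<Delta>H ?\<omega> (\<lambda>x. \<eta> (\<pi> x)) x = conv \<Delta>G h \<eta> (\<pi> x)" by (rule conv_res[OF nh \<eta> x, symmetric])
    also have "\<dots> = \<eta> (fscale (h (\<pi> x)) (fone BG))"
      unfolding G.conv_eq_conv_op[OF nh \<eta> res_linf[OF x]] inv(1)[OF res_linf[OF x]] ..
    also have "\<dots> = \<eta> (fone BG) * h (\<pi> x)" unfolding s by (rule mult.commute)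
    finally show "conv \<Delta>H ?\<omega> (\<lambda>x. \<eta> (\<pi> x)) x = \<eta> (fone BG) * h (\<pi> x)" .
    have "conv \<Delta>H (\<lambda>x. \<eta> (\<pi> x)) ?\<omega> x = conv \<Delta>G \<eta> h (\<pi> x)" by (rule conv_res[OF \<eta> nh x, symmetric])
    also have "\<dots> = \<eta> (fscale (h (\<pi> x)) (fone BG))"
      unfolding conv_eq_rconv_op inv(2)[OF res_linf[OF x]] ..
    also have "\<dots> = \<eta> (fone BG) * h (\<pi> x)" unfolding s by (rule mult.commute)
    finally show "conv \<Delta>H (\<lambda>x. \<eta> (\<pi> x)) ?\<omega> x = \<eta> (fone BG) * h (\<pi> x)" .
  next
    show "\<exists>h'. nfun BG h' \<and> (\<forall>x. h (\<pi> x) = h' (\<pi> x))" using nh by blast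
  next
    fix x assume x: "x \<in> linf_pos BH" and z: "h (\<pi> x) = 0"
    have px: "\<pi> x \<in> linf_pos BG" by (rule pnm_linf_pos[OF pnm_res x])
    have "of_real c * G.trace_state (\<pi> x) \<le> 0" using le[OF px] z by simp
    moreover have "0 \<le> G.trace_state (\<pi> x)" by (rule npf_pos[OF G.npf_trace px])
    ultimately have "G.trace_state (\<pi> x) = 0"
      using c by (auto simp: less_eq_complex_def complex_eq_iff mult_le_0_iff)
    then show "\<pi> x = 0" by (rule G.trace_faithful[OF px])
  qed
  then show ?thesis by blast
qed

lemma averaging_idempotent:
  assumes \<omega>: "averaging_state \<omega>" and x: "x \<in> linf BH"
  shows "conv \<Delta>H \<omega> \<omega> x = \<omega> x"
proof -
  obtain h where h: "nfun BG h" "\<And>x. \<omega> x = h (\<pi> x)" using \<omega> by (auto simp: averaging_state_def)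
  have "conv \<Delta>H \<omega> (\<lambda>x. h (\<pi> x)) x = h (fone BG) * \<omega> x"
    using \<omega> h(1) x by (auto simp: averaging_state_def)
  moreover have "\<omega> = (\<lambda>x. h (\<pi> x))" by (intro ext h(2))
  moreover have "h (fone BG) = 1" using \<omega> by (simp add: averaging_state_def h(2) flip: res_one)
  ultimately show ?thesis by (simp only: mult_1_left)
qed

text \<open>
  The left average \<open>y = (\<omega> \<otimes> \<iota>)\<Delta>(x)\<close> is fixed by the left action of \<open>G\<close>, hence by the right
  action, and so \<open>(\<iota> \<otimes> \<omega>)\<Delta>(y) = y\<close>. Similarly the right average \<open>z\<close> of \<open>x\<close> satisfies
  \<open>(\<omega> \<otimes> \<iota>)\<Delta>(z) = z\<close>. Left and right averaging commute by coassociativity, so \<open>y = z\<close>.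
\<close>

lemma averaging_central:
  assumes \<omega>: "averaging_state \<omega>" and \<tau>: "nfun BH \<tau>" and x: "x \<in> linf BH"
  shows "conv \<Delta>H \<omega> \<tau> x = conv \<Delta>H \<tau> \<omega> x"
proof -
  have npf: "npf BH \<omega>" using \<omega> by (simp add: averaging_state_def)
  note n\<omega> = nfun.npf[OF npf]
  have invL: "conv \<Delta>H \<omega> (\<lambda>x. \<eta> (\<pi> x)) y = \<eta> (fone BG) * \<omega> y"
    and invR: "conv \<Delta>H (\<lambda>x. \<eta> (\<pi> x)) \<omega> y = \<eta> (fone BG) * \<omega> y"
    if "nfun BG \<eta>" "y \<in> linf BH" for \<eta> y
    using \<omega> that by (auto simp: averaging_state_def)
  obtain h where h: "nfun BG h" "\<And>x. \<omega> x = h (\<pi> x)" using \<omega> by (auto simp: averaging_state_def)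
  have \<omega>1: "\<omega> (fone BH) = 1" using \<omega> by (simp add: averaging_state_def)
  then have h1: "h (fone BG) = 1" by (simp add: h(2) res_one)
  let ?y = "conv_op \<Delta>H \<omega> x" and ?z = "rconv_op \<Delta>H \<omega> x"
  have y: "?y \<in> linf BH" by (rule H.conv_op_linf[OF n\<omega> x])
  have z: "?z \<in> linf BH" by (rule H.rconv_op_linf[OF n\<omega> x])
  have "left_action \<Delta>H \<pi> ?y = fone BG \<otimes>\<^sub>F ?y"
  proof (intro ext)
    fix u :: "'j \<times> 'i" and a b :: "'c \<times> 'b"
    obtain j t k m l n where u: "u = (j, t)" "a = (k, m)" "b = (l, n)" by (metis prod.exhaust)
    let ?p = "\<lambda>x. \<pi> x j k l" and ?e = "\<lambda>x::('i, 'b) fam. x t m n"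
    note ne = nfun_entryH[of t m n] and np = nfun_res_entry[of j k l]
    have "left_action \<Delta>H \<pi> ?y u a b = ?e (conv_op \<Delta>H ?p ?y)"
      by (simp add: left_action_def map_id_def u conv_op_def fun_id_def)
    also have "\<dots> = conv \<Delta>H ?p ?e ?y" by (rule H.conv_eq_conv_op[OF np ne y, symmetric])
    also have "\<dots> = conv \<Delta>H \<omega> (conv \<Delta>H ?p ?e) x"
      by (rule H.conv_eq_conv_op[OF n\<omega> H.nfun_conv[OF np ne] x, symmetric])
    also have "\<dots> = conv \<Delta>H (conv \<Delta>H \<omega> ?p) ?e x" by (rule H.conv_assoc[OF ne x, symmetric])
    also have "\<dots> = conv \<Delta>H (\<lambda>x. fone BG j k l * \<omega> x) ?e x"
      by (rule H.conv_cong_left[OF ne x]) (rule invL[OF nfun_entryG])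
    also have "\<dots> = fone BG j k l * conv \<Delta>H \<omega> ?e x" by (simp only: conv_eq_rconv_op)
    also have "conv \<Delta>H \<omega> ?e x = ?e ?y" by (rule H.conv_eq_conv_op[OF n\<omega> ne x])
    finally show "left_action \<Delta>H \<pi> ?y u a b = (fone BG \<otimes>\<^sub>F ?y) u a b"
      by (simp add: ftens_def u)
  qed
  then have ra: "right_action \<Delta>H \<pi> ?y = ?y \<otimes>\<^sub>F fone BG" using fixed_points_eq y by blast
  have ry: "\<pi> (slice2 (\<Delta>H ?y) s i i') j k l = ?y s i i' * fone BG j k l" for s i i' j k l
  proof -
    have "right_action \<Delta>H \<pi> ?y (s, j) (i, k) (i', l) = (?y \<otimes>\<^sub>F fone BG) (s, j) (i, k) (i', l)"
      by (simp only: ra)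
    then show ?thesis by (simp add: right_action_def id_map_def ftens_def)
  qed
  have 1: "rconv_op \<Delta>H \<omega> ?y = ?y"
  proof (intro ext)
    fix s i i'
    have "\<pi> (slice2 (\<Delta>H ?y) s i i') = fscale (?y s i i') (fone BG)"
      by (intro ext) (simp only: ry fscale_apply)
    then have "\<omega> (slice2 (\<Delta>H ?y) s i i') = h (fscale (?y s i i') (fone BG))" by (simp only: h(2))
    also have "\<dots> = ?y s i i'"
      unfolding linear_fun_scale[OF nfun_linear[OF h(1)] fone_linf[OF G.fdB]] h1 by simp
    finally show "rconv_op \<Delta>H \<omega> ?y s i i' = ?y s i i'" by (simp only: rconv_op_def id_fun_def)
  qed
  have "right_action \<Delta>H \<pi> ?z = ?z \<otimes>\<^sub>F fone BG"
  proof (intro ext)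
    fix u :: "'i \<times> 'j" and a b :: "'b \<times> 'c"
    obtain t j m k n l where u: "u = (t, j)" "a = (m, k)" "b = (n, l)" by (metis prod.exhaust)
    let ?p = "\<lambda>x. \<pi> x j k l" and ?e = "\<lambda>x::('i, 'b) fam. x t m n"
    note ne = nfun_entryH[of t m n] and np = nfun_res_entry[of j k l]
    have "right_action \<Delta>H \<pi> ?z u a b = conv \<Delta>H ?e ?p ?z"
      by (simp add: right_action_def id_map_def u conv_def id_fun_def)
    also have "\<dots> = conv \<Delta>H (conv \<Delta>H ?e ?p) \<omega> x" by (simp only: conv_eq_rconv_op)
    also have "\<dots> = conv \<Delta>H ?e (conv \<Delta>H ?p \<omega>) x" by (rule H.conv_assoc[OF n\<omega> x])
    also have "\<dots> = conv \<Delta>H ?e (\<lambda>x. fone BG j k l * \<omega> x) x"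
      by (rule H.conv_cong_right[OF x]) (rule invR[OF nfun_entryG])
    also have "\<dots> = fone BG j k l * conv \<Delta>H ?e \<omega> x"
      by (simp only: H.conv_eq_conv_op[OF ne nfun.scale[OF n\<omega>] x] H.conv_eq_conv_op[OF ne n\<omega> x])
    also have "conv \<Delta>H ?e \<omega> x = ?e ?z" by (rule conv_eq_rconv_op)
    finally show "right_action \<Delta>H \<pi> ?z u a b = (?z \<otimes>\<^sub>F fone BG) u a b"
      by (simp add: ftens_def u)
  qed
  then have la: "left_action \<Delta>H \<pi> ?z = fone BG \<otimes>\<^sub>F ?z" using fixed_points_eq z by blast
  have lz: "\<pi> (slice1 (\<Delta>H ?z) t m n) j k l = fone BG j k l * ?z t m n" for t m n j k l
  proof -
    have "left_action \<Delta>H \<pi> ?z (j, t) (k, m) (l, n) = (fone BG \<otimes>\<^sub>F ?z) (j, t) (k, m) (l, n)"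
      by (simp only: la)
    then show ?thesis by (simp add: left_action_def map_id_def ftens_def)
  qed
  have 2: "conv_op \<Delta>H \<omega> ?z = ?z"
  proof (intro ext)
    fix t m n
    have "\<pi> (slice1 (\<Delta>H ?z) t m n) = fscale (?z t m n) (fone BG)"
      by (intro ext) (simp only: lz fscale_apply mult.commute)
    then have "\<omega> (slice1 (\<Delta>H ?z) t m n) = h (fscale (?z t m n) (fone BG))" by (simp only: h(2))
    also have "\<dots> = ?z t m n"
      unfolding linear_fun_scale[OF nfun_linear[OF h(1)] fone_linf[OF G.fdB]] h1 by simp
    finally show "conv_op \<Delta>H \<omega> ?z t m n = ?z t m n" by (simp only: conv_op_def fun_id_def)
  qed
  have "?y t m n = ?z t m n" for t m n
  proof -
    let ?e = "\<lambda>x::('i, 'b) fam. x t m n"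
    note ne = nfun_entryH[of t m n]
    have "?e ?y = conv \<Delta>H ?e \<omega> ?y" unfolding conv_eq_rconv_op 1 ..
    also have "\<dots> = conv \<Delta>H \<omega> (conv \<Delta>H ?e \<omega>) x"
      by (rule H.conv_eq_conv_op[OF n\<omega> H.nfun_conv[OF ne n\<omega>] x, symmetric])
    also have "\<dots> = conv \<Delta>H (conv \<Delta>H \<omega> ?e) \<omega> x" by (rule H.conv_assoc[OF n\<omega> x, symmetric])
    also have "\<dots> = conv \<Delta>H \<omega> ?e ?z" by (rule conv_eq_rconv_op)
    also have "\<dots> = ?e ?z" unfolding H.conv_eq_conv_op[OF n\<omega> ne z] 2 ..
    finally show ?thesis .
  qed
  then have "?y = ?z" by (intro ext)
  then show ?thesis
    using H.conv_eq_conv_op[OF n\<omega> \<tau> x] conv_eq_rconv_op[of \<Delta>H \<tau> \<omega> x] by (simp only:)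
qed

lemma averaging_dominated:
  assumes \<omega>: "averaging_state \<omega>" and \<tau>: "\<And>m. npf BH (\<tau> m)"
    and ex: "\<And>s v. sqnorm BH s v \<noteq> 0 \<Longrightarrow> \<exists>m. \<tau> m (rank_one BH s v) \<noteq> 0"
  shows "\<exists>M C. C \<ge> 0 \<and> (\<forall>x\<in>linf_pos BH. \<omega> x \<le> of_real C * (\<Sum>m<(M::nat). \<tau> m x))"
proof -
  have npf: "npf BH \<omega>" using \<omega> by (simp add: averaging_state_def)
  obtain h where h: "nfun BG h" "\<And>x. \<omega> x = h (\<pi> x)" using \<omega> by (auto simp: averaging_state_def)
  let ?F = "{s. \<pi> (cut s (fone BH)) \<noteq> 0}"
  have "\<omega> x = (\<Sum>s\<in>?F. \<omega> (cut s x))" if x: "x \<in> linf_pos BH" for x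
  proof -
    have out: "\<omega> (cut s x) = 0" if "s \<notin> ?F" for s
    proof -
      have "\<pi> (cut s (fone BH)) = 0" using that by blast
      then have "\<pi> (cut s x) = 0" by (rule res_cut_outside[OF _ linf_posD[OF x]])
      then show ?thesis by (simp only: h(2) linear_fun_zero[OF nfun_linear[OF h(1)]])
    qed
    have "((\<lambda>s. \<omega> (cut s x)) has_sum (\<Sum>s\<in>?F. \<omega> (cut s x))) UNIV"
      by (rule has_sum_finite_neutralI[OF finite_res_support]) (use out in auto)
    then show ?thesis using npf_has_sum[OF npf x] has_sum_unique by blast
  qed
  then show ?thesis
    by (rule npf_dominated[OF H.fdB npf \<tau> finite_res_support]) (assumption | rule ex)+
qed

text \<open>
  Faithfulness of \<open>h\<close> gives \<open>(\<pi> \<otimes> \<iota>)\<Delta>(x) = 0\<close>. On a block \<open>s\<close> with \<open>\<pi>(1\<^sub>s) \<noteq> 0\<close> the map \<open>\<pi>\<close> is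
  injective, so the component of \<open>\<Delta>(x)\<close> with first leg in this block is zero.
\<close>

lemma averaging_nondegenerate:
  assumes \<omega>: "averaging_state \<omega>" and x: "x \<in> linf_pos BH" "x \<in> cfin BH"
    and z: "\<And>t v. conv \<Delta>H \<omega> (sesq BH t v v) x = 0"
  shows "x = 0"
proof -
  obtain s where s: "\<pi> (cut s (fone BH)) \<noteq> 0" using res_support_nonempty by blast
  have xl: "x \<in> linf BH" by (rule linf_posD[OF x(1)])
  have nq: "nfun BH (sesq BH t v v)" for t v by (rule nfun.npf[OF npf_sesq[OF H.fdB]])
  have zero: "rconv_op \<Delta>H (sesq BH t v v) x s k l = 0" for t v k l
  proof -
    let ?z = "rconv_op \<Delta>H (sesq BH t v v) x"
    have zp: "?z \<in> linf_pos BH" by (rule pnm_linf_pos[OF H.pnm_rconv_op[OF npf_sesq[OF H.fdB]] x(1)])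
    have "\<omega> ?z = 0" using z[of t v] by (simp only: conv_eq_rconv_op)
    then have "\<pi> ?z = 0" using \<omega> zp by (auto simp: averaging_state_def)
    then show ?thesis by (rule res_zero_block[OF s linf_posD[OF zp]])
  qed
  obtain i where i: "i \<in> BH s" using H.nonzero_dim by blast
  let ?w = "basis_vec i"
  have w: "sqnorm BH s ?w \<noteq> 0"
    using i by (auto simp: sqnorm_eq_0_iff[OF H.fdB] basis_vec_def)
  have "conv_op \<Delta>H (sesq BH s ?w ?w) x = 0"
  proof (rule funs_eqI[OF H.fdB linf_funs[OF H.conv_op_linf[OF nq xl]] linf_funs[OF linf_zero]])
    fix t v
    have "sesq BH t v v (conv_op \<Delta>H (sesq BH s ?w ?w) x) = sesq BH s ?w ?w (rconv_op \<Delta>H (sesq BH t v v) x)"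
      unfolding H.conv_eq_conv_op[OF nq nq xl, symmetric] conv_eq_rconv_op ..
    also have "\<dots> = 0" by (simp only: sesq_basis[OF H.fdB i i] zero)
    finally show "sesq BH t v v (conv_op \<Delta>H (sesq BH s ?w ?w) x) = sesq BH t v v 0"
      by (simp only: sesq_zero)
  qed
  then show "x = 0" using x by (intro H.conv_op_vector_zeroD[OF _ x(2) w]) (simp add: linf_pos_iff)
qed

end

section \<open>Positive harmonic functions\<close>

lemma has_sum_dominated:
  fixes f g :: "'a \<Rightarrow> complex"
  assumes g: "(g has_sum r) A" and le: "\<And>x. x \<in> A \<Longrightarrow> 0 \<le> f x \<and> f x \<le> g x"
  shows "\<exists>r'. (f has_sum r') A \<and> 0 \<le> r' \<and> r' \<le> r"
proof -
  have g': "((\<lambda>x. Re (g x)) has_sum Re r) A \<and> Im r = 0"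
    using has_sum_complex_of_real_iff[of A g r] g le by (meson order_trans)
  have re: "0 \<le> Re (f x)" "Re (f x) \<le> Re (g x)" if "x \<in> A" for x
    using le[OF that] by (auto simp: less_eq_complex_def)
  have "(\<lambda>x. Re (f x)) summable_on A"
    by (rule summable_on_comparison_test[OF has_sum_imp_summable[OF conjunct1[OF g']]]) (use re in auto)
  then obtain q where q: "((\<lambda>x. Re (f x)) has_sum q) A" by (auto simp: summable_on_def)
  have "(f has_sum of_real q) A"
    using has_sum_complex_of_real_iff[of A f "of_real q"] le q by simp
  moreover have "0 \<le> q" by (rule has_sum_nonneg[OF q]) (use re in auto)
  moreover have "q \<le> Re r" by (rule has_sum_mono[OF q conjunct1[OF g']]) (use re in auto)
  ultimately show ?thesis using g' by (intro exI[of _ "of_real q"]) (simp add: less_eq_complex_def)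
qed

context discrete_quantum_group
begin

text \<open>
  Harmonicity as invariance \<open>(\<omega> \<star> \<tau>)(a) = \<tau>(a)\<close> of the values of functionals, including the
  finiteness of either side.
\<close>

lemma harmonic_value_iff:
  assumes \<omega>: "npf B \<omega>" and \<tau>: "npf B \<tau>" and a: "fpos B a" and harm: "extends_to (conv_op \<Delta> \<omega>) a a"
  shows "((\<lambda>s. conv \<Delta> \<omega> \<tau> (cut s a)) has_sum r) UNIV \<longleftrightarrow> ((\<lambda>s. \<tau> (cut s a)) has_sum r) UNIV"
proof -
  have af: "a \<in> funs B" using a by (simp add: fpos_iff)
  have e: "conv \<Delta> \<omega> \<tau> (cut s a) = \<tau> (conv_op \<Delta> \<omega> (cut s a))" for s
    by (rule conv_eq_conv_op[OF nfun.npf[OF \<omega>] nfun.npf[OF \<tau>] cut_linf[OF fdB af]])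
  have y: "conv_op \<Delta> \<omega> (cut s a) \<in> linf_pos B" for s
    by (rule pnm_linf_pos[OF pnm_conv_op[OF \<omega>] cut_linf_pos[OF fdB a]])
  have ya: "((\<lambda>s. conv_op \<Delta> \<omega> (cut s a) t i j) has_sum a t i j) UNIV" for t i j
    using harm by (simp add: extends_to_def)
  show ?thesis unfolding e by (rule npf_has_sum_family[OF fdB \<tau> y ya af])
qed

lemma harmonic_value_power_iff:
  assumes \<phi>: "npf B \<phi>" and \<tau>: "npf B \<tau>" and a: "fpos B a" and harm: "extends_to (conv_op \<Delta> \<phi>) a a"
  shows "((\<lambda>s. conv \<Delta> (conv_pow_Suc \<Delta> \<phi> n) \<tau> (cut s a)) has_sum r) UNIV \<longleftrightarrow>
    ((\<lambda>s. \<tau> (cut s a)) has_sum r) UNIV"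
  using \<tau>
proof (induction n arbitrary: \<tau>)
  case 0
  then show ?case using harmonic_value_iff[OF \<phi> _ a harm] by simp
next
  case (Suc n)
  have af: "a \<in> funs B" using a by (simp add: fpos_iff)
  have "conv \<Delta> (conv_pow_Suc \<Delta> \<phi> (Suc n)) \<tau> (cut s a) = conv \<Delta> (conv_pow_Suc \<Delta> \<phi> n) (conv \<Delta> \<phi> \<tau>) (cut s a)" for s
    unfolding conv_pow_Suc.simps by (rule conv_assoc[OF nfun.npf[OF Suc.prems] cut_linf[OF fdB af]])
  then show ?case
    using Suc.IH[OF npf_conv[OF \<phi> Suc.prems]] harmonic_value_iff[OF \<phi> Suc.prems a harm] by (simp only:)
qed

end

context finite_normal_quantum_subgroup
begin

text \<open>
  The core of the argument: first \<open>a\<close> lies above its average over \<open>G\<close>, by iterating the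
  domination of \<open>\<omega>\<close> by means of convolution powers, and then the difference vanishes because its average
  does.
\<close>

lemma averaging_fixes_harmonic:
  assumes \<phi>: "npf BH \<phi>" "\<phi> (fone BH) = 1" and gen: "generating BH \<Delta>H \<phi>"
    and a: "fpos BH a" and harm: "extends_to (conv_op \<Delta>H \<phi>) a a"
    and \<omega>: "averaging_state \<omega>"
  shows "extends_to (conv_op \<Delta>H \<omega>) a a"
proof -
  have npf\<omega>: "npf BH \<omega>" and \<omega>1: "\<omega> (fone BH) = 1" using \<omega> by (auto simp: averaging_state_def)
  note n\<omega> = nfun.npf[OF npf\<omega>]
  have af: "a \<in> funs BH" using a by (simp add: fpos_iff)
  have cp: "cut s a \<in> linf_pos BH" for s by (rule cut_linf_pos[OF H.fdB a])
  note cl = linf_posD[OF cp]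
  define S where "S \<tau> r \<longleftrightarrow> ((\<lambda>s. \<tau> (cut s a)) has_sum r) UNIV" for \<tau> :: "('i, 'b) fam \<Rightarrow> complex" and r
  have Scong: "S \<tau> r \<longleftrightarrow> S \<sigma> r" if "\<And>x. x \<in> linf BH \<Longrightarrow> \<tau> x = \<sigma> x" for \<tau> \<sigma> r
    using that[OF cl] by (simp only: S_def)
  have Sq: "S (sesq BH t v v) (sesq BH t v v a)" for t v
    unfolding S_def by (rule has_sum_finite_neutralI[of "{t}"]) (auto simp: sesq_cut)
  let ?P = "conv_pow_Suc \<Delta>H \<phi>"
  have P: "npf BH (?P n)" for n by (rule H.npf_conv_pow[OF \<phi>(1)])

  obtain M C where C: "C \<ge> 0" "\<And>x. x \<in> linf_pos BH \<Longrightarrow> \<omega> x \<le> of_real C * (\<Sum>m<M. ?P m x)"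
    using averaging_dominated[OF \<omega> P H.generating_faithful[OF \<phi> gen]] by blast
  have CM: "1 \<le> C * real M"
    using C(2)[OF fone_linf_pos[OF H.fdB]] by (simp add: \<omega>1 H.conv_pow_one[OF \<phi>] less_eq_complex_def)
  then have M: "M > 0" by (cases M) auto
  define \<psi> where "\<psi> x = of_real (1 / real M) * (\<Sum>m<M. ?P m x)" for x
  \<comment> \<open>This is the constant for which \<open>c C\<close> is the weight \<open>1 / M\<close> of each power in \<open>\<psi>\<close>.\<close>
  define c where "c = 1 / (C * real M)"
  have c: "0 < c" "c \<le> 1" using CM by (auto simp: c_def divide_le_eq)
  have \<psi>: "npf BH \<psi>" unfolding \<psi>_def[abs_def] by (intro npf_scale npf_sum P) simp
  have c\<omega>\<psi>: "of_real c * \<omega> x \<le> \<psi> x" if x: "x \<in> linf_pos BH" for x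
  proof -
    have "of_real c * \<omega> x \<le> of_real c * (of_real C * (\<Sum>m<M. ?P m x))"
      using C(2)[OF x] c(1) by (intro mult_left_mono) (auto simp: less_eq_complex_def)
    also have "\<dots> = of_real (c * C) * (\<Sum>m<M. ?P m x)" by (simp only: of_real_mult mult.assoc)
    also have "c * C = 1 / real M" using CM by (auto simp: c_def)
    finally show ?thesis by (simp only: \<psi>_def)
  qed
  \<comment> \<open>Averaging the harmonicity relations for the powers of \<open>\<phi>\<close>.\<close>
  have S\<psi>: "S (conv \<Delta>H \<psi> \<tau>) r" if \<tau>: "npf BH \<tau>" and r: "S \<tau> r" for \<tau> r
  proof -
    have "((\<lambda>s. conv \<Delta>H (?P m) \<tau> (cut s a)) has_sum r) UNIV" for m
      using H.harmonic_value_power_iff[OF \<phi>(1) \<tau> a harm] r by (simp only: S_def)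
    then have "((\<lambda>s. of_real (1 / real M) * (\<Sum>m<M. conv \<Delta>H (?P m) \<tau> (cut s a))) has_sum
        of_real (1 / real M) * (\<Sum>m<M. r)) UNIV"
      by (intro has_sum_cmult_right has_sum_sum)
    moreover have "of_real (1 / real M) * (\<Sum>m<M. r) = r" using M by simp
    ultimately show ?thesis by (simp only: S_def \<psi>_def conv_eq_rconv_op)
  qed
  define \<rho> where "\<rho> x = \<psi> x - of_real c * \<omega> x" for x
  have \<rho>: "npf BH \<rho>"
    unfolding \<rho>_def[abs_def] using c by (intro npf_diff \<psi> npf_scale npf\<omega> c\<omega>\<psi>) auto
  have S\<omega>: "\<exists>r'. S (conv \<Delta>H \<omega> \<tau>) r'" if \<tau>: "npf BH \<tau>" and r: "S \<tau> r" for \<tau> r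
  proof -
    let ?g = "\<lambda>s. of_real (1 / c) * conv \<Delta>H \<psi> \<tau> (cut s a)"
    have gs: "(?g has_sum of_real (1 / c) * r) UNIV"
      using S\<psi>[OF \<tau> r] unfolding S_def by (rule has_sum_cmult_right)
    have bd: "0 \<le> conv \<Delta>H \<omega> \<tau> (cut s a) \<and> conv \<Delta>H \<omega> \<tau> (cut s a) \<le> ?g s" for s
    proof
      let ?z = "rconv_op \<Delta>H \<tau> (cut s a)"
      have z: "?z \<in> linf_pos BH" by (rule pnm_linf_pos[OF H.pnm_rconv_op[OF \<tau>] cp])
      show "0 \<le> conv \<Delta>H \<omega> \<tau> (cut s a)" unfolding conv_eq_rconv_op by (rule npf_pos[OF npf\<omega> z])
      have "of_real (1 / c) * (of_real c * \<omega> ?z) \<le> of_real (1 / c) * \<psi> ?z"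
        using c\<omega>\<psi>[OF z] c(1) by (intro mult_left_mono) (auto simp: less_eq_complex_def)
      moreover have "of_real (1 / c) * (of_real c * \<omega> ?z) = \<omega> ?z" using c(1) by simp
      ultimately show "conv \<Delta>H \<omega> \<tau> (cut s a) \<le> ?g s" unfolding conv_eq_rconv_op by (simp only:)
    qed
    have "\<exists>r'. ((\<lambda>s. conv \<Delta>H \<omega> \<tau> (cut s a)) has_sum r') UNIV \<and> 0 \<le> r' \<and> r' \<le> of_real (1 / c) * r"
      by (rule has_sum_dominated[OF gs bd])
    then show ?thesis unfolding S_def by blast
  qed
  have S0: "0 \<le> r" if "npf BH \<tau>" "S \<tau> r" for \<tau> r
    using that(2) unfolding S_def by (rule has_sum_nonneg_complex) (rule npf_pos[OF that(1) cp])

  \<comment> \<open>The values of \<open>a\<close> satisfy \<open>\<tau>(a) = c (\<omega> \<star> \<tau>)(a) + (\<rho> \<star> \<tau>)(a)\<close>, and the induction hypothesis applies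
    to \<open>\<rho> \<star> \<tau>\<close>, whose average \<open>\<omega> \<star> \<rho> \<star> \<tau>\<close> has the value \<open>(1 - c) (\<omega> \<star> \<tau>)(a)\<close> by centrality of \<open>\<omega>\<close>.\<close>
  have iterate: "(1 - (1 - c) ^ n) * Re r' \<le> Re r"
    if "npf BH \<tau>" "S \<tau> r" "S (conv \<Delta>H \<omega> \<tau>) r'" for n \<tau> r r'
    using that
  proof (induction n arbitrary: \<tau> r r')
    case 0
    then show ?case using S0[OF 0(1,2)] by (simp add: less_eq_complex_def)
  next
    case (Suc n)
    note \<tau> = Suc.prems(1)
    note n\<tau> = nfun.npf[OF \<tau>]
    have "S (conv \<Delta>H \<rho> \<tau>) (r + (- of_real c) * r')"
    proof -
      have "S (\<lambda>x. conv \<Delta>H \<psi> \<tau> x + (- of_real c) * conv \<Delta>H \<omega> \<tau> x) (r + (- of_real c) * r')"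
        using S\<psi>[OF \<tau> Suc.prems(2)] Suc.prems(3) unfolding S_def
        by (intro has_sum_add has_sum_cmult_right)
      then show ?thesis by (simp add: conv_eq_rconv_op \<rho>_def S_def)
    qed
    moreover have "S (conv \<Delta>H \<omega> (conv \<Delta>H \<rho> \<tau>)) (r' + (- of_real c) * r')"
    proof -
      have e1: "conv \<Delta>H \<omega> (conv \<Delta>H \<rho> \<tau>) x
          = conv \<Delta>H \<psi> (conv \<Delta>H \<omega> \<tau>) x + (- of_real c) * conv \<Delta>H \<omega> \<tau> x" if x: "x \<in> linf BH" for x
      proof -
        let ?z = "rconv_op \<Delta>H \<tau> x"
        have z: "?z \<in> linf BH" by (rule H.rconv_op_linf[OF n\<tau> x])
        have idem: "conv \<Delta>H \<omega> \<omega> ?z = \<omega> ?z" by (rule averaging_idempotent[OF \<omega> z])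
        have "conv \<Delta>H \<omega> (conv \<Delta>H \<rho> \<tau>) x = conv \<Delta>H (conv \<Delta>H \<omega> \<rho>) \<tau> x"
          by (rule H.conv_assoc[OF n\<tau> x, symmetric])
        also have "\<dots> = conv \<Delta>H \<omega> \<rho> ?z" by (rule conv_eq_rconv_op)
        also have "\<dots> = conv \<Delta>H \<rho> \<omega> ?z" by (rule averaging_central[OF \<omega> nfun.npf[OF \<rho>] z])
        also have "\<dots> = conv \<Delta>H \<psi> \<omega> ?z - of_real c * conv \<Delta>H \<omega> \<omega> ?z"
          by (simp only: conv_eq_rconv_op \<rho>_def)
        also have "conv \<Delta>H \<psi> \<omega> ?z = conv \<Delta>H (conv \<Delta>H \<psi> \<omega>) \<tau> x" by (rule conv_eq_rconv_op[symmetric])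
        also have "\<dots> = conv \<Delta>H \<psi> (conv \<Delta>H \<omega> \<tau>) x" by (rule H.conv_assoc[OF n\<tau> x])
        also have "conv \<Delta>H \<omega> \<omega> ?z = conv \<Delta>H \<omega> \<tau> x" unfolding idem by (rule conv_eq_rconv_op[symmetric])
        finally show ?thesis by simp
      qed
      have e2: "S (\<lambda>x. conv \<Delta>H \<psi> (conv \<Delta>H \<omega> \<tau>) x + (- of_real c) * conv \<Delta>H \<omega> \<tau> x) (r' + (- of_real c) * r')"
        using S\<psi>[OF H.npf_conv[OF npf\<omega> \<tau>] Suc.prems(3)] Suc.prems(3) unfolding S_def
        by (intro has_sum_add has_sum_cmult_right)
      show ?thesis by (rule iffD2[OF Scong e2]) (rule e1)
    qed
    ultimately have "(1 - (1 - c) ^ n) * Re (r' + (- of_real c) * r') \<le> Re (r + (- of_real c) * r')"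
      by (intro Suc.IH[OF H.npf_conv[OF \<rho> \<tau>]])
    then show ?case by (simp add: algebra_simps)
  qed
  have S_le: "Re r' \<le> Re r" if "npf BH \<tau>" "S \<tau> r" "S (conv \<Delta>H \<omega> \<tau>) r'" for \<tau> r r'
  proof -
    have "(\<lambda>n. (1 - (1 - c) ^ n) * Re r') \<longlonglongrightarrow> (1 - 0) * Re r'"
      using c by (intro tendsto_intros LIMSEQ_power_zero) auto
    then have "(1 - 0) * Re r' \<le> Re r"
      by (rule LIMSEQ_le_const2) (use iterate[OF that] in blast)
    then show ?thesis by simp
  qed

  have "\<exists>r. S (conv \<Delta>H \<omega> (sesq BH t v v)) r" for t v
    by (rule S\<omega>[OF npf_sesq[OF H.fdB] Sq])
  then obtain q where q: "\<And>t v. S (conv \<Delta>H \<omega> (sesq BH t v v)) (q t v)" by metis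
  define X where "X s = conv_op \<Delta>H \<omega> (cut s a)" for s
  have Xp: "X s \<in> linf_pos BH" for s
    unfolding X_def by (rule pnm_linf_pos[OF H.pnm_conv_op[OF npf\<omega>] cp])
  note Xf = linf_funs[OF linf_posD[OF Xp]]
  have Xconv: "conv \<Delta>H \<omega> \<tau> (cut s a) = \<tau> (X s)" if "nfun BH \<tau>" for \<tau> s
    unfolding X_def by (rule H.conv_eq_conv_op[OF n\<omega> that cl])
  have Xq: "((\<lambda>s. sesq BH t v v (X s)) has_sum q t v) UNIV" for t v
    using q[of t v] unfolding S_def Xconv[OF nfun.npf[OF npf_sesq[OF H.fdB]]] .
  \<comment> \<open>The average \<open>b = (\<omega> \<otimes> \<iota>)\<Delta>(a)\<close> of the unbounded function \<open>a\<close>.\<close>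
  define b where "b = (\<lambda>t i j. infsum (\<lambda>s. X s t i j) UNIV)"
  have b: "((\<lambda>s. X s t i j) has_sum b t i j) UNIV" for t i j
    unfolding b_def by (rule has_sum_infsum[OF summable_polarize[OF H.fdB Xf has_sum_imp_summable[OF Xq]]])
  have bf: "b \<in> funs BH"
  proof (rule funsI)
    fix t i j assume "i \<notin> BH t \<or> j \<notin> BH t"
    then have "X s t i j = 0" for s using funs_zero[OF Xf] by blast
    then show "b t i j = 0" by (simp add: b_def)
  qed
  have bq: "sesq BH t v v b = q t v" for t v
  proof -
    have "((\<lambda>s. sesq BH t v v (X s)) has_sum sesq BH t v v b) UNIV" by (rule has_sum_sesq) (rule b)
    then show ?thesis by (rule has_sum_unique[OF _ Xq])
  qed
  let ?g = "a - b"
  have g: "fpos BH ?g"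
    unfolding fpos_iff
  proof (intro conjI allI)
    show "?g \<in> funs BH" by (rule funs_diff[OF af bf])
    fix t v
    have "0 \<le> q t v" by (rule S0[OF H.npf_conv[OF npf\<omega> npf_sesq[OF H.fdB]] q])
    then show "0 \<le> sesq BH t v v ?g"
      using S_le[OF npf_sesq[OF H.fdB] Sq q, of t v] fposD[OF a, of t v]
      by (simp add: sesq_diff bq less_eq_complex_def)
  qed
  \<comment> \<open>Both \<open>a\<close> and \<open>b\<close> have the average \<open>b\<close>, since \<open>\<omega> \<star> \<omega> = \<omega>\<close>.\<close>
  have "cut s ?g = 0" for s
  proof (rule averaging_nondegenerate[OF \<omega> cut_linf_pos[OF H.fdB g]])
    show "cut s ?g \<in> cfin BH" by (rule cut_cfin[OF funs_diff[OF af bf]])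
    fix t v
    let ?\<tau> = "conv \<Delta>H \<omega> (sesq BH t v v)"
    have \<tau>: "npf BH ?\<tau>" by (rule H.npf_conv[OF npf\<omega> npf_sesq[OF H.fdB]])
    note lin = npf_linear[OF \<tau>] and nq = nfun.npf[OF npf_sesq[OF H.fdB, of t v]]
    have "S (conv \<Delta>H \<omega> ?\<tau>) (q t v)"
    proof -
      have e: "conv \<Delta>H \<omega> ?\<tau> x = ?\<tau> x" if x: "x \<in> linf BH" for x
      proof -
        let ?z = "rconv_op \<Delta>H (sesq BH t v v) x"
        have z: "?z \<in> linf BH" by (rule H.rconv_op_linf[OF nq x])
        have "conv \<Delta>H \<omega> \<omega> ?z = \<omega> ?z" by (rule averaging_idempotent[OF \<omega> z])
        then show ?thesis
          unfolding H.conv_assoc[OF nq x, symmetric] conv_eq_rconv_op[of \<Delta>H _ "sesq BH t v v"] .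
      qed
      show ?thesis by (rule iffD2[OF Scong q]) (rule e)
    qed
    then have "((\<lambda>s. ?\<tau> (X s)) has_sum q t v) UNIV"
      unfolding S_def Xconv[OF nfun.npf[OF \<tau>]] .
    then have "((\<lambda>s. ?\<tau> (cut s b)) has_sum q t v) UNIV"
      using npf_has_sum_family[OF H.fdB \<tau> Xp b bf] by blast
    then have "((\<lambda>s. ?\<tau> (cut s a) + - ?\<tau> (cut s b)) has_sum q t v + - q t v) UNIV"
      using q[of t v] unfolding S_def by (intro has_sum_add has_sum_uminusI)
    moreover have "?\<tau> (cut s a) + - ?\<tau> (cut s b) = ?\<tau> (cut s ?g)" for s
    proof -
      have "cut s ?g = cut s a - cut s b" by (auto simp: cut_def fun_eq_iff)
      then show ?thesis
        using linear_fun_diff[OF lin cl cut_linf[OF H.fdB bf], of s s] by (simp only: uminus_add_conv_diff diff_conv_add_uminus)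
    qed
    ultimately have "((\<lambda>s. ?\<tau> (cut s ?g)) has_sum 0) UNIV" by simp
    then show "?\<tau> (cut s ?g) = 0"
      by (rule nonneg_has_sum_le_0D_complex) (auto intro: npf_pos[OF \<tau> cut_linf_pos[OF H.fdB g]])
  qed
  then have "?g s i j = 0" for s i j
    by (metis (full_types) cut_def zero_fun_apply)
  then have ab: "a = b" by (intro ext) simp
  show ?thesis
    using b unfolding extends_to_def ab[symmetric] X_def by blast
qed

text \<open>
  For a positive functional \<open>\<eta>\<close> on \<open>C(G)\<close> and \<open>\<sigma> = \<eta> \<circ> \<pi>\<close>, invariance of \<open>\<omega>\<close> gives
  \<open>(\<sigma> \<star> \<tau>)(a) = (\<omega> \<star> \<sigma> \<star> \<tau>)(a) = \<eta>(1) (\<omega> \<star> \<tau>)(a) = \<eta>(1) \<tau>(a)\<close>.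
\<close>

lemma G_invariant_if_averaging_fixes:
  assumes \<omega>: "averaging_state \<omega>" and a: "fpos BH a" and harm\<omega>: "extends_to (conv_op \<Delta>H \<omega>) a a"
  shows "G_invariant \<Delta>H BG \<pi> a"
proof -
  have npf\<omega>: "npf BH \<omega>" using \<omega> by (simp add: averaging_state_def)
  have invL: "conv \<Delta>H \<omega> (\<lambda>x. \<eta> (\<pi> x)) y = \<eta> (fone BG) * \<omega> y" if "nfun BG \<eta>" "y \<in> linf BH" for \<eta> y
    using \<omega> that by (auto simp: averaging_state_def)
  have af: "a \<in> funs BH" using a by (simp add: fpos_iff)
  have cl: "cut s a \<in> linf BH" for s by (rule cut_linf[OF H.fdB af])
  have left: "((\<lambda>s. conv_op \<Delta>H (\<lambda>x. \<eta> (\<pi> x)) (cut s a) t m n) has_sum \<eta> (fone BG) * a t m n) UNIV"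
    if "nfun BG \<eta>" for \<eta> t m n
    using that
  proof (induction rule: nfun.induct)
    case (npf \<eta>)
    let ?\<sigma> = "\<lambda>x. \<eta> (\<pi> x)"
    have \<sigma>: "npf BH ?\<sigma>" by (rule npf_res[OF npf])
    note n\<sigma> = nfun.npf[OF \<sigma>]
    have "((\<lambda>s. sesq BH t v v (conv_op \<Delta>H ?\<sigma> (cut s a))) has_sum sesq BH t v v (fscale (\<eta> (fone BG)) a)) UNIV" for v
    proof -
      let ?q = "sesq BH t v v"
      have nq: "nfun BH ?q" and pq: "npf BH ?q" by (auto intro: nfun.npf npf_sesq H.fdB)
      have "((\<lambda>s. ?q (cut s a)) has_sum ?q a) UNIV"
        by (rule has_sum_finite_neutralI[of "{t}"]) (auto simp: sesq_cut)
      then have "((\<lambda>s. conv \<Delta>H \<omega> ?q (cut s a)) has_sum ?q a) UNIV"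
        unfolding H.harmonic_value_iff[OF npf\<omega> pq a harm\<omega>] .
      then have "((\<lambda>s. \<eta> (fone BG) * conv \<Delta>H \<omega> ?q (cut s a)) has_sum \<eta> (fone BG) * ?q a) UNIV"
        by (rule has_sum_cmult_right)
      moreover have "conv \<Delta>H \<omega> (conv \<Delta>H ?\<sigma> ?q) (cut s a) = \<eta> (fone BG) * conv \<Delta>H \<omega> ?q (cut s a)" for s
      proof -
        have "conv \<Delta>H \<omega> (conv \<Delta>H ?\<sigma> ?q) (cut s a) = conv \<Delta>H (conv \<Delta>H \<omega> ?\<sigma>) ?q (cut s a)"
          by (rule H.conv_assoc[OF nq cl, symmetric])
        also have "\<dots> = conv \<Delta>H (\<lambda>x. \<eta> (fone BG) * \<omega> x) ?q (cut s a)"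
          by (rule H.conv_cong_left[OF nq cl]) (rule invL[OF nfun.npf[OF npf]])
        also have "\<dots> = \<eta> (fone BG) * conv \<Delta>H \<omega> ?q (cut s a)" by (simp only: conv_eq_rconv_op)
        finally show ?thesis .
      qed
      ultimately have "((\<lambda>s. conv \<Delta>H \<omega> (conv \<Delta>H ?\<sigma> ?q) (cut s a)) has_sum \<eta> (fone BG) * ?q a) UNIV"
        by (simp only:)
      then have "((\<lambda>s. conv \<Delta>H ?\<sigma> ?q (cut s a)) has_sum \<eta> (fone BG) * ?q a) UNIV"
        unfolding H.harmonic_value_iff[OF npf\<omega> H.npf_conv[OF \<sigma> pq] a harm\<omega>] .
      then show ?thesis
        unfolding H.conv_eq_conv_op[OF n\<sigma> nq cl] sesq_scale .
    qed
    then have "((\<lambda>s. conv_op \<Delta>H ?\<sigma> (cut s a) t m n) has_sum fscale (\<eta> (fone BG)) a t m n) UNIV"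
      by (rule has_sum_polarize[OF H.fdB linf_funs[OF H.conv_op_linf[OF n\<sigma> cl]] funs_scale[OF af]])
    then show ?case by (simp only: fscale_apply)
  next
    case (add \<eta> \<zeta>)
    show ?case using has_sum_add[OF add.IH] by (simp only: conv_op_def fun_id_def distrib_right)
  next
    case (scale \<eta> c)
    show ?case using has_sum_cmult_right[OF scale.IH, of c] by (simp only: conv_op_def fun_id_def mult.assoc)
  next
    case (cong \<eta> \<zeta>)
    have "conv_op \<Delta>H (\<lambda>x. \<zeta> (\<pi> x)) (cut s a) t m n = conv_op \<Delta>H (\<lambda>x. \<eta> (\<pi> x)) (cut s a) t m n" for s
      unfolding conv_op_def fun_id_def
      by (rule cong.hyps(2)[OF res_linf[OF slice1_linf[OF H.fdB H.fdB H.comult_linf[OF cl]]]])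
    then show ?case using cong.IH cong.hyps(2)[OF fone_linf[OF G.fdB]] by (simp only:)
  qed
  show ?thesis
    unfolding G_invariant_def extends_to_def
  proof (intro allI)
    fix u :: "'j \<times> 'i" and k l :: "'c \<times> 'b"
    obtain j t k1 k2 l1 l2 where u: "u = (j, t)" "k = (k1, k2)" "l = (l1, l2)" by (metis prod.exhaust)
    have "left_action \<Delta>H \<pi> (cut s a) u k l = conv_op \<Delta>H (\<lambda>x. \<pi> x j k1 l1) (cut s a) t k2 l2" for s
      by (simp add: left_action_def map_id_def u conv_op_def fun_id_def)
    moreover have "(fone BG \<otimes>\<^sub>F a) u k l = fone BG j k1 l1 * a t k2 l2" by (simp add: ftens_def u)
    ultimately show "((\<lambda>s. left_action \<Delta>H \<pi> (cut s a) u k l) has_sum (fone BG \<otimes>\<^sub>F a) u k l) UNIV"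
      using left[OF nfun_entryG[of j k1 l1], of t k2 l2] by (simp only:)
  qed
qed

end

theorem theorem1p1:
  fixes BH :: "'i \<Rightarrow> 'b set" and \<Delta>H :: "('i, 'b) fam \<Rightarrow> ('i \<times> 'i, 'b \<times> 'b) fam"
    and BG :: "'j \<Rightarrow> 'c set" and \<Delta>G :: "('j, 'c) fam \<Rightarrow> ('j \<times> 'j, 'c \<times> 'c) fam"
    and \<pi> :: "('i, 'b) fam \<Rightarrow> ('j, 'c) fam"
    and \<phi> :: "('i, 'b) fam \<Rightarrow> complex"
    and a :: "('i, 'b) fam"
  assumes "discrete_quantum_group BH \<Delta>H"
    and "finite_normal_quantum_subgroup BH \<Delta>H BG \<Delta>G \<pi>"
    and "normal_state BH \<phi>"
    and "generating BH \<Delta>H \<phi>"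
    and "positive_harmonic BH \<Delta>H \<phi> a"
  shows "G_invariant \<Delta>H BG \<pi> a"
proof -
  interpret finite_normal_quantum_subgroup BH \<Delta>H BG \<Delta>G \<pi> by (rule assms(2))
  have \<phi>: "npf BH \<phi>" "\<phi> (fone BH) = 1"
    using npf_normal_state[OF H.fdB assms(3)] assms(3) by (simp_all add: normal_state_def)
  have a: "fpos BH a" and harm: "extends_to (conv_op \<Delta>H \<phi>) a a"
    using assms(5) by (simp_all add: positive_harmonic_def)
  obtain \<omega> where \<omega>: "averaging_state \<omega>" using averaging_state_exists by blast
  show ?thesis
    by (rule G_invariant_if_averaging_fixes[OF \<omega> a averaging_fixes_harmonic[OF \<phi> assms(4) a harm \<omega>]])
qed

end
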